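(* Let $\mathbf{C}$ be a set. The $4$-polygraph $\mathbf{BiCat}[\mathbf{C}]$ is $3$-convergent and the free $(4,2)$-category $\mathbf{BiCat}[\mathbf{C}]^{*(2)}$ is $3$-coherent.
   Context: **Higher categories and polygraphs.** All $n$-categories are strict and globular; $\star_i$ is composition along $i$-cells, written in diagrammatic order; a lower-dimensional cell occurring in a composite stands for its identity. An $(n,p)$-category is an $n$-category in which every $(i+1)$-cell is invertible for $\star_i$, for all $i\ge p$. An $n$-polygraph $\Sigma$ consists of sets $\Sigma_0,\dots,\Sigma_n$ of generating cells, where inductively $\Sigma_{k+1}$ comes with source and target maps into parallel $k$-cells of the free $k$-category $\Sigma_k^*$ generated by the generating cells of dimension $\le k$, and $\Sigma_{k+1}^*$ is obtained by freely adjoining $\Sigma_{k+1}$. The free $(n,p)$-category $\Sigma^{*(p)}$ generated by $\Sigma$ is obtained by adjoining moreover inverses of all generating cells of dimension $>p$. **Rewriting.** Let $\Sigma$ be a $4$-polygraph. For $2$-cells $u,v\in\Sigma_2^*$ write $u\to_3^* v$ if there is a $3$-cell $u\Rrightarrow v$ in $\Sigma_3^*$. $\Sigma$ is $3$-terminating if $\to_3^*$ is a well-founded (partial) ordering; it is $3$-confluent if for all $3$-cells $A,B\in\Sigma_3^*$ with the same source there are $A',B'\in\Sigma_3^*$ such that $A\star_2 A'$ and $B\star_2 B'$ are defined and have the same target; it is $3$-convergent if both hold. A $4$-category is $3$-coherent if for every pair $(f,g)$ of parallel $3$-cells (same source, same target) there is a $4$-cell $f\to g$. **The $4$-polygraph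 $\mathbf{BiCat}[\mathbf{C}]$.** Its generating cells, for all $a,b,c,d,e\in\mathbf{C}$, are: Dimension 0: the elements of $\mathbf{C}$. Dimension 1: $e_{a,b}:a\to b$. Dimension 2: $m_{a,b,c}: e_{a,b}\star_0 e_{b,c}\Rightarrow e_{a,c}$ and $i_a: 1_a\Rightarrow e_{a,a}$. Dimension 3: $\alpha_{a,b,c,d}: (m_{a,b,c}\star_0 e_{c,d})\star_1 m_{a,c,d}\Rrightarrow (e_{a,b}\star_0 m_{b,c,d})\star_1 m_{a,b,d}$; $\lambda_{a,b}:(i_a\star_0 e_{a,b})\star_1 m_{a,a,b}\Rrightarrow e_{a,b}$; $\rho_{a,b}:(e_{a,b}\star_0 i_b)\star_1 m_{a,b,b}\Rrightarrow e_{a,b}$ (targets of $\lambda,\rho$ being identity $2$-cells). Dimension 4: $\pi_{a,b,c,d,e}$ with source $$\big((\alpha_{a,b,c,d}\star_0 e_{d,e})\star_1 m_{a,d,e}\big)\star_2\big((e_{a,b}\star_0 m_{b,c,d}\star_0 e_{d,e})\star_1\alpha_{a,b,d,e}\big)\star_2\big((e_{a,b}\star_0\alpha_{b,c,d,e})\star_1 m_{a,b,e}\big)$$ and target $$\big((m_{a,b,c}\star_0 e_{c,d}\star_0 e_{d,e})\star_1\alpha_{a,c,d,e}\big)\star_2\big((e_{a,b}\star_0 e_{b,c}\star_0 m_{c,d,e})\star_1\alpha_{a,b,c,e}\big);$$ and $\kappa_{a,b,c}$ with source $\big((e_{a,b}\star_0 i_b\star_0 e_{b,c})\star_1\alpha_{a,b,b,c}\big)\star_2\big((e_{a,b}\star_0\lambda_{b,c})\star_1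 m_{a,b,c}\big)$ and target $(\rho_{a,b}\star_0 e_{b,c})\star_1 m_{a,b,c}$. *)

theory Defs
  imports Main
begin

section \<open>Strict globular higher categories\<close>

text \<open>
  Cells of all dimensions live in one type; \<open>csrc\<close> and \<open>ctgt\<close> lower the dimension by one,
  \<open>cid\<close> raises it by one, and \<open>ccomp K i\<close> is composition along \<open>i\<close>-cells in diagrammatic order.
  The operations are only meaningful on cells (and composites only on composable pairs).
\<close>

record 'c cat_data =
  cells :: "nat \<Rightarrow> 'c set"
  csrc :: "'c \<Rightarrow> 'c"
  ctgt :: "'c \<Rightarrow> 'c"
  cid :: "'c \<Rightarrow> 'c"
  ccomp :: "nat \<Rightarrow> 'c \<Rightarrow> 'c \<Rightarrow> 'c"

text \<open>The \<open>i\<close>-dimensional source and target, and the iterated identity in dimension \<open>k\<close>,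
  of a \<open>k\<close>-cell respectively of an \<open>i\<close>-cell.\<close>

definition csrc_at :: "('c, 'm) cat_data_scheme \<Rightarrow> nat \<Rightarrow> nat \<Rightarrow> 'c \<Rightarrow> 'c" where
  "csrc_at K k i x = (csrc K ^^ (k - i)) x"

definition ctgt_at :: "('c, 'm) cat_data_scheme \<Rightarrow> nat \<Rightarrow> nat \<Rightarrow> 'c \<Rightarrow> 'c" where
  "ctgt_at K k i x = (ctgt K ^^ (k - i)) x"

definition cid_at :: "('c, 'm) cat_data_scheme \<Rightarrow> nat \<Rightarrow> nat \<Rightarrow> 'c \<Rightarrow> 'c" where
  "cid_at K i k x = (cid K ^^ (k - i)) x"

definition composable :: "('c, 'm) cat_data_scheme \<Rightarrow> nat \<Rightarrow> nat \<Rightarrow> 'c \<Rightarrow> 'c \<Rightarrow> bool" where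
  "composable K k i x y \<longleftrightarrow>
     x \<in> cells K k \<and> y \<in> cells K k \<and> i < k \<and> ctgt_at K k i x = csrc_at K k i y"

definition parallel :: "('c, 'm) cat_data_scheme \<Rightarrow> nat \<Rightarrow> 'c \<Rightarrow> 'c \<Rightarrow> bool" where
  "parallel K k x y \<longleftrightarrow>
     x \<in> cells K k \<and> y \<in> cells K k \<and> (0 < k \<longrightarrow> csrc K x = csrc K y \<and> ctgt K x = ctgt K y)"

locale strict_ncategory =
  fixes n :: nat and K :: "('c, 'm) cat_data_scheme"
  assumes dim_le: "x \<in> cells K k \<Longrightarrow> k \<le> n"
    and csrc_cell: "x \<in> cells K (Suc k) \<Longrightarrow> csrc K x \<in> cells K k"
    and ctgt_cell: "x \<in> cells K (Suc k) \<Longrightarrow> ctgt K x \<in> cells K k"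
    and globular: "x \<in> cells K (Suc k) \<Longrightarrow> parallel K k (csrc K x) (ctgt K x)"
    and cid_cell: "x \<in> cells K k \<Longrightarrow> k < n \<Longrightarrow> cid K x \<in> cells K (Suc k)"
    and csrc_cid: "x \<in> cells K k \<Longrightarrow> k < n \<Longrightarrow> csrc K (cid K x) = x"
    and ctgt_cid: "x \<in> cells K k \<Longrightarrow> k < n \<Longrightarrow> ctgt K (cid K x) = x"
    and ccomp_cell: "composable K k i x y \<Longrightarrow> ccomp K i x y \<in> cells K k"
    and csrc_ccomp: "composable K k i x y \<Longrightarrow>
      csrc K (ccomp K i x y) = (if Suc i = k then csrc K x else ccomp K i (csrc K x) (csrc K y))"
    and ctgt_ccomp: "composable K k i x y \<Longrightarrow>
      ctgt K (ccomp K i x y) = (if Suc i = k then ctgt K y else ccomp K i (ctgt K x) (ctgt K y))"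
    and assoc: "composable K k i x y \<Longrightarrow> composable K k i y z \<Longrightarrow>
      ccomp K i (ccomp K i x y) z = ccomp K i x (ccomp K i y z)"
    and unit_left: "x \<in> cells K k \<Longrightarrow> i < k \<Longrightarrow>
      ccomp K i (cid_at K i k (csrc_at K k i x)) x = x"
    and unit_right: "x \<in> cells K k \<Longrightarrow> i < k \<Longrightarrow>
      ccomp K i x (cid_at K i k (ctgt_at K k i x)) = x"
    and exchange: "i < j \<Longrightarrow> composable K k j x x' \<Longrightarrow> composable K k j y y' \<Longrightarrow>
      composable K k i (ccomp K j x x') (ccomp K j y y') \<Longrightarrow>
      ccomp K i (ccomp K j x x') (ccomp K j y y') = ccomp K j (ccomp K i x y) (ccomp K i x' y')"
    and cid_ccomp: "composable K k i x y \<Longrightarrow> k < n \<Longrightarrow>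
      cid K (ccomp K i x y) = ccomp K i (cid K x) (cid K y)"

definition invertible_cell :: "('c, 'm) cat_data_scheme \<Rightarrow> nat \<Rightarrow> 'c \<Rightarrow> bool" where
  "invertible_cell K i x \<longleftrightarrow>
     (\<exists>y. composable K (Suc i) i x y \<and> composable K (Suc i) i y x \<and>
          ccomp K i x y = cid K (csrc K x) \<and> ccomp K i y x = cid K (ctgt K x))"

locale strict_npcategory = strict_ncategory n K
  for n :: nat and p :: nat and K :: "('c, 'm) cat_data_scheme" +
  assumes invertible: "p \<le> i \<Longrightarrow> x \<in> cells K (Suc i) \<Longrightarrow> invertible_cell K i x"


section \<open>Polygraphs and the free categories on them\<close>

text \<open>
  The cells of free categories are classes of terms. \<open>GenInv g\<close> is the formal inverse of a
  generating cell \<open>g\<close>, \<open>Ident t\<close> the identity on \<open>t\<close>.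
\<close>

datatype 'g cell_term =
    Gen 'g
  | GenInv 'g
  | Ident "'g cell_term"
  | Comp nat "'g cell_term" "'g cell_term"

record 'g polygraph_data =
  gens :: "'g set"
  gdim :: "'g \<Rightarrow> nat"
  gsrc :: "'g \<Rightarrow> 'g cell_term"
  gtgt :: "'g \<Rightarrow> 'g cell_term"

primrec term_dim :: "('g \<Rightarrow> nat) \<Rightarrow> 'g cell_term \<Rightarrow> nat" where
  "term_dim d (Gen g) = d g"
| "term_dim d (GenInv g) = d g"
| "term_dim d (Ident t) = Suc (term_dim d t)"
| "term_dim d (Comp i t u) = term_dim d t"

abbreviation tdim :: "'g polygraph_data \<Rightarrow> 'g cell_term \<Rightarrow> nat" where
  "tdim S \<equiv> term_dim (gdim S)"

primrec tsrc :: "'g polygraph_data \<Rightarrow> 'g cell_term \<Rightarrow> 'g cell_term" where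
  "tsrc S (Gen g) = gsrc S g"
| "tsrc S (GenInv g) = gtgt S g"
| "tsrc S (Ident t) = t"
| "tsrc S (Comp i t u) = (if Suc i = tdim S t then tsrc S t else Comp i (tsrc S t) (tsrc S u))"

primrec ttgt :: "'g polygraph_data \<Rightarrow> 'g cell_term \<Rightarrow> 'g cell_term" where
  "ttgt S (Gen g) = gtgt S g"
| "ttgt S (GenInv g) = gsrc S g"
| "ttgt S (Ident t) = t"
| "ttgt S (Comp i t u) = (if Suc i = tdim S t then ttgt S u else Comp i (ttgt S t) (ttgt S u))"

definition tsrc_at :: "'g polygraph_data \<Rightarrow> nat \<Rightarrow> 'g cell_term \<Rightarrow> 'g cell_term" where
  "tsrc_at S i t = (tsrc S ^^ (tdim S t - i)) t"

definition ttgt_at :: "'g polygraph_data \<Rightarrow> nat \<Rightarrow> 'g cell_term \<Rightarrow> 'g cell_term" where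
  "ttgt_at S i t = (ttgt S ^^ (tdim S t - i)) t"

text \<open>The axioms of strict \<open>n\<close>-categories, together with the equations making each formal
  inverse inverse to its generating cell; they are imposed whenever both sides are well formed.\<close>

inductive cat_law :: "'g polygraph_data \<Rightarrow> 'g cell_term \<Rightarrow> 'g cell_term \<Rightarrow> bool"
  for S :: "'g polygraph_data" where
  assoc: "cat_law S (Comp i (Comp i t u) v) (Comp i t (Comp i u v))"
| unit_left: "i < tdim S t \<Longrightarrow>
    cat_law S (Comp i ((Ident ^^ (tdim S t - i)) (tsrc_at S i t)) t) t"
| unit_right: "i < tdim S t \<Longrightarrow>
    cat_law S (Comp i t ((Ident ^^ (tdim S t - i)) (ttgt_at S i t))) t"
| exchange: "i < j \<Longrightarrow>
    cat_law S (Comp i (Comp j t t') (Comp j u u')) (Comp j (Comp i t u) (Comp i t' u'))"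
| id_comp: "cat_law S (Ident (Comp i t u)) (Comp i (Ident t) (Ident u))"
| inv_right: "gdim S g = Suc i \<Longrightarrow> cat_law S (Comp i (Gen g) (GenInv g)) (Ident (gsrc S g))"
| inv_left: "gdim S g = Suc i \<Longrightarrow> cat_law S (Comp i (GenInv g) (Gen g)) (Ident (gtgt S g))"

text \<open>
  \<open>wf_term S n p\<close>: the terms denoting cells of the free \<open>(n,p)\<close>-category on (the part of dimension
  at most \<open>n\<close> of) \<open>S\<close>. \<open>term_eq S n p\<close>: two such terms denote the same cell. The definition is
  mutual because composability is equality of boundaries as cells.
\<close>

inductive wf_term :: "'g polygraph_data \<Rightarrow> nat \<Rightarrow> nat \<Rightarrow> 'g cell_term \<Rightarrow> bool"
  and term_eq :: "'g polygraph_data \<Rightarrow> nat \<Rightarrow> nat \<Rightarrow> 'g cell_term \<Rightarrow> 'g cell_term \<Rightarrow> bool"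
  for S :: "'g polygraph_data" and n p :: nat where
  wf_Gen: "g \<in> gens S \<Longrightarrow> gdim S g \<le> n \<Longrightarrow> wf_term S n p (Gen g)"
| wf_GenInv: "g \<in> gens S \<Longrightarrow> gdim S g \<le> n \<Longrightarrow> p < gdim S g \<Longrightarrow> wf_term S n p (GenInv g)"
| wf_Ident: "wf_term S n p t \<Longrightarrow> tdim S t < n \<Longrightarrow> wf_term S n p (Ident t)"
| wf_Comp: "wf_term S n p t \<Longrightarrow> wf_term S n p u \<Longrightarrow> tdim S t = tdim S u \<Longrightarrow> i < tdim S t \<Longrightarrow>
    term_eq S n p (ttgt_at S i t) (tsrc_at S i u) \<Longrightarrow> wf_term S n p (Comp i t u)"
| teq_refl: "wf_term S n p t \<Longrightarrow> term_eq S n p t t"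
| teq_sym: "term_eq S n p t u \<Longrightarrow> term_eq S n p u t"
| teq_trans: "term_eq S n p t u \<Longrightarrow> term_eq S n p u v \<Longrightarrow> term_eq S n p t v"
| teq_Ident: "term_eq S n p t u \<Longrightarrow> wf_term S n p (Ident t) \<Longrightarrow> wf_term S n p (Ident u) \<Longrightarrow>
    term_eq S n p (Ident t) (Ident u)"
| teq_Comp: "term_eq S n p t t' \<Longrightarrow> term_eq S n p u u' \<Longrightarrow>
    wf_term S n p (Comp i t u) \<Longrightarrow> wf_term S n p (Comp i t' u') \<Longrightarrow>
    term_eq S n p (Comp i t u) (Comp i t' u')"
| teq_law: "cat_law S t u \<Longrightarrow> wf_term S n p t \<Longrightarrow> wf_term S n p u \<Longrightarrow> term_eq S n p t u"

definition cell_class :: "'g polygraph_data \<Rightarrow> nat \<Rightarrow> nat \<Rightarrow> 'g cell_term \<Rightarrow> 'g cell_term set" where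
  "cell_class S n p t = {u. term_eq S n p t u}"

text \<open>The free \<open>(n,p)\<close>-category; operations on classes are computed on representatives.\<close>

definition free_npcat :: "nat \<Rightarrow> nat \<Rightarrow> 'g polygraph_data \<Rightarrow> 'g cell_term set cat_data" where
  "free_npcat n p S =
    \<lparr> cells = (\<lambda>k. {cell_class S n p t | t. wf_term S n p t \<and> tdim S t = k}),
      csrc = (\<lambda>X. \<Union>t\<in>X. cell_class S n p (tsrc S t)),
      ctgt = (\<lambda>X. \<Union>t\<in>X. cell_class S n p (ttgt S t)),
      cid = (\<lambda>X. \<Union>t\<in>X. cell_class S n p (Ident t)),
      ccomp = (\<lambda>i X Y. \<Union>t\<in>X. \<Union>u\<in>Y. cell_class S n p (Comp i t u)) \<rparr>"

text \<open>For \<open>p = n\<close> there are no formal inverses.\<close>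

definition free_ncat :: "nat \<Rightarrow> 'g polygraph_data \<Rightarrow> 'g cell_term set cat_data" where
  "free_ncat n S = free_npcat n n S"

text \<open>The boundary of a generating \<open>(k + 1)\<close>-cell is a pair of parallel cells of the free
  \<open>k\<close>-category: \<open>wf_term S k k\<close> only sees generators of dimension at most \<open>k\<close>, and no inverses.\<close>

definition polygraph :: "nat \<Rightarrow> 'g polygraph_data \<Rightarrow> bool" where
  "polygraph n S \<longleftrightarrow>
     (\<forall>g\<in>gens S. gdim S g \<le> n \<and>
        (\<forall>k. gdim S g = Suc k \<longrightarrow>
           wf_term S k k (gsrc S g) \<and> wf_term S k k (gtgt S g) \<and>
           tdim S (gsrc S g) = k \<and> tdim S (gtgt S g) = k \<and>
           (0 < k \<longrightarrow> term_eq S k k (tsrc S (gsrc S g)) (tsrc S (gtgt S g)) \<and>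
                     term_eq S k k (ttgt S (gsrc S g)) (ttgt S (gtgt S g)))))"


subsection \<open>The free \<open>(n,p)\<close>-category is an \<open>(n,p)\<close>-category\<close>

lemma wf_term_mono: "wf_term S k k t \<Longrightarrow> k \<le> n \<Longrightarrow> wf_term S n p t"
  and term_eq_mono: "term_eq S k k t u \<Longrightarrow> k \<le> n \<Longrightarrow> term_eq S n p t u"
  by (induction rule: wf_term_term_eq.inducts) (auto intro: wf_term_term_eq.intros)

inductive_cases wf_IdentE: "wf_term S n p (Ident t)"
inductive_cases wf_CompE: "wf_term S n p (Comp i t u)"
inductive_cases wf_GenE: "wf_term S n p (Gen g)"
inductive_cases wf_GenInvE: "wf_term S n p (GenInv g)"

lemma wf_CompD:
  assumes "wf_term S n p (Comp i t u)"
  shows "wf_term S n p t" "wf_term S n p u" "tdim S t = tdim S u" "i < tdim S t"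
    "term_eq S n p (ttgt_at S i t) (tsrc_at S i u)"
  using assms by (auto elim: wf_CompE)

lemma wf_term_dim: "wf_term S n p t \<Longrightarrow> tdim S t \<le> n"
  by (induction t) (auto elim: wf_IdentE wf_CompE wf_GenE wf_GenInvE)

lemma tdim_Ident_pow [simp]: "term_dim d ((Ident ^^ m) t) = m + term_dim d t"
  by (induction m) auto

locale polygraph_loc =
  fixes N :: nat and S :: "'g polygraph_data"
  assumes polygraph: "polygraph N S"
begin

lemma gen_dims:
  assumes "g \<in> gens S" "gdim S g = Suc k"
  shows "tdim S (gsrc S g) = k" "tdim S (gtgt S g) = k"
    "wf_term S k k (gsrc S g)" "wf_term S k k (gtgt S g)"
  using polygraph assms unfolding polygraph_def by blast+

lemma cat_law_dim: "cat_law S t u \<Longrightarrow> wf_term S n p t \<Longrightarrow> tdim S t = tdim S u"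
  by (induction rule: cat_law.induct) (auto elim!: wf_CompE wf_GenE dest: gen_dims)

lemma term_eq_wf: "term_eq S n p t u \<Longrightarrow> wf_term S n p t \<and> wf_term S n p u \<and> tdim S t = tdim S u"
  by (induction rule: wf_term_term_eq.inducts(2)[where ?P1.0 = "\<lambda>_. True"])
     (auto dest: cat_law_dim)

lemma cell_class_eq_iff:
  assumes "wf_term S n p t"
  shows "cell_class S n p t = cell_class S n p u \<longleftrightarrow> term_eq S n p t u"
proof
  assume h: "cell_class S n p t = cell_class S n p u"
  have "t \<in> cell_class S n p t" using assms by (simp add: cell_class_def teq_refl)
  then show "term_eq S n p t u" using h by (auto simp: cell_class_def intro: teq_sym)
next
  assume "term_eq S n p t u"
  then show "cell_class S n p t = cell_class S n p u"
    by (auto simp: cell_class_def intro: teq_sym teq_trans)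
qed

lemma cell_class_eqI: "term_eq S n p t u \<Longrightarrow> cell_class S n p u = cell_class S n p t"
  using cell_class_eq_iff term_eq_wf by blast

definition boundary_ok :: "nat \<Rightarrow> nat \<Rightarrow> nat \<Rightarrow> bool" where
  "boundary_ok n p k \<longleftrightarrow>
    (\<forall>t. wf_term S n p t \<and> tdim S t = Suc k \<longrightarrow>
      wf_term S n p (tsrc S t) \<and> wf_term S n p (ttgt S t) \<and>
      tdim S (tsrc S t) = k \<and> tdim S (ttgt S t) = k \<and>
      (0 < k \<longrightarrow> term_eq S n p (tsrc S (tsrc S t)) (tsrc S (ttgt S t)) \<and>
                term_eq S n p (ttgt S (tsrc S t)) (ttgt S (ttgt S t)))) \<and>
    (\<forall>t u. term_eq S n p t u \<and> tdim S t = Suc k \<longrightarrow>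
      term_eq S n p (tsrc S t) (tsrc S u) \<and> term_eq S n p (ttgt S t) (ttgt S u))"

lemma boundary_okD:
  assumes "boundary_ok n p k"
  shows "wf_term S n p t \<Longrightarrow> tdim S t = Suc k \<Longrightarrow> wf_term S n p (tsrc S t)"
    "wf_term S n p t \<Longrightarrow> tdim S t = Suc k \<Longrightarrow> wf_term S n p (ttgt S t)"
    "wf_term S n p t \<Longrightarrow> tdim S t = Suc k \<Longrightarrow> tdim S (tsrc S t) = k"
    "wf_term S n p t \<Longrightarrow> tdim S t = Suc k \<Longrightarrow> tdim S (ttgt S t) = k"
    "wf_term S n p t \<Longrightarrow> tdim S t = Suc k \<Longrightarrow> 0 < k \<Longrightarrow>
       term_eq S n p (tsrc S (tsrc S t)) (tsrc S (ttgt S t))"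
    "wf_term S n p t \<Longrightarrow> tdim S t = Suc k \<Longrightarrow> 0 < k \<Longrightarrow>
       term_eq S n p (ttgt S (tsrc S t)) (ttgt S (ttgt S t))"
    "term_eq S n p t u \<Longrightarrow> tdim S t = Suc k \<Longrightarrow> term_eq S n p (tsrc S t) (tsrc S u)"
    "term_eq S n p t u \<Longrightarrow> tdim S t = Suc k \<Longrightarrow> term_eq S n p (ttgt S t) (ttgt S u)"
  using assms unfolding boundary_ok_def by blast+

lemma iterated_boundary:
  assumes "\<And>j. j < k \<Longrightarrow> boundary_ok n p j" "m \<le> tdim S t" "tdim S t \<le> k"
  shows "wf_term S n p t \<Longrightarrow> wf_term S n p ((tsrc S ^^ m) t) \<and> tdim S ((tsrc S ^^ m) t) = tdim S t - m"
    and "wf_term S n p t \<Longrightarrow> wf_term S n p ((ttgt S ^^ m) t) \<and> tdim S ((ttgt S ^^ m) t) = tdim S t - m"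
    and "term_eq S n p t u \<Longrightarrow> term_eq S n p ((tsrc S ^^ m) t) ((tsrc S ^^ m) u)"
    and "term_eq S n p t u \<Longrightarrow> term_eq S n p ((ttgt S ^^ m) t) ((ttgt S ^^ m) u)"
proof -
  have *: "(wf_term S n p t \<longrightarrow> wf_term S n p ((tsrc S ^^ m) t) \<and> tdim S ((tsrc S ^^ m) t) = tdim S t - m)
     \<and> (wf_term S n p t \<longrightarrow> wf_term S n p ((ttgt S ^^ m) t) \<and> tdim S ((ttgt S ^^ m) t) = tdim S t - m)
     \<and> (term_eq S n p t u \<longrightarrow> term_eq S n p ((tsrc S ^^ m) t) ((tsrc S ^^ m) u))
     \<and> (term_eq S n p t u \<longrightarrow> term_eq S n p ((ttgt S ^^ m) t) ((ttgt S ^^ m) u))"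
    using assms(2)
  proof (induction m)
    case (Suc m)
    define d where "d = tdim S t - Suc m"
    have d: "tdim S t - m = Suc d" "d < k" using Suc.prems assms(3) by (auto simp: d_def)
    have ok: "boundary_ok n p d" using assms(1) d(2) .
    show ?case
      using Suc.IH Suc.prems d boundary_okD[OF ok] term_eq_wf[of n p t u]
      by (simp add: d_def)
  qed auto
  show "wf_term S n p t \<Longrightarrow> wf_term S n p ((tsrc S ^^ m) t) \<and> tdim S ((tsrc S ^^ m) t) = tdim S t - m"
    and "wf_term S n p t \<Longrightarrow> wf_term S n p ((ttgt S ^^ m) t) \<and> tdim S ((ttgt S ^^ m) t) = tdim S t - m"
    and "term_eq S n p t u \<Longrightarrow> term_eq S n p ((tsrc S ^^ m) t) ((tsrc S ^^ m) u)"
    and "term_eq S n p t u \<Longrightarrow> term_eq S n p ((ttgt S ^^ m) t) ((ttgt S ^^ m) u)"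
    using * by blast+
qed

lemma csrc_class:
  assumes "boundary_ok n p k" "wf_term S n p t" "tdim S t = Suc k"
  shows "csrc (free_npcat n p S) (cell_class S n p t) = cell_class S n p (tsrc S t)"
    and "ctgt (free_npcat n p S) (cell_class S n p t) = cell_class S n p (ttgt S t)"
proof -
  have a: "t \<in> cell_class S n p t" using assms by (simp add: cell_class_def teq_refl)
  then have ne: "cell_class S n p t \<noteq> {}" by blast
  have b: "cell_class S n p (tsrc S u) = cell_class S n p (tsrc S t)"
    "cell_class S n p (ttgt S u) = cell_class S n p (ttgt S t)" if "u \<in> cell_class S n p t" for u
  proof -
    have e: "term_eq S n p t u" using that by (simp add: cell_class_def)
    show "cell_class S n p (tsrc S u) = cell_class S n p (tsrc S t)"
      using boundary_okD(7)[OF assms(1) e assms(3)] by (rule cell_class_eqI)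
    show "cell_class S n p (ttgt S u) = cell_class S n p (ttgt S t)"
      using boundary_okD(8)[OF assms(1) e assms(3)] by (rule cell_class_eqI)
  qed
  show "csrc (free_npcat n p S) (cell_class S n p t) = cell_class S n p (tsrc S t)"
    "ctgt (free_npcat n p S) (cell_class S n p t) = cell_class S n p (ttgt S t)"
    unfolding free_npcat_def by (simp_all add: b ne)
qed

lemma gen_boundary:
  assumes "g \<in> gens S" "gdim S g = Suc k" "0 < k"
  shows "term_eq S k k (tsrc S (gsrc S g)) (tsrc S (gtgt S g))"
    "term_eq S k k (ttgt S (gsrc S g)) (ttgt S (gtgt S g))"
  using polygraph assms unfolding polygraph_def by blast+

lemma boundary_ok: "boundary_ok n p k"
proof (induction k arbitrary: n p rule: less_induct)
  case (less k)
  note ok = less.IH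
  let ?W = "wf_term S n p" and ?E = "term_eq S n p" and ?s = "tsrc S" and ?t = "ttgt S" and ?d = "tdim S"
  note it = iterated_boundary[OF ok, where k = k and n = n and p = p]
  let ?Q = "\<lambda>t. ?d t = Suc k \<longrightarrow>
      ?W (?s t) \<and> ?W (?t t) \<and> ?d (?s t) = k \<and> ?d (?t t) = k \<and>
      (0 < k \<longrightarrow> ?E (?s (?s t)) (?s (?t t)) \<and> ?E (?t (?s t)) (?t (?t t)))"
  have glob: "?E (tsrc_at S i (?s t)) (tsrc_at S i (?t t))" "?E (ttgt_at S i (?s t)) (ttgt_at S i (?t t))"
    "tsrc_at S i t = tsrc_at S i (?s t)" "ttgt_at S i t = ttgt_at S i (?t t)"
    if "?Q t" "?d t = Suc k" "i < k" for t i
  proof -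
    define m where "m = k - i - 1"
    have m: "k - i = Suc m" using that(3) by (simp add: m_def)
    have ds: "?d (?s t) = k" "?d (?t t) = k" and W: "?W (?s t)" "?W (?t t)" using that by auto
    have kk: "0 < k" "k - 1 < k" using that by auto
    have okk: "boundary_ok n p (k - 1)" using ok kk by blast
    have dss: "?d (?s (?s t)) = k - 1" "?d (?t (?s t)) = k - 1"
      using boundary_okD(3,4)[OF okk W(1)] ds kk by auto
    have "?E ((?s ^^ m) (?s (?s t))) ((?s ^^ m) (?s (?t t)))"
      by (rule it(3)) (use that m dss kk in auto)
    then show "?E (tsrc_at S i (?s t)) (tsrc_at S i (?t t))"
      using m ds by (simp add: tsrc_at_def funpow_swap1)
    have "?E ((?t ^^ m) (?t (?s t))) ((?t ^^ m) (?t (?t t)))"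
      by (rule it(4)) (use that m dss kk in auto)
    then show "?E (ttgt_at S i (?s t)) (ttgt_at S i (?t t))"
      using m ds by (simp add: ttgt_at_def funpow_swap1)
    have "Suc k - i = Suc (k - i)" using that by auto
    then show "tsrc_at S i t = tsrc_at S i (?s t)" "ttgt_at S i t = ttgt_at S i (?t t)"
      using that ds by (auto simp: tsrc_at_def ttgt_at_def funpow_swap1)
  qed
  have wfc: "?Q (Comp i t u)" if W: "?W t" "?W u" and d: "?d t = ?d u" "i < ?d t"
      and e: "?E (ttgt_at S i t) (tsrc_at S i u)" and Q: "?Q t" "?Q u" for i t u
  proof (intro impI)
    assume dc: "?d (Comp i t u) = Suc k"
    then have dt: "?d t = Suc k" "?d u = Suc k" using d by auto
    note Qt = Q(1)[rule_format, OF dt(1)] and Qu = Q(2)[rule_format, OF dt(2)]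
    show "?W (?s (Comp i t u)) \<and> ?W (?t (Comp i t u)) \<and> ?d (?s (Comp i t u)) = k \<and> ?d (?t (Comp i t u)) = k \<and>
      (0 < k \<longrightarrow> ?E (?s (?s (Comp i t u))) (?s (?t (Comp i t u))) \<and> ?E (?t (?s (Comp i t u))) (?t (?t (Comp i t u))))"
    proof (cases "i = k")
      case True
      have e': "?E (?t t) (?s u)" using e True dt by (simp add: ttgt_at_def tsrc_at_def)
      have "?E (?s (?s t)) (?s (?t u)) \<and> ?E (?t (?s t)) (?t (?t u))" if "0 < k"
      proof -
        have okk: "boundary_ok n p (k - 1)" and dk: "?d (?t t) = Suc (k - 1)" using ok that Qt by auto
        show ?thesis using boundary_okD(7,8)[OF okk e' dk] Qt Qu that
          by (meson teq_trans)
      qed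
      then show ?thesis using True dt Qt Qu by simp
    next
      case False
      then have ik: "i < k" using d dt by auto
      note gt = glob[OF Q(1) dt(1) ik] and gu = glob[OF Q(2) dt(2) ik]
      have Ws: "?W (Comp i (?s t) (?s u))"
        by (rule wf_Comp) (use Qt Qu ik gt gu e in \<open>auto intro: teq_trans\<close>)
      have "?E (ttgt_at S i (?t t)) (tsrc_at S i (?t u))"
        using gt gu e by (metis teq_trans)
      then have Wt: "?W (Comp i (?t t) (?t u))"
        by (intro wf_Comp) (use Qt Qu ik in auto)
      have kk: "0 < k" using ik by auto
      have okk: "boundary_ok n p (k - 1)" using ok kk by auto
      have dss: "?d (Comp i (?s t) (?s u)) = Suc (k - 1)" "?d (Comp i (?t t) (?t u)) = Suc (k - 1)"
        using Qt kk by auto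
      note B = boundary_okD(1,2)[OF okk Ws dss(1)] boundary_okD(1,2)[OF okk Wt dss(2)]
      have "?E (?s (Comp i (?s t) (?s u))) (?s (Comp i (?t t) (?t u)))"
        "?E (?t (Comp i (?s t) (?s u))) (?t (Comp i (?t t) (?t u)))"
        using B Qt Qu kk by (auto split: if_splits intro: teq_Comp)
      then show ?thesis using Ws Wt False dt Qt by auto
    qed
  qed
  have Q: "?Q t" if "?W t" for t
    using that
  proof (induction t rule: cell_term.induct)
    case (Gen g)
    then have g: "g \<in> gens S" "gdim S g \<le> n" by (auto elim: wf_GenE)
    show ?case
    proof (intro impI)
      assume "?d (Gen g) = Suc k"
      then have dk: "gdim S g = Suc k" by simp
      have kn: "k \<le> n" using dk g by auto
      then show "?W (?s (Gen g)) \<and> ?W (?t (Gen g)) \<and> ?d (?s (Gen g)) = k \<and> ?d (?t (Gen g)) = k \<and>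
        (0 < k \<longrightarrow> ?E (?s (?s (Gen g))) (?s (?t (Gen g))) \<and> ?E (?t (?s (Gen g))) (?t (?t (Gen g))))"
        using gen_dims[OF g(1) dk] gen_boundary[OF g(1) dk] kn
        by (auto intro: wf_term_mono term_eq_mono)
    qed
  next
    case (GenInv g)
    then have g: "g \<in> gens S" "gdim S g \<le> n" by (auto elim: wf_GenInvE)
    show ?case
    proof (intro impI)
      assume "?d (GenInv g) = Suc k"
      then have dk: "gdim S g = Suc k" by simp
      have kn: "k \<le> n" using dk g by auto
      then show "?W (?s (GenInv g)) \<and> ?W (?t (GenInv g)) \<and> ?d (?s (GenInv g)) = k \<and> ?d (?t (GenInv g)) = k \<and>
        (0 < k \<longrightarrow> ?E (?s (?s (GenInv g))) (?s (?t (GenInv g))) \<and> ?E (?t (?s (GenInv g))) (?t (?t (GenInv g))))"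
        using gen_dims[OF g(1) dk] gen_boundary[OF g(1) dk] kn
        by (auto intro: wf_term_mono term_eq_mono teq_sym)
    qed
  next
    case (Ident t)
    then have W: "?W t" by (auto elim: wf_IdentE)
    have okk: "0 < k \<Longrightarrow> boundary_ok n p (k - 1)" using ok by auto
    show ?case using W boundary_okD(1,2)[OF okk W] by (auto intro!: teq_refl)
  next
    case (Comp i t u)
    from Comp.prems show ?case
      by (rule wf_CompE) (rule wfc, use Comp.IH in auto)
  qed
  have lift: "?E ((Ident ^^ m) x) ((Ident ^^ m) y)" "?W ((Ident ^^ m) x)" "?W ((Ident ^^ m) y)"
    if "?E x y" "m + ?d x \<le> n" for m x y
  proof -
    have "?E ((Ident ^^ m) x) ((Ident ^^ m) y) \<and> ?W ((Ident ^^ m) x) \<and> ?W ((Ident ^^ m) y)"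
      using that(2)
      by (induction m) (use that(1) term_eq_wf in \<open>auto intro!: wf_Ident teq_Ident\<close>)
    then show "?E ((Ident ^^ m) x) ((Ident ^^ m) y)" "?W ((Ident ^^ m) x)" "?W ((Ident ^^ m) y)" by auto
  qed
  have tid: "(?s ^^ m) ((Ident ^^ m) x) = x" "(?t ^^ m) ((Ident ^^ m) x) = x" for m x
  proof (induction m)
    case (Suc m)
    have *: "(Ident ^^ Suc m) x = Ident ((Ident ^^ m) x)" by simp
    show "(?s ^^ Suc m) ((Ident ^^ Suc m) x) = x" "(?t ^^ Suc m) ((Ident ^^ Suc m) x) = x"
      by (simp_all only: * funpow_Suc_right[of m "?s"] funpow_Suc_right[of m "?t"] o_apply
          tsrc.simps ttgt.simps Suc)
  qed simp_all
  have law: "?E (?s t) (?s u) \<and> ?E (?t t) (?t u)" if "cat_law S t u" "?W t" "?W u" "?d t = Suc k" for t u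
    using that
  proof (induction rule: cat_law.induct)
    case (assoc i t u v)
    have d: "?d t = Suc k" "?d u = Suc k" "?d v = Suc k" using assoc by (auto elim!: wf_CompE)
    have du: "?d (?s t) = k" "?d (?t t) = k" "?d (?s u) = k" "?d (?t u) = k" "?d (?s v) = k" "?d (?t v) = k"
      using Q assoc.prems d by (auto elim!: wf_CompE)
    have "?W (?s (Comp i (Comp i t u) v))" "?W (?t (Comp i (Comp i t u) v))"
      "?W (?s (Comp i t (Comp i u v)))" "?W (?t (Comp i t (Comp i u v)))"
      using Q[OF assoc.prems(1)] Q[OF assoc.prems(2)] d by auto
    then show ?case using d du by (cases "i = k") (auto intro: teq_refl teq_law cat_law.assoc)
  next
    case (unit_left i t)
    have d: "?d t = Suc k" using unit_left by (auto elim!: wf_CompE)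
    have W: "?W t" by fact
    note Qt = Q[OF W, rule_format, OF d]
    have LW: "?W (?s (Comp i ((Ident ^^ (?d t - i)) (tsrc_at S i t)) t))"
       "?W (?t (Comp i ((Ident ^^ (?d t - i)) (tsrc_at S i t)) t))"
      using Q[OF unit_left.prems(1)] unit_left.prems(3) by auto
    have da: "?d ((Ident ^^ (?d t - i)) (tsrc_at S i t)) = Suc k" using unit_left.prems by simp
    show ?case
    proof (cases "i = k")
      case True
      then show ?thesis using d Qt da by (auto simp: tsrc_at_def intro!: teq_refl)
    next
      case False
      then have ik: "i < k" using unit_left d by auto
      note g = glob[OF Q[OF W] d ik]
      have sk: "Suc k - i = Suc (k - i)" using ik by auto
      have 1: "?s (Comp i ((Ident ^^ (?d t - i)) (tsrc_at S i t)) t)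
           = Comp i ((Ident ^^ (?d (?s t) - i)) (tsrc_at S i (?s t))) (?s t)"
        using da d ik g sk Qt by auto
      have 2: "?t (Comp i ((Ident ^^ (?d t - i)) (tsrc_at S i t)) t)
           = Comp i ((Ident ^^ (k - i)) (tsrc_at S i (?s t))) (?t t)"
        using da d ik g sk Qt by auto
      have E1: "?E (?s (Comp i ((Ident ^^ (?d t - i)) (tsrc_at S i t)) t)) (?s t)"
        using LW(1) Qt ik unfolding 1 by (intro teq_law cat_law.unit_left) auto
      have dsi: "?d (tsrc_at S i (?s t)) = i" "?d (tsrc_at S i (?t t)) = i"
        using it(1)[of "k - i" "?s t"] it(1)[of "k - i" "?t t"] Qt ik by (auto simp: tsrc_at_def)
      have kn: "k - i + i \<le> n" using wf_term_dim[OF W] d ik by auto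
      note l = lift[OF g(1), of "k - i", unfolded dsi, OF kn]
      have W2: "?W (Comp i ((Ident ^^ (k - i)) (tsrc_at S i (?t t))) (?t t))"
        by (rule wf_Comp) (use l Qt ik dsi term_eq_wf[OF g(1)] in \<open>auto simp: ttgt_at_def tid intro: teq_refl\<close>)
      have "?E (Comp i ((Ident ^^ (k - i)) (tsrc_at S i (?s t))) (?t t))
               (Comp i ((Ident ^^ (k - i)) (tsrc_at S i (?t t))) (?t t))"
        by (rule teq_Comp) (use l Qt W2 LW(2) 2 in \<open>auto intro: teq_refl\<close>)
      moreover have "?E (Comp i ((Ident ^^ (k - i)) (tsrc_at S i (?t t))) (?t t)) (?t t)"
        using cat_law.unit_left[of i S "?t t"] W2 Qt ik by (intro teq_law) auto
      ultimately show ?thesis using E1 2 by (metis teq_trans)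
    qed
  next
    case (unit_right i t)
    have d: "?d t = Suc k" using unit_right by (auto elim!: wf_CompE)
    have W: "?W t" by fact
    note Qt = Q[OF W, rule_format, OF d]
    have LW: "?W (?s (Comp i t ((Ident ^^ (?d t - i)) (ttgt_at S i t))))"
       "?W (?t (Comp i t ((Ident ^^ (?d t - i)) (ttgt_at S i t))))"
      using Q[OF unit_right.prems(1)] unit_right.prems(3) by auto
    show ?case
    proof (cases "i = k")
      case True
      then show ?thesis using d Qt by (auto simp: ttgt_at_def intro!: teq_refl)
    next
      case False
      then have ik: "i < k" using unit_right d by auto
      note g = glob[OF Q[OF W] d ik]
      have sk: "Suc k - i = Suc (k - i)" using ik by auto
      have 1: "?t (Comp i t ((Ident ^^ (?d t - i)) (ttgt_at S i t)))
           = Comp i (?t t) ((Ident ^^ (?d (?t t) - i)) (ttgt_at S i (?t t)))"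
        using d ik g sk Qt by auto
      have 2: "?s (Comp i t ((Ident ^^ (?d t - i)) (ttgt_at S i t)))
           = Comp i (?s t) ((Ident ^^ (k - i)) (ttgt_at S i (?t t)))"
        using d ik g sk Qt by auto
      have E1: "?E (?t (Comp i t ((Ident ^^ (?d t - i)) (ttgt_at S i t)))) (?t t)"
        using LW(2) Qt ik unfolding 1 by (intro teq_law cat_law.unit_right) auto
      have dsi: "?d (ttgt_at S i (?s t)) = i" "?d (ttgt_at S i (?t t)) = i"
        using it(2)[of "k - i" "?s t"] it(2)[of "k - i" "?t t"] Qt ik by (auto simp: ttgt_at_def)
      have kn: "k - i + i \<le> n" using wf_term_dim[OF W] d ik by auto
      note l = lift[OF g(2), of "k - i", unfolded dsi, OF kn]
      have W2: "?W (Comp i (?s t) ((Ident ^^ (k - i)) (ttgt_at S i (?s t))))"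
        by (rule wf_Comp) (use l Qt ik dsi term_eq_wf[OF g(2)] in \<open>auto simp: tsrc_at_def tid intro: teq_refl\<close>)
      have "?E (Comp i (?s t) ((Ident ^^ (k - i)) (ttgt_at S i (?t t))))
               (Comp i (?s t) ((Ident ^^ (k - i)) (ttgt_at S i (?s t))))"
        by (rule teq_Comp) (use l Qt W2 LW(1) 2 in \<open>auto intro: teq_refl teq_sym\<close>)
      moreover have "?E (Comp i (?s t) ((Ident ^^ (k - i)) (ttgt_at S i (?s t)))) (?s t)"
        using cat_law.unit_right[of i S "?s t"] W2 Qt ik by (intro teq_law) auto
      ultimately show ?thesis using E1 2 by (metis teq_trans)
    qed
  next
    case (exchange i j t t' u u')
    let ?L = "Comp i (Comp j t t') (Comp j u u')" and ?R = "Comp j (Comp i t u) (Comp i t' u')"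
    have ij: "i < j" and WL: "?W ?L" and WR: "?W ?R" and dL: "?d ?L = Suc k" by fact+
    note Wc = wf_CompD[OF WL]
    note Wt = wf_CompD[OF Wc(1)] and Wu = wf_CompD[OF Wc(2)]
    have d: "?d t = Suc k" "?d t' = Suc k" "?d u = Suc k" "?d u' = Suc k"
      using dL Wc(3) Wt(3) Wu(3) by simp_all
    have dR: "?d ?R = Suc k" using d by simp
    have jk: "j < Suc k" using Wt(4) d by simp
    note Qs = Q[OF Wt(1), rule_format, OF d(1)] Q[OF Wt(2), rule_format, OF d(2)]
      Q[OF Wu(1), rule_format, OF d(3)] Q[OF Wu(2), rule_format, OF d(4)]
    have du: "?d (?s t) = k" "?d (?t t) = k" "?d (?s t') = k" "?d (?t t') = k"
      "?d (?s u) = k" "?d (?t u) = k" "?d (?s u') = k" "?d (?t u') = k"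
      by (simp_all only: Qs)
    have W: "?W (?s ?L)" "?W (?t ?L)" "?W (?s ?R)" "?W (?t ?R)"
      using Q[OF WL, rule_format, OF dL] Q[OF WR, rule_format, OF dR] by (simp_all only:)
    show ?case
    proof (cases "j = k")
      case True
      have ik: "i \<noteq> k" using ij True by simp
      have "?s ?R = ?s ?L" "?t ?R = ?t ?L" by (simp_all add: d du True ik)
      then show ?thesis using W(1,2) by (simp only: teq_refl)
    next
      case False
      then have "j < k" using jk by simp
      then have eqs: "?s ?L = Comp i (Comp j (?s t) (?s t')) (Comp j (?s u) (?s u'))"
        "?t ?L = Comp i (Comp j (?t t) (?t t')) (Comp j (?t u) (?t u'))"
        "?s ?R = Comp j (Comp i (?s t) (?s u)) (Comp i (?s t') (?s u'))"
        "?t ?R = Comp j (Comp i (?t t) (?t u)) (Comp i (?t t') (?t u'))"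
        using ij by (simp_all add: d du)
      show ?thesis
        using teq_law[OF _ W(1) W(3)] teq_law[OF _ W(2) W(4)] ij
        unfolding eqs by (simp only: cat_law.exchange)
    qed
  next
    case (id_comp i t u)
    have "i < ?d t" "?W (Comp i t u)" using id_comp.prems by (auto elim!: wf_CompE wf_IdentE)
    then show ?case by (auto intro: teq_refl)
  next
    case (inv_right g i)
    have g: "g \<in> gens S" and i: "i = k" using inv_right by (auto elim!: wf_CompE wf_GenE)
    have "?W (gsrc S g)" using inv_right.prems by (auto elim: wf_IdentE)
    then show ?case using inv_right.hyps by (auto intro: teq_refl)
  next
    case (inv_left g i)
    have "?W (gtgt S g)" using inv_left.prems by (auto elim: wf_IdentE)
    then show ?case using inv_left.hyps by (auto intro: teq_refl)
  qed
  have E: "?d t = Suc k \<longrightarrow> ?E (?s t) (?s u) \<and> ?E (?t t) (?t u)" if "?E t u" for t u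
    using that
  proof (induction rule: wf_term_term_eq.inducts(2)[where ?P1.0 = "\<lambda>_. True"])
    case (teq_refl t)
    then show ?case using Q by (auto intro: wf_term_term_eq.teq_refl)
  next
    case (teq_sym t u)
    then show ?case using term_eq_wf by (metis wf_term_term_eq.teq_sym)
  next
    case (teq_trans t u v)
    then show ?case using term_eq_wf by (metis wf_term_term_eq.teq_trans)
  next
    case (teq_Comp t t' u u' i)
    show ?case
    proof
      assume d: "?d (Comp i t u) = Suc k"
      have WL: "?W (Comp i t u)" and WR: "?W (Comp i t' u')" by fact+
      have dd: "?d t = Suc k" "?d t' = Suc k" "?d u = Suc k" "?d u' = Suc k"
        using d wf_CompD(3)[OF WL] wf_CompD(3)[OF WR] teq_Comp.hyps(1) term_eq_wf by simp_all
      have dR: "?d (Comp i t' u') = Suc k" using dd by simp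
      have W: "?W (?s (Comp i t u))" "?W (?t (Comp i t u))" "?W (?s (Comp i t' u'))" "?W (?t (Comp i t' u'))"
        using Q[OF WL, rule_format, OF d] Q[OF WR, rule_format, OF dR] by (simp_all only:)
      have IH: "?E (?s t) (?s t')" "?E (?t t) (?t t')" "?E (?s u) (?s u')" "?E (?t u) (?t u')"
        using teq_Comp.IH dd by blast+
      show "?E (?s (Comp i t u)) (?s (Comp i t' u')) \<and> ?E (?t (Comp i t u)) (?t (Comp i t' u'))"
        using IH W by (cases "i = k") (auto simp: dd intro: wf_term_term_eq.teq_Comp)
    qed
  next
    case (teq_law t u)
    then show ?case using law by blast
  qed auto
  show ?case unfolding boundary_ok_def using Q E by blast
qed

lemmas boundary = boundary_okD[OF boundary_ok]
lemmas class_boundary = csrc_class[OF boundary_ok]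
lemmas iterated = iterated_boundary[OF boundary_ok _ order.refl]

lemma src_at_wf:
  assumes "wf_term S n p t" "i \<le> tdim S t"
  shows "wf_term S n p (tsrc_at S i t)" "tdim S (tsrc_at S i t) = i"
    "wf_term S n p (ttgt_at S i t)" "tdim S (ttgt_at S i t) = i"
  using iterated(1,2)[of "tdim S t - i" t n p] assms by (auto simp: tsrc_at_def ttgt_at_def)

lemma src_at_eq:
  assumes "term_eq S n p t u" "i \<le> tdim S t"
  shows "term_eq S n p (tsrc_at S i t) (tsrc_at S i u)" "term_eq S n p (ttgt_at S i t) (ttgt_at S i u)"
  using iterated(3,4)[of "tdim S t - i" t n p u] assms term_eq_wf[OF assms(1)]
  by (auto simp: tsrc_at_def ttgt_at_def)

lemma self_class: "wf_term S n p t \<Longrightarrow> t \<in> cell_class S n p t"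
  by (simp add: cell_class_def teq_refl)

lemma class_at:
  assumes "wf_term S n p t" "i \<le> tdim S t"
  shows "csrc_at (free_npcat n p S) (tdim S t) i (cell_class S n p t) = cell_class S n p (tsrc_at S i t)"
    "ctgt_at (free_npcat n p S) (tdim S t) i (cell_class S n p t) = cell_class S n p (ttgt_at S i t)"
proof -
  have "m \<le> tdim S t \<Longrightarrow>
     (csrc (free_npcat n p S) ^^ m) (cell_class S n p t) = cell_class S n p ((tsrc S ^^ m) t) \<and>
     (ctgt (free_npcat n p S) ^^ m) (cell_class S n p t) = cell_class S n p ((ttgt S ^^ m) t)" for m
  proof (induction m)
    case (Suc m)
    define d where "d = tdim S t - Suc m"
    have d: "tdim S t - m = Suc d" using Suc.prems by (simp add: d_def)
    have "m \<le> tdim S t" using Suc.prems by (rule Suc_leD)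
    note i = iterated(1,2)[OF this assms(1)]
    have IH: "(csrc (free_npcat n p S) ^^ m) (cell_class S n p t) = cell_class S n p ((tsrc S ^^ m) t)"
      "(ctgt (free_npcat n p S) ^^ m) (cell_class S n p t) = cell_class S n p ((ttgt S ^^ m) t)"
      using Suc.IH[OF \<open>m \<le> tdim S t\<close>] by blast+
    have W: "wf_term S n p ((tsrc S ^^ m) t)" "tdim S ((tsrc S ^^ m) t) = Suc d"
      "wf_term S n p ((ttgt S ^^ m) t)" "tdim S ((ttgt S ^^ m) t) = Suc d"
      by (simp_all only: i d)
    show ?case
      by (simp only: funpow.simps o_apply IH class_boundary(1)[OF W(1,2)] class_boundary(2)[OF W(3,4)] simp_thms)
  qed simp
  from this[of "tdim S t - i"]
  show "csrc_at (free_npcat n p S) (tdim S t) i (cell_class S n p t) = cell_class S n p (tsrc_at S i t)"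
    "ctgt_at (free_npcat n p S) (tdim S t) i (cell_class S n p t) = cell_class S n p (ttgt_at S i t)"
    by (simp_all add: csrc_at_def ctgt_at_def tsrc_at_def ttgt_at_def)
qed

lemma cid_class:
  assumes "wf_term S n p t" "tdim S t < n"
  shows "cid (free_npcat n p S) (cell_class S n p t) = cell_class S n p (Ident t)"
proof -
  have ne: "cell_class S n p t \<noteq> {}" using self_class[OF assms(1)] by blast
  have b: "cell_class S n p (Ident u) = cell_class S n p (Ident t)" if "u \<in> cell_class S n p t" for u
  proof (rule cell_class_eqI)
    have e: "term_eq S n p t u" using that by (simp add: cell_class_def)
    show "term_eq S n p (Ident t) (Ident u)"
      using e term_eq_wf[OF e] assms by (auto intro!: teq_Ident wf_Ident)
  qed
  show ?thesis unfolding free_npcat_def by (simp add: b ne)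
qed

lemma Comp_cong:
  assumes "wf_term S n p (Comp i t u)" "term_eq S n p t t'" "term_eq S n p u u'"
  shows "term_eq S n p (Comp i t u) (Comp i t' u')"
proof (rule teq_Comp[OF assms(2,3,1)])
  note w = wf_CompD[OF assms(1)]
  note e = term_eq_wf[OF assms(2)] term_eq_wf[OF assms(3)]
  have i: "i \<le> tdim S t" "i \<le> tdim S u" using w by auto
  have "term_eq S n p (ttgt_at S i t') (tsrc_at S i u')"
    using src_at_eq(2)[OF assms(2) i(1)] src_at_eq(1)[OF assms(3) i(2)] w(5) by (meson teq_sym teq_trans)
  then show "wf_term S n p (Comp i t' u')" using e w by (intro wf_Comp) auto
qed

lemma ccomp_class:
  assumes "wf_term S n p (Comp i t u)"
  shows "ccomp (free_npcat n p S) i (cell_class S n p t) (cell_class S n p u) = cell_class S n p (Comp i t u)"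
proof -
  note w = wf_CompD[OF assms]
  have ne: "cell_class S n p t \<noteq> {}" "cell_class S n p u \<noteq> {}" using self_class w by blast+
  have b: "cell_class S n p (Comp i t' u') = cell_class S n p (Comp i t u)"
    if "t' \<in> cell_class S n p t" "u' \<in> cell_class S n p u" for t' u'
    using that by (intro cell_class_eqI Comp_cong[OF assms]) (simp_all add: cell_class_def)
  have "(\<Union>t'\<in>cell_class S n p t. \<Union>u'\<in>cell_class S n p u. cell_class S n p (Comp i t' u'))
      = (\<Union>t'\<in>cell_class S n p t. \<Union>u'\<in>cell_class S n p u. cell_class S n p (Comp i t u))"
    by (intro SUP_cong refl b)
  then show ?thesis unfolding free_npcat_def using ne by simp
qed

lemma cells_free: "cells (free_npcat n p S) k = {cell_class S n p t | t. wf_term S n p t \<and> tdim S t = k}"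
  by (simp add: free_npcat_def)

lemma class_cell_iff:
  assumes "wf_term S n p t"
  shows "cell_class S n p t \<in> cells (free_npcat n p S) k \<longleftrightarrow> tdim S t = k"
proof
  assume "cell_class S n p t \<in> cells (free_npcat n p S) k"
  then obtain u where "cell_class S n p t = cell_class S n p u" "tdim S u = k"
    unfolding cells_free by blast
  then show "tdim S t = k" using term_eq_wf[of n p t u] cell_class_eq_iff[OF assms] by simp
next
  assume "tdim S t = k"
  then show "cell_class S n p t \<in> cells (free_npcat n p S) k"
    unfolding cells_free using assms by blast
qed

lemma composable_class:
  assumes "wf_term S n p t" "wf_term S n p u"
  shows "composable (free_npcat n p S) k i (cell_class S n p t) (cell_class S n p u) \<longleftrightarrow>
    tdim S t = k \<and> wf_term S n p (Comp i t u)"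
proof
  assume c: "composable (free_npcat n p S) k i (cell_class S n p t) (cell_class S n p u)"
  then have d: "tdim S t = k" "tdim S u = k" "i < k"
    by (auto simp: composable_def class_cell_iff assms)
  have "term_eq S n p (ttgt_at S i t) (tsrc_at S i u)"
    using c d class_at[OF assms(1), of i] class_at[OF assms(2), of i] src_at_wf[OF assms(1), of i]
    by (simp add: composable_def cell_class_eq_iff)
  then show "tdim S t = k \<and> wf_term S n p (Comp i t u)" using assms d by (auto intro: wf_Comp)
next
  assume "tdim S t = k \<and> wf_term S n p (Comp i t u)"
  then have d: "tdim S t = k" and w: "wf_term S n p (Comp i t u)" by auto
  note w' = wf_CompD[OF w]
  show "composable (free_npcat n p S) k i (cell_class S n p t) (cell_class S n p u)"
    using w' d class_at[OF assms(1), of i] class_at[OF assms(2), of i] src_at_wf[OF assms(1), of i]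
    by (simp add: composable_def class_cell_iff cell_class_eq_iff)
qed

lemma composableE:
  assumes "composable (free_npcat n p S) k i x y"
  obtains t u where "x = cell_class S n p t" "y = cell_class S n p u" "wf_term S n p t" "wf_term S n p u"
    "tdim S t = k" "tdim S u = k" "i < k" "wf_term S n p (Comp i t u)"
proof -
  obtain t u where tu: "x = cell_class S n p t" "y = cell_class S n p u" "wf_term S n p t" "wf_term S n p u"
    using assms by (auto simp: composable_def cells_free)
  have "tdim S t = k" "wf_term S n p (Comp i t u)" using assms tu composable_class by auto
  then show thesis using that tu wf_CompD(3,4) by metis
qed

lemma cellE:
  assumes "x \<in> cells (free_npcat n p S) k"
  obtains t where "x = cell_class S n p t" "wf_term S n p t" "tdim S t = k"
  using assms by (auto simp: cells_free)

lemma cid_at_class: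
  assumes "wf_term S n p t" "tdim S t = i" "i \<le> k" "k \<le> n"
  shows "cid_at (free_npcat n p S) i k (cell_class S n p t) = cell_class S n p ((Ident ^^ (k - i)) t)"
    "wf_term S n p ((Ident ^^ (k - i)) t)"
proof -
  have "m + i \<le> n \<Longrightarrow> (cid (free_npcat n p S) ^^ m) (cell_class S n p t) = cell_class S n p ((Ident ^^ m) t)
     \<and> wf_term S n p ((Ident ^^ m) t)" for m
    by (induction m) (auto simp: assms(1,2) cid_class wf_Ident)
  from this[of "k - i"] show "cid_at (free_npcat n p S) i k (cell_class S n p t) = cell_class S n p ((Ident ^^ (k - i)) t)"
    "wf_term S n p ((Ident ^^ (k - i)) t)" using assms by (auto simp: cid_at_def)
qed


lemma boundary_Ident_pow: "(tsrc S ^^ m) ((Ident ^^ m) x) = x" "(ttgt S ^^ m) ((Ident ^^ m) x) = x"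
proof (induction m)
  case (Suc m)
  have *: "(Ident ^^ Suc m) x = Ident ((Ident ^^ m) x)" by simp
  show "(tsrc S ^^ Suc m) ((Ident ^^ Suc m) x) = x" "(ttgt S ^^ Suc m) ((Ident ^^ Suc m) x) = x"
    by (simp_all only: * funpow_Suc_right[of m "tsrc S"] funpow_Suc_right[of m "ttgt S"] o_apply
        tsrc.simps ttgt.simps Suc)
qed simp_all

lemma src_at_step:
  assumes "wf_term S n p t" "i < tdim S t"
  shows "tsrc_at S i t = tsrc_at S i (tsrc S t)" "ttgt_at S i t = ttgt_at S i (ttgt S t)"
proof -
  define j where "j = tdim S t - 1"
  have d: "tdim S t = Suc j" using assms(2) by (simp add: j_def)
  have ij: "Suc j - i = Suc (j - i)" using assms(2) d by simp
  show "tsrc_at S i t = tsrc_at S i (tsrc S t)" "ttgt_at S i t = ttgt_at S i (ttgt S t)"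
    using boundary(3,4)[OF assms(1) d] by (simp_all add: tsrc_at_def ttgt_at_def d ij funpow_swap1)
qed

lemma Comp_at:
  assumes "wf_term S n p (Comp j t u)"
  shows "i < j \<Longrightarrow> tsrc_at S i (Comp j t u) = tsrc_at S i t"
    "i < j \<Longrightarrow> ttgt_at S i (Comp j t u) = ttgt_at S i u"
    "tsrc_at S j (Comp j t u) = tsrc_at S j t"
    "ttgt_at S j (Comp j t u) = ttgt_at S j u"
    "j < i \<Longrightarrow> i \<le> tdim S t \<Longrightarrow> tsrc_at S i (Comp j t u) = Comp j (tsrc_at S i t) (tsrc_at S i u)"
    "j < i \<Longrightarrow> i \<le> tdim S t \<Longrightarrow> ttgt_at S i (Comp j t u) = Comp j (ttgt_at S i t) (ttgt_at S i u)"
proof -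
  have *: "(i \<le> j \<longrightarrow> tsrc_at S i (Comp j t u) = tsrc_at S i t \<and> ttgt_at S i (Comp j t u) = ttgt_at S i u) \<and>
     (j < i \<and> i \<le> tdim S t \<longrightarrow> tsrc_at S i (Comp j t u) = Comp j (tsrc_at S i t) (tsrc_at S i u) \<and>
       ttgt_at S i (Comp j t u) = Comp j (ttgt_at S i t) (ttgt_at S i u))" for i
    using assms
  proof (induction "tdim S t" arbitrary: t u rule: less_induct)
    case less
    note w = wf_CompD[OF less.prems]
    show ?case
    proof (cases "i = tdim S t")
      case True
      then show ?thesis using w by (simp add: tsrc_at_def ttgt_at_def)
    next
      case False
      show ?thesis
      proof (cases "i < tdim S t")
        case True
        define d where "d = tdim S t - 1"
        have d: "tdim S t = Suc d" "tdim S u = Suc d" "tdim S (Comp j t u) = Suc d"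
          using True w by (auto simp: d_def)
        note b = boundary(1-4)[OF less.prems d(3)] and bt = boundary(3,4)[OF w(1) d(1)]
        have s: "tsrc_at S i (Comp j t u) = tsrc_at S i (tsrc S (Comp j t u))"
          "ttgt_at S i (Comp j t u) = ttgt_at S i (ttgt S (Comp j t u))"
          "tsrc_at S i t = tsrc_at S i (tsrc S t)" "tsrc_at S i u = tsrc_at S i (tsrc S u)"
          "ttgt_at S i t = ttgt_at S i (ttgt S t)" "ttgt_at S i u = ttgt_at S i (ttgt S u)"
          using src_at_step[OF less.prems] src_at_step[OF w(1)] src_at_step[OF w(2)] True w(3) by simp_all
        show ?thesis
        proof (cases "j = d")
          case True
          then show ?thesis using s d \<open>i < tdim S t\<close> by simp
        next
          case False
          then have e: "tsrc S (Comp j t u) = Comp j (tsrc S t) (tsrc S u)"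
            "ttgt S (Comp j t u) = Comp j (ttgt S t) (ttgt S u)" using d by auto
          have "tdim S (tsrc S t) < tdim S t" "tdim S (ttgt S t) < tdim S t" using bt d by auto
          from less.hyps[OF this(1) b(1)[unfolded e]] less.hyps[OF this(2) b(2)[unfolded e]]
          show ?thesis using s e bt d True by auto
        qed
      next
        case False
        then show ?thesis using w(4) \<open>i \<noteq> tdim S t\<close> by auto
      qed
    qed
  qed
  show "i < j \<Longrightarrow> tsrc_at S i (Comp j t u) = tsrc_at S i t"
    "i < j \<Longrightarrow> ttgt_at S i (Comp j t u) = ttgt_at S i u"
    "tsrc_at S j (Comp j t u) = tsrc_at S j t"
    "ttgt_at S j (Comp j t u) = ttgt_at S j u"
    "j < i \<Longrightarrow> i \<le> tdim S t \<Longrightarrow> tsrc_at S i (Comp j t u) = Comp j (tsrc_at S i t) (tsrc_at S i u)"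
    "j < i \<Longrightarrow> i \<le> tdim S t \<Longrightarrow> ttgt_at S i (Comp j t u) = Comp j (ttgt_at S i t) (ttgt_at S i u)"
    using *[of i] *[of j] by auto
qed

lemma globular_at:
  assumes "wf_term S n p t" "i < j" "j \<le> tdim S t"
  shows "term_eq S n p (tsrc_at S i (tsrc_at S j t)) (tsrc_at S i t)"
    "term_eq S n p (tsrc_at S i (ttgt_at S j t)) (tsrc_at S i t)"
    "term_eq S n p (ttgt_at S i (tsrc_at S j t)) (ttgt_at S i t)"
    "term_eq S n p (ttgt_at S i (ttgt_at S j t)) (ttgt_at S i t)"
proof -
  have "term_eq S n p (tsrc_at S i (tsrc_at S j t)) (tsrc_at S i t) \<and>
    term_eq S n p (tsrc_at S i (ttgt_at S j t)) (tsrc_at S i t) \<and>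
    term_eq S n p (ttgt_at S i (tsrc_at S j t)) (ttgt_at S i t) \<and>
    term_eq S n p (ttgt_at S i (ttgt_at S j t)) (ttgt_at S i t)"
    using assms
  proof (induction "tdim S t" arbitrary: t rule: less_induct)
    case less
    show ?case
    proof (cases "j = tdim S t")
      case True
      have "tsrc_at S j t = t" "ttgt_at S j t = t" by (simp_all add: True tsrc_at_def ttgt_at_def)
      then show ?thesis using less.prems src_at_wf[of n p t i] by (simp add: teq_refl)
    next
      case False
      define d where "d = tdim S t - 1"
      have d: "tdim S t = Suc d" "j \<le> d" "0 < d" using False less.prems by (auto simp: d_def)
      note b = boundary(1-4)[OF less.prems(1) d(1)] boundary(5,6)[OF less.prems(1) d(1,3)]
      define d' where "d' = d - 1"
      have d': "d = Suc d'" using d(3) by (simp add: d'_def)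
      have lt: "tdim S (tsrc S t) < tdim S t" "tdim S (ttgt S t) < tdim S t" using b d by auto
      note IHs = less.hyps[OF lt(1) b(1) less.prems(2)] and IHt = less.hyps[OF lt(2) b(2) less.prems(2)]
      have it: "i < tdim S t" "j < tdim S t" "i < d" using less.prems d by auto
      note st = src_at_step[OF less.prems(1) it(1)] src_at_step[OF less.prems(1) it(2)]
      have st2: "tsrc_at S i (tsrc S t) = tsrc_at S i (tsrc S (tsrc S t))"
        "tsrc_at S i (ttgt S t) = tsrc_at S i (tsrc S (ttgt S t))"
        "ttgt_at S i (tsrc S t) = ttgt_at S i (ttgt S (tsrc S t))"
        "ttgt_at S i (ttgt S t) = ttgt_at S i (ttgt S (ttgt S t))"
        using src_at_step[OF b(1)] src_at_step[OF b(2)] b it by simp_all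
      have dd: "i \<le> tdim S (tsrc S (tsrc S t))" "i \<le> tdim S (ttgt S (tsrc S t))"
        using boundary(3,4)[OF b(1), unfolded b(3), OF d'] it d' by auto
      have "term_eq S n p (tsrc_at S i (tsrc S t)) (tsrc_at S i (ttgt S t))"
        "term_eq S n p (ttgt_at S i (tsrc S t)) (ttgt_at S i (ttgt S t))"
        unfolding st2 using src_at_eq(1)[OF b(5) dd(1)] src_at_eq(2)[OF b(6) dd(2)] by auto
      then show ?thesis using IHs IHt b d unfolding st by (metis teq_sym teq_trans)
    qed
  qed
  then show "term_eq S n p (tsrc_at S i (tsrc_at S j t)) (tsrc_at S i t)"
    "term_eq S n p (tsrc_at S i (ttgt_at S j t)) (tsrc_at S i t)"
    "term_eq S n p (ttgt_at S i (tsrc_at S j t)) (ttgt_at S i t)"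
    "term_eq S n p (ttgt_at S i (ttgt_at S j t)) (ttgt_at S i t)" by blast+
qed

lemma wf_assoc:
  assumes "wf_term S n p (Comp i t u)" "wf_term S n p (Comp i u v)"
  shows "wf_term S n p (Comp i (Comp i t u) v)" "wf_term S n p (Comp i t (Comp i u v))"
  using assms wf_CompD[OF assms(1)] wf_CompD[OF assms(2)] Comp_at(3,4)[OF assms(1)] Comp_at(3,4)[OF assms(2)]
  by (auto intro!: wf_Comp)

lemma wf_exchange:
  assumes ij: "i < j" and L: "wf_term S n p (Comp i (Comp j t t') (Comp j u u'))"
  shows "wf_term S n p (Comp j (Comp i t u) (Comp i t' u'))"
proof -
  note c = wf_CompD[OF L]
  note t = wf_CompD[OF c(1)] and u = wf_CompD[OF c(2)]
  have dim: "tdim S t' = tdim S t" "tdim S u = tdim S t" "tdim S u' = tdim S t" using c(3) t(3) u(3) by auto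
  have j: "i < tdim S t" "j \<le> tdim S t" using t(4) ij by auto
  have g: "term_eq S n p (ttgt_at S i t) (ttgt_at S i t')" "term_eq S n p (tsrc_at S i u) (tsrc_at S i u')"
  proof -
    have jj: "i \<le> tdim S (ttgt_at S j t)" "i \<le> tdim S (ttgt_at S j u)"
      using src_at_wf[OF t(1) j(2)] src_at_wf[OF u(1)] j dim ij by auto
    have "term_eq S n p (ttgt_at S i (ttgt_at S j t)) (ttgt_at S i t)"
      "term_eq S n p (ttgt_at S i (tsrc_at S j t')) (ttgt_at S i t')"
      "term_eq S n p (tsrc_at S i (ttgt_at S j u)) (tsrc_at S i u)"
      "term_eq S n p (tsrc_at S i (tsrc_at S j u')) (tsrc_at S i u')"
      using globular_at[OF t(1) ij] globular_at[OF t(2) ij] globular_at[OF u(1) ij] globular_at[OF u(2) ij] j dim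
      by auto
    then show "term_eq S n p (ttgt_at S i t) (ttgt_at S i t')" "term_eq S n p (tsrc_at S i u) (tsrc_at S i u')"
      using src_at_eq(2)[OF t(5) jj(1)] src_at_eq(1)[OF u(5) jj(2)] by (meson teq_sym teq_trans)+
  qed
  have e: "term_eq S n p (ttgt_at S i t') (tsrc_at S i u)"
    using c(5) Comp_at(2)[OF c(1) ij] Comp_at(1)[OF c(2) ij] by simp
  have w1: "wf_term S n p (Comp i t u)"
    using t u j dim e g by (intro wf_Comp) (auto intro: teq_trans)
  have w2: "wf_term S n p (Comp i t' u')"
    using t u j dim e g by (intro wf_Comp) (auto intro: teq_trans)
  have a: "ttgt_at S j (Comp i t u) = Comp i (ttgt_at S j t) (ttgt_at S j u)"
    "tsrc_at S j (Comp i t' u') = Comp i (tsrc_at S j t') (tsrc_at S j u')"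
    using Comp_at(6)[OF w1 ij] Comp_at(5)[OF w2 ij] j dim by auto
  have "wf_term S n p (ttgt_at S j (Comp i t u))"
    using src_at_wf(3)[OF w1] j by simp
  then have "term_eq S n p (ttgt_at S j (Comp i t u)) (tsrc_at S j (Comp i t' u'))"
    unfolding a using Comp_cong t(5) u(5) by blast
  then show ?thesis by (rule wf_Comp[OF w1 w2, rotated 2]) (simp_all add: t(4) dim)
qed

theorem free_strict_ncategory: "strict_ncategory n (free_npcat n p S)"
proof
  let ?K = "free_npcat n p S" and ?c = "cell_class S n p"
  fix x k
  show "x \<in> cells ?K k \<Longrightarrow> k \<le> n"
    by (auto simp: cells_free wf_term_dim)
  show "x \<in> cells ?K (Suc k) \<Longrightarrow> csrc ?K x \<in> cells ?K k"
    by (elim cellE) (auto simp: class_boundary class_cell_iff boundary)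
  show "x \<in> cells ?K (Suc k) \<Longrightarrow> ctgt ?K x \<in> cells ?K k"
    by (elim cellE) (auto simp: class_boundary class_cell_iff boundary)
  show "x \<in> cells ?K (Suc k) \<Longrightarrow> parallel ?K k (csrc ?K x) (ctgt ?K x)"
  proof (elim cellE)
    fix t assume t: "x = ?c t" "wf_term S n p t" "tdim S t = Suc k"
    show "parallel ?K k (csrc ?K x) (ctgt ?K x)"
    proof (cases k)
      case 0
      then show ?thesis using t by (simp add: parallel_def class_boundary class_cell_iff boundary)
    next
      case (Suc j)
      then have "0 < k" by simp
      note b = boundary(1-4)[OF t(2,3)] boundary(5,6)[OF t(2,3) this]
      have d: "tdim S (tsrc S t) = Suc j" "tdim S (ttgt S t) = Suc j" using b Suc by auto
      show ?thesis
        using b t class_boundary[OF b(1) d(1)] class_boundary[OF b(2) d(2)]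
          boundary(1,2)[OF b(1) d(1)]
        by (simp add: parallel_def class_boundary[OF t(2,3)] class_cell_iff cell_class_eq_iff)
    qed
  qed
  show "x \<in> cells ?K k \<Longrightarrow> k < n \<Longrightarrow> cid ?K x \<in> cells ?K (Suc k)"
    by (elim cellE) (auto simp: cid_class class_cell_iff wf_Ident)
  show "x \<in> cells ?K k \<Longrightarrow> k < n \<Longrightarrow> csrc ?K (cid ?K x) = x"
    by (elim cellE) (auto simp: cid_class class_boundary wf_Ident)
  show "x \<in> cells ?K k \<Longrightarrow> k < n \<Longrightarrow> ctgt ?K (cid ?K x) = x"
    by (elim cellE) (auto simp: cid_class class_boundary wf_Ident)
  fix i y
  show "composable ?K k i x y \<Longrightarrow> ccomp ?K i x y \<in> cells ?K k"
    by (elim composableE) (simp only: ccomp_class class_cell_iff term_dim.simps)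
  show "csrc ?K (ccomp ?K i x y) = (if Suc i = k then csrc ?K x else ccomp ?K i (csrc ?K x) (csrc ?K y))"
    "ctgt ?K (ccomp ?K i x y) = (if Suc i = k then ctgt ?K y else ccomp ?K i (ctgt ?K x) (ctgt ?K y))"
    if c: "composable ?K k i x y"
  proof -
    obtain t u where tu: "x = ?c t" "y = ?c u" "wf_term S n p t" "wf_term S n p u"
      "tdim S t = k" "tdim S u = k" "i < k" "wf_term S n p (Comp i t u)"
      using composableE[OF c] by metis
    define j where "j = k - 1"
    have k: "k = Suc j" using tu(7) by (simp add: j_def)
    have dt: "tdim S t = Suc j" "tdim S u = Suc j" "tdim S (Comp i t u) = Suc j" using tu k by auto
    note cb = class_boundary[OF tu(3) dt(1)] class_boundary[OF tu(4) dt(2)] class_boundary[OF tu(8) dt(3)]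
    note W = boundary(1,2)[OF tu(8) dt(3)]
    have ck: "csrc ?K (ccomp ?K i x y) = ?c (tsrc S (Comp i t u))"
      "ctgt ?K (ccomp ?K i x y) = ?c (ttgt S (Comp i t u))"
      by (simp_all only: tu(1,2) ccomp_class[OF tu(8)] cb)
    have xy: "csrc ?K x = ?c (tsrc S t)" "csrc ?K y = ?c (tsrc S u)"
      "ctgt ?K x = ?c (ttgt S t)" "ctgt ?K y = ?c (ttgt S u)"
      by (simp_all only: tu(1,2) cb)
    show "csrc ?K (ccomp ?K i x y) = (if Suc i = k then csrc ?K x else ccomp ?K i (csrc ?K x) (csrc ?K y))"
      "ctgt ?K (ccomp ?K i x y) = (if Suc i = k then ctgt ?K y else ccomp ?K i (ctgt ?K x) (ctgt ?K y))"
    proof (atomize (full), cases "i = j")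
      case True
      then show "csrc ?K (ccomp ?K i x y) = (if Suc i = k then csrc ?K x else ccomp ?K i (csrc ?K x) (csrc ?K y)) \<and>
        ctgt ?K (ccomp ?K i x y) = (if Suc i = k then ctgt ?K y else ccomp ?K i (ctgt ?K x) (ctgt ?K y))"
        unfolding ck xy by (simp add: k dt)
    next
      case False
      then have e: "tsrc S (Comp i t u) = Comp i (tsrc S t) (tsrc S u)"
        "ttgt S (Comp i t u) = Comp i (ttgt S t) (ttgt S u)" by (simp_all add: dt)
      show "csrc ?K (ccomp ?K i x y) = (if Suc i = k then csrc ?K x else ccomp ?K i (csrc ?K x) (csrc ?K y)) \<and>
        ctgt ?K (ccomp ?K i x y) = (if Suc i = k then ctgt ?K y else ccomp ?K i (ctgt ?K x) (ctgt ?K y))"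
        using False ccomp_class[OF W(1)[unfolded e]] ccomp_class[OF W(2)[unfolded e]]
        by (simp only: ck xy k e if_False nat.inject simp_thms)
    qed
  qed
  show "ccomp ?K i (cid_at ?K i k (csrc_at ?K k i x)) x = x"
    "ccomp ?K i x (cid_at ?K i k (ctgt_at ?K k i x)) = x"
    if x: "x \<in> cells ?K k" and ik: "i < k"
  proof -
    obtain t where t: "x = ?c t" "wf_term S n p t" "tdim S t = k" using cellE[OF x] by metis
    have it: "i \<le> tdim S t" "i \<le> k" "k \<le> n" using ik t wf_term_dim by auto
    note s = src_at_wf[OF t(2) it(1)] and ca = class_at[OF t(2) it(1), unfolded t(3)]
    note ci = cid_at_class[OF s(1,2) it(2,3)] cid_at_class[OF s(3,4) it(2,3)]
    have inv: "ttgt_at S i ((Ident ^^ (k - i)) (tsrc_at S i t)) = tsrc_at S i t"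
      "tsrc_at S i ((Ident ^^ (k - i)) (ttgt_at S i t)) = ttgt_at S i t"
      using s by (simp_all add: ttgt_at_def[of S i "(Ident ^^ _) _"] tsrc_at_def[of S i "(Ident ^^ _) _"] boundary_Ident_pow)
    have "wf_term S n p (Comp i ((Ident ^^ (k - i)) (tsrc_at S i t)) t)"
      using s ci t ik by (intro wf_Comp) (auto simp: inv teq_refl)
    then have "term_eq S n p (Comp i ((Ident ^^ (k - i)) (tsrc_at S i t)) t) t"
      using cat_law.unit_left[of i S t] t ik by (auto intro: teq_law)
    then show "ccomp ?K i (cid_at ?K i k (csrc_at ?K k i x)) x = x"
      using term_eq_wf by (auto simp: t(1) ca ci ccomp_class dest: cell_class_eqI)
    have "wf_term S n p (Comp i t ((Ident ^^ (k - i)) (ttgt_at S i t)))"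
      using s ci t ik by (intro wf_Comp) (auto simp: inv teq_refl)
    then have "term_eq S n p (Comp i t ((Ident ^^ (k - i)) (ttgt_at S i t))) t"
      using cat_law.unit_right[of i S t] t ik by (auto intro: teq_law)
    then show "ccomp ?K i x (cid_at ?K i k (ctgt_at ?K k i x)) = x"
      using term_eq_wf by (auto simp: t(1) ca ci ccomp_class dest: cell_class_eqI)
  qed
  show "cid ?K (ccomp ?K i x y) = ccomp ?K i (cid ?K x) (cid ?K y)"
    if c: "composable ?K k i x y" and kn: "k < n"
  proof -
    obtain t u where tu: "x = ?c t" "y = ?c u" "wf_term S n p t" "wf_term S n p u"
      "tdim S t = k" "tdim S u = k" "i < k" "wf_term S n p (Comp i t u)"
      using composableE[OF c] by metis
    have at: "ttgt_at S i (Ident t) = ttgt_at S i t" "tsrc_at S i (Ident u) = tsrc_at S i u"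
      using tu by (simp_all add: ttgt_at_def tsrc_at_def Suc_diff_le funpow_swap1)
    have w: "wf_term S n p (Comp i (Ident t) (Ident u))" "wf_term S n p (Ident (Comp i t u))"
      using tu kn wf_CompD(5)[OF tu(8)] by (auto intro!: wf_Comp wf_Ident simp: at)
    have "term_eq S n p (Ident (Comp i t u)) (Comp i (Ident t) (Ident u))"
      using w cat_law.id_comp by (blast intro: teq_law)
    then show ?thesis
      using w tu kn by (simp add: cid_class ccomp_class cell_class_eq_iff)
  qed
  fix z
  show "ccomp ?K i (ccomp ?K i x y) z = ccomp ?K i x (ccomp ?K i y z)"
    if c: "composable ?K k i x y" and c': "composable ?K k i y z"
  proof -
    obtain t u where tu: "x = ?c t" "y = ?c u" "wf_term S n p t" "wf_term S n p u"
      "tdim S t = k" "tdim S u = k" "i < k" "wf_term S n p (Comp i t u)"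
      using composableE[OF c] by metis
    obtain v where v: "z = ?c v" "wf_term S n p v" using composableE[OF c'] by metis
    have uv: "wf_term S n p (Comp i u v)" using c' tu v composable_class by simp
    have w: "wf_term S n p (Comp i (Comp i t u) v)" "wf_term S n p (Comp i t (Comp i u v))"
      using wf_assoc[OF tu(8) uv] by auto
    have "term_eq S n p (Comp i (Comp i t u) v) (Comp i t (Comp i u v))"
      using w cat_law.assoc by (blast intro: teq_law)
    then show ?thesis using w uv tu v by (simp add: ccomp_class cell_class_eq_iff)
  qed
  fix j x' y'
  show "ccomp ?K i (ccomp ?K j x x') (ccomp ?K j y y') = ccomp ?K j (ccomp ?K i x y) (ccomp ?K i x' y')"
    if ij: "i < j" and c: "composable ?K k j x x'" "composable ?K k j y y'"
      "composable ?K k i (ccomp ?K j x x') (ccomp ?K j y y')"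
  proof -
    obtain t t' where t: "x = ?c t" "x' = ?c t'" "wf_term S n p t" "wf_term S n p t'"
      "tdim S t = k" "tdim S t' = k" "j < k" "wf_term S n p (Comp j t t')"
      using composableE[OF c(1)] by metis
    obtain u u' where u: "y = ?c u" "y' = ?c u'" "wf_term S n p u" "wf_term S n p u'"
      "tdim S u = k" "tdim S u' = k" "wf_term S n p (Comp j u u')"
      using composableE[OF c(2)] by metis
    have wL: "wf_term S n p (Comp i (Comp j t t') (Comp j u u'))"
      using c(3) t u by (simp add: ccomp_class composable_class)
    note wR = wf_exchange[OF ij wL]
    have "term_eq S n p (Comp i (Comp j t t') (Comp j u u')) (Comp j (Comp i t u) (Comp i t' u'))"
      using wL wR ij cat_law.exchange by (blast intro: teq_law)
    then show ?thesis using wL wR wf_CompD(1,2)[OF wR] t u by (simp add: ccomp_class cell_class_eq_iff)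
  qed
qed

definition right_inverse :: "nat \<Rightarrow> nat \<Rightarrow> nat \<Rightarrow> 'g cell_term \<Rightarrow> 'g cell_term \<Rightarrow> bool" where
  "right_inverse n p i t a \<longleftrightarrow> tdim S t = Suc i \<and> wf_term S n p (Comp i t a) \<and>
     term_eq S n p (Comp i t a) (Ident (tsrc S t))"

lemma at_top:
  "tdim S t = Suc i \<Longrightarrow> ttgt_at S i t = ttgt S t" "tdim S t = Suc i \<Longrightarrow> tsrc_at S i t = tsrc S t"
  by (simp_all add: ttgt_at_def tsrc_at_def)

lemma at_Ident:
  assumes "i \<le> tdim S t"
  shows "ttgt_at S i (Ident t) = ttgt_at S i t" "tsrc_at S i (Ident t) = tsrc_at S i t"
  using assms by (simp_all add: ttgt_at_def tsrc_at_def Suc_diff_le funpow_swap1)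

lemma at_self: "ttgt_at S (tdim S t) t = t" "tsrc_at S (tdim S t) t = t"
  by (simp_all add: ttgt_at_def tsrc_at_def)

lemma right_inverseD:
  assumes "right_inverse n p i t a"
  shows "wf_term S n p t" "wf_term S n p a" "tdim S t = Suc i" "tdim S a = Suc i"
    "wf_term S n p (Comp i t a)" "term_eq S n p (Comp i t a) (Ident (tsrc S t))"
    "term_eq S n p (ttgt S t) (tsrc S a)" "term_eq S n p (ttgt S a) (tsrc S t)"
    "wf_term S n p (Ident (tsrc S t))" "Suc i \<le> n"
proof -
  have a: "tdim S t = Suc i" "wf_term S n p (Comp i t a)" "term_eq S n p (Comp i t a) (Ident (tsrc S t))"
    using assms by (auto simp: right_inverse_def)
  note w = wf_CompD[OF a(2)]
  show "wf_term S n p t" "wf_term S n p a" "tdim S t = Suc i" by fact+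
  show da: "tdim S a = Suc i" using w a by simp
  show "wf_term S n p (Comp i t a)" "term_eq S n p (Comp i t a) (Ident (tsrc S t))" by fact+
  show "term_eq S n p (ttgt S t) (tsrc S a)" using w(5) at_top(1)[OF a(1)] at_top(2)[OF da] by simp
  have dc: "tdim S (Comp i t a) = Suc i" using a by simp
  have "term_eq S n p (ttgt S (Comp i t a)) (ttgt S (Ident (tsrc S t)))"
    by (rule boundary(8)[OF a(3) dc])
  then show "term_eq S n p (ttgt S a) (tsrc S t)" using a(1) by simp
  show "wf_term S n p (Ident (tsrc S t))" using term_eq_wf[OF a(3)] by simp
  show "Suc i \<le> n" using wf_term_dim[OF w(1)] a by simp
qed

lemma eq_assoc:
  assumes "wf_term S n p (Comp i t u)" "wf_term S n p (Comp i u v)"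
  shows "term_eq S n p (Comp i (Comp i t u) v) (Comp i t (Comp i u v))"
  by (rule teq_law[OF cat_law.assoc wf_assoc[OF assms]])

lemma right_inverse_Comp_below:
  assumes ta: "right_inverse n p i t a" and ub: "right_inverse n p i u b"
    and w: "wf_term S n p (Comp j t u)" and ji: "j < i"
  shows "right_inverse n p i (Comp j t u) (Comp j a b)"
proof -
  note t = right_inverseD[OF ta] and u = right_inverseD[OF ub]
  note wt = wf_CompD[OF w]
  have ds: "tdim S (tsrc S t) = i" "wf_term S n p (tsrc S t)"
    using boundary(1,3)[OF t(1,3)] by auto
  have 1: "term_eq S n p (ttgt_at S j (Comp i t a)) (ttgt_at S j (Ident (tsrc S t)))"
    by (rule src_at_eq[OF t(6)]) (simp add: t(3) ji less_imp_le le_SucI)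
  have 2: "ttgt_at S j (Ident (tsrc S t)) = ttgt_at S j (tsrc_at S i t)"
    using at_Ident(1)[of j "tsrc S t"] at_top(2)[OF t(3)] ds ji by simp
  have 3: "term_eq S n p (ttgt_at S j (tsrc_at S i t)) (ttgt_at S j t)"
    by (rule globular_at(3)[OF t(1) ji]) (simp add: t(3))
  have 4: "tsrc_at S j (Comp i u b) = tsrc_at S j u" by (rule Comp_at(1)[OF u(5) ji])
  have "term_eq S n p (ttgt_at S j (Comp i t a)) (tsrc_at S j (Comp i u b))"
    unfolding 4 using 1 2 3 wt(5) by (metis teq_trans)
  then have L: "wf_term S n p (Comp j (Comp i t a) (Comp i u b))"
    by (rule wf_Comp[OF t(5) u(5), rotated 2]) (simp_all add: t(3) u(3) ji less_SucI)
  have R: "wf_term S n p (Comp i (Comp j t u) (Comp j a b))" by (rule wf_exchange[OF ji L])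
  have e1: "term_eq S n p (Comp i (Comp j t u) (Comp j a b)) (Comp j (Comp i t a) (Comp i u b))"
    by (rule teq_sym[OF teq_law[OF cat_law.exchange[OF ji] L R]])
  have e2: "term_eq S n p (Comp j (Comp i t a) (Comp i u b)) (Comp j (Ident (tsrc S t)) (Ident (tsrc S u)))"
    by (rule Comp_cong[OF L t(6) u(6)])
  have dw: "tdim S (Comp j t u) = Suc i" using t(3) by simp
  have sC: "tsrc S (Comp j t u) = Comp j (tsrc S t) (tsrc S u)" using t(3) ji by simp
  have w5: "wf_term S n p (Ident (Comp j (tsrc S t) (tsrc S u)))"
    using boundary(1,3)[OF w dw] t(10) unfolding sC by (intro wf_Ident) auto
  have e3: "term_eq S n p (Ident (Comp j (tsrc S t) (tsrc S u))) (Comp j (Ident (tsrc S t)) (Ident (tsrc S u)))"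
    by (rule teq_law[OF cat_law.id_comp w5]) (use term_eq_wf[OF e2] in blast)
  have "term_eq S n p (Comp i (Comp j t u) (Comp j a b)) (Ident (tsrc S (Comp j t u)))"
    unfolding sC using e1 e2 e3 by (meson teq_sym teq_trans)
  then show ?thesis unfolding right_inverse_def using dw R by blast
qed

lemma right_inverse_Comp_top:
  assumes ta: "right_inverse n p i t a" and ub: "right_inverse n p i u b"
    and w: "wf_term S n p (Comp i t u)"
  shows "right_inverse n p i (Comp i t u) (Comp i b a)"
proof -
  note t = right_inverseD[OF ta] and u = right_inverseD[OF ub]
  note wt = wf_CompD[OF w]
  have tu: "term_eq S n p (ttgt S t) (tsrc S u)"
    using wt(5) at_top(1)[OF t(3)] at_top(2)[OF u(3)] by simp
  have "term_eq S n p (ttgt S b) (tsrc S a)" using u(8) tu t(7) by (meson teq_sym teq_trans)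
  then have ba: "wf_term S n p (Comp i b a)"
    by (intro wf_Comp) (simp_all add: u(2,4) t(2,4) at_top)
  note wub = u(5)
  have w1: "wf_term S n p (Comp i (Comp i t u) b)" "wf_term S n p (Comp i t (Comp i u b))"
    using wf_assoc[OF w wub] by auto
  have w2: "wf_term S n p (Comp i (Comp i (Comp i t u) b) a)" "wf_term S n p (Comp i (Comp i t u) (Comp i b a))"
    using wf_assoc[OF w1(1) ba] by auto
  have e1: "term_eq S n p (Comp i (Comp i t u) (Comp i b a)) (Comp i (Comp i (Comp i t u) b) a)"
    by (rule teq_sym[OF eq_assoc[OF w1(1) ba]])
  have idt: "term_eq S n p (Ident (tsrc S u)) (Ident (ttgt S t))"
    using boundary(2,4)[OF t(1,3)] t(10) by (intro teq_Ident teq_sym[OF tu] u(9) wf_Ident) auto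
  have ub': "term_eq S n p (Comp i u b) (Ident (ttgt S t))" by (rule teq_trans[OF u(6) idt])
  have e2: "term_eq S n p (Comp i (Comp i t u) b) (Comp i t (Ident (ttgt S t)))"
    using eq_assoc[OF w wub] Comp_cong[OF w1(2) teq_refl[OF t(1)] ub'] by (rule teq_trans)
  have "cat_law S (Comp i t (Ident (ttgt S t))) t"
    using cat_law.unit_right[of i S t] t(3) at_top(1)[OF t(3)] by simp
  then have e3: "term_eq S n p (Comp i t (Ident (ttgt S t))) t"
    using term_eq_wf[OF e2] t(1) by (blast intro: teq_law)
  have e4: "term_eq S n p (Comp i (Comp i (Comp i t u) b) a) (Comp i t a)"
    by (rule Comp_cong[OF w2(1) teq_trans[OF e2 e3] teq_refl[OF t(2)]])
  have "term_eq S n p (Comp i (Comp i t u) (Comp i b a)) (Ident (tsrc S t))"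
    using e1 e4 t(6) by (meson teq_trans)
  then show ?thesis unfolding right_inverse_def using t(3) w2(2) by simp
qed

lemma inverse_exists:
  assumes "wf_term S n p t" "tdim S t = Suc i" "p \<le> i"
  shows "\<exists>a. right_inverse n p i t a \<and> right_inverse n p i a t"
  using assms
proof (induction t rule: cell_term.induct)
  case (Gen g)
  have g: "g \<in> gens S" "gdim S g \<le> n" using Gen by (auto elim: wf_GenE)
  have d: "gdim S g = Suc i" using Gen by simp
  have wi: "wf_term S n p (GenInv g)" using g d Gen.prems by (auto intro: wf_GenInv)
  note b = boundary(1-4)[OF Gen.prems(1,2)]
  have "wf_term S n p (Comp i (Gen g) (GenInv g))" "wf_term S n p (Comp i (GenInv g) (Gen g))"
    using Gen.prems wi d b by (auto intro!: wf_Comp teq_refl simp: at_top)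
  moreover have "wf_term S n p (Ident (gsrc S g))" "wf_term S n p (Ident (gtgt S g))"
    using b g d by (auto intro!: wf_Ident)
  ultimately have "right_inverse n p i (Gen g) (GenInv g)" "right_inverse n p i (GenInv g) (Gen g)"
    unfolding right_inverse_def using cat_law.inv_right[OF d] cat_law.inv_left[OF d] d
    by (auto intro: teq_law)
  then show ?case by blast
next
  case (GenInv g)
  have g: "g \<in> gens S" "gdim S g \<le> n" using GenInv by (auto elim: wf_GenInvE)
  have d: "gdim S g = Suc i" using GenInv by simp
  have wi: "wf_term S n p (Gen g)" using g by (auto intro: wf_Gen)
  note b = boundary(1-4)[OF GenInv.prems(1,2)]
  have "wf_term S n p (Comp i (Gen g) (GenInv g))" "wf_term S n p (Comp i (GenInv g) (Gen g))"
    using GenInv.prems wi d b by (auto intro!: wf_Comp teq_refl simp: at_top)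
  moreover have "wf_term S n p (Ident (gsrc S g))" "wf_term S n p (Ident (gtgt S g))"
    using b g d by (auto intro!: wf_Ident)
  ultimately have "right_inverse n p i (Gen g) (GenInv g)" "right_inverse n p i (GenInv g) (Gen g)"
    unfolding right_inverse_def using cat_law.inv_right[OF d] cat_law.inv_left[OF d] d
    by (auto intro: teq_law)
  then show ?case by blast
next
  case (Ident t)
  have d: "tdim S t = i" and W: "wf_term S n p t" using Ident by (auto elim: wf_IdentE)
  have w: "wf_term S n p (Comp i (Ident t) (Ident t))"
    using Ident.prems d W by (auto intro!: wf_Comp teq_refl simp: at_top)
  have "cat_law S (Comp i (Ident t) (Ident t)) (Ident t)"
    using cat_law.unit_left[of i S "Ident t"] d at_top(2)[of "Ident t" i] by simp
  then have "right_inverse n p i (Ident t) (Ident t)"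
    unfolding right_inverse_def using w Ident.prems by (auto intro: teq_law)
  then show ?case by blast
next
  case (Comp j t u)
  note w = wf_CompD[OF Comp.prems(1)]
  have d: "tdim S t = Suc i" "tdim S u = Suc i" using Comp.prems(2) w(3) by simp_all
  obtain a where a: "right_inverse n p i t a" "right_inverse n p i a t"
    using Comp.IH(1)[OF w(1) d(1) Comp.prems(3)] by blast
  obtain b where b: "right_inverse n p i u b" "right_inverse n p i b u"
    using Comp.IH(2)[OF w(2) d(2) Comp.prems(3)] by blast
  show ?case
  proof (cases "j = i")
    case True
    have "right_inverse n p i (Comp i t u) (Comp i b a)"
      using right_inverse_Comp_top[OF a(1) b(1)] Comp.prems(1) True by simp
    moreover from right_inverseD(2)[OF this] have "right_inverse n p i (Comp i b a) (Comp i t u)"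
      by (rule right_inverse_Comp_top[OF b(2) a(2)])
    ultimately show ?thesis using True by blast
  next
    case False
    then have ji: "j < i" using w(4) d by simp
    have "right_inverse n p i (Comp j t u) (Comp j a b)"
      by (rule right_inverse_Comp_below[OF a(1) b(1) Comp.prems(1) ji])
    moreover from right_inverseD(2)[OF this] have "right_inverse n p i (Comp j a b) (Comp j t u)"
      by (rule right_inverse_Comp_below[OF a(2) b(2) _ ji])
    ultimately show ?thesis by blast
  qed
qed

theorem free_strict_npcategory: "strict_npcategory n p (free_npcat n p S)"
proof -
  interpret strict_ncategory n "free_npcat n p S" by (rule free_strict_ncategory)
  show ?thesis
  proof
    let ?K = "free_npcat n p S" and ?c = "cell_class S n p"
    fix i x
    assume pi: "p \<le> i" and "x \<in> cells ?K (Suc i)"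
    then obtain t where t: "x = ?c t" "wf_term S n p t" "tdim S t = Suc i" using cellE by metis
    obtain a where a: "right_inverse n p i t a" "right_inverse n p i a t"
      using inverse_exists[OF t(2,3) pi] by blast
    note ta = right_inverseD[OF a(1)] and at = right_inverseD[OF a(2)]
    have b: "wf_term S n p (tsrc S t)" "wf_term S n p (ttgt S t)" "tdim S (tsrc S t) < n" "tdim S (ttgt S t) < n"
      using boundary(1-4)[OF t(2,3)] ta(10) by auto
    have wt: "wf_term S n p (Ident (ttgt S t))" using b by (intro wf_Ident)
    have "term_eq S n p (Comp i a t) (Ident (ttgt S t))"
      by (rule teq_trans[OF at(6) teq_Ident[OF teq_sym[OF ta(7)] at(9) wt]])
    then have e: "?c (Comp i a t) = ?c (Ident (ttgt S t))" "?c (Comp i t a) = ?c (Ident (tsrc S t))"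
      using ta(6) at(5) ta(5) cell_class_eq_iff by blast+
    have "composable ?K (Suc i) i x (?c a)" "composable ?K (Suc i) i (?c a) x"
      unfolding t(1) using composable_class[OF ta(1,2)] composable_class[OF ta(2,1)] ta at by blast+
    moreover have "ccomp ?K i x (?c a) = cid ?K (csrc ?K x)" "ccomp ?K i (?c a) x = cid ?K (ctgt ?K x)"
      unfolding t(1) ccomp_class[OF ta(5)] ccomp_class[OF at(5)] class_boundary[OF t(2,3)]
        cid_class[OF b(1,3)] cid_class[OF b(2,4)] e by simp_all
    ultimately show "invertible_cell ?K i x" unfolding invertible_cell_def by blast
  qed
qed

end


section \<open>Rewriting by 3-cells and coherence\<close>

definition rewrites3 :: "'g polygraph_data \<Rightarrow> ('g cell_term set \<times> 'g cell_term set) set" where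
  "rewrites3 S = {(u, v). u \<in> cells (free_ncat 3 S) 2 \<and> v \<in> cells (free_ncat 3 S) 2 \<and>
     (\<exists>A\<in>cells (free_ncat 3 S) 3. csrc (free_ncat 3 S) A = u \<and> ctgt (free_ncat 3 S) A = v)}"

text \<open>Rewriting decreases: well-foundedness means that every strictly rewriting sequence ends.\<close>

definition three_terminating :: "'g polygraph_data \<Rightarrow> bool" where
  "three_terminating S \<longleftrightarrow>
     partial_order_on (cells (free_ncat 3 S) 2) (rewrites3 S) \<and> wf ((rewrites3 S)\<inverse> - Id)"

definition three_confluent :: "'g polygraph_data \<Rightarrow> bool" where
  "three_confluent S \<longleftrightarrow>
    (let F = free_ncat 3 S in
     \<forall>A\<in>cells F 3. \<forall>B\<in>cells F 3. csrc F A = csrc F B \<longrightarrow>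
       (\<exists>A'\<in>cells F 3. \<exists>B'\<in>cells F 3. composable F 3 2 A A' \<and> composable F 3 2 B B' \<and>
          ctgt F (ccomp F 2 A A') = ctgt F (ccomp F 2 B B')))"

definition three_convergent :: "'g polygraph_data \<Rightarrow> bool" where
  "three_convergent S \<longleftrightarrow> three_terminating S \<and> three_confluent S"

definition three_coherent :: "('c, 'm) cat_data_scheme \<Rightarrow> bool" where
  "three_coherent K \<longleftrightarrow>
     (\<forall>f g. parallel K 3 f g \<longrightarrow> (\<exists>h\<in>cells K 4. csrc K h = f \<and> ctgt K h = g))"


section \<open>The 4-polygraph of bicategories\<close>

datatype 'a bicat_gen =
    G_obj 'a
  | G_e 'a 'a
  | G_m 'a 'a 'a
  | G_i 'a
  | G_alpha 'a 'a 'a 'a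
  | G_lambda 'a 'a
  | G_rho 'a 'a
  | G_pi 'a 'a 'a 'a 'a
  | G_kappa 'a 'a 'a

primrec bicat_dim :: "'a bicat_gen \<Rightarrow> nat" where
  "bicat_dim (G_obj a) = 0"
| "bicat_dim (G_e a b) = 1"
| "bicat_dim (G_m a b c) = 2"
| "bicat_dim (G_i a) = 2"
| "bicat_dim (G_alpha a b c d) = 3"
| "bicat_dim (G_lambda a b) = 3"
| "bicat_dim (G_rho a b) = 3"
| "bicat_dim (G_pi a b c d e) = 4"
| "bicat_dim (G_kappa a b c) = 4"

type_synonym 'a bicat_term = "'a bicat_gen cell_term"

text \<open>In a composite of terms of different dimensions, the lower-dimensional one stands for its
  iterated identity.\<close>

definition bicat_lift :: "nat \<Rightarrow> 'a bicat_term \<Rightarrow> 'a bicat_term" where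
  "bicat_lift k t = (Ident ^^ (k - term_dim bicat_dim t)) t"

definition bicat_comp :: "nat \<Rightarrow> 'a bicat_term \<Rightarrow> 'a bicat_term \<Rightarrow> 'a bicat_term" where
  "bicat_comp i t u =
     (let k = max (term_dim bicat_dim t) (term_dim bicat_dim u)
      in Comp i (bicat_lift k t) (bicat_lift k u))"

abbreviation bicat_comp0 (infixl \<open>\<star>\<^sub>0\<close> 70) where "t \<star>\<^sub>0 u \<equiv> bicat_comp 0 t u"
abbreviation bicat_comp1 (infixl \<open>\<star>\<^sub>1\<close> 70) where "t \<star>\<^sub>1 u \<equiv> bicat_comp 1 t u"
abbreviation bicat_comp2 (infixl \<open>\<star>\<^sub>2\<close> 70) where "t \<star>\<^sub>2 u \<equiv> bicat_comp 2 t u"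

abbreviation "t_obj a \<equiv> Gen (G_obj a)"
abbreviation "t_e a b \<equiv> Gen (G_e a b)"
abbreviation "t_m a b c \<equiv> Gen (G_m a b c)"
abbreviation "t_i a \<equiv> Gen (G_i a)"
abbreviation "t_alpha a b c d \<equiv> Gen (G_alpha a b c d)"
abbreviation "t_lambda a b \<equiv> Gen (G_lambda a b)"
abbreviation "t_rho a b \<equiv> Gen (G_rho a b)"

primrec (nonexhaustive) bicat_src :: "'a bicat_gen \<Rightarrow> 'a bicat_term" where
  "bicat_src (G_e a b) = t_obj a"
| "bicat_src (G_m a b c) = t_e a b \<star>\<^sub>0 t_e b c"
| "bicat_src (G_i a) = Ident (t_obj a)"
| "bicat_src (G_alpha a b c d) = (t_m a b c \<star>\<^sub>0 t_e c d) \<star>\<^sub>1 t_m a c d"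
| "bicat_src (G_lambda a b) = (t_i a \<star>\<^sub>0 t_e a b) \<star>\<^sub>1 t_m a a b"
| "bicat_src (G_rho a b) = (t_e a b \<star>\<^sub>0 t_i b) \<star>\<^sub>1 t_m a b b"
| "bicat_src (G_pi a b c d e) =
     ((t_alpha a b c d \<star>\<^sub>0 t_e d e) \<star>\<^sub>1 t_m a d e)
     \<star>\<^sub>2 ((t_e a b \<star>\<^sub>0 t_m b c d \<star>\<^sub>0 t_e d e) \<star>\<^sub>1 t_alpha a b d e)
     \<star>\<^sub>2 ((t_e a b \<star>\<^sub>0 t_alpha b c d e) \<star>\<^sub>1 t_m a b e)"
| "bicat_src (G_kappa a b c) =
     ((t_e a b \<star>\<^sub>0 t_i b \<star>\<^sub>0 t_e b c) \<star>\<^sub>1 t_alpha a b b c)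
     \<star>\<^sub>2 ((t_e a b \<star>\<^sub>0 t_lambda b c) \<star>\<^sub>1 t_m a b c)"

primrec (nonexhaustive) bicat_tgt :: "'a bicat_gen \<Rightarrow> 'a bicat_term" where
  "bicat_tgt (G_e a b) = t_obj b"
| "bicat_tgt (G_m a b c) = t_e a c"
| "bicat_tgt (G_i a) = t_e a a"
| "bicat_tgt (G_alpha a b c d) = (t_e a b \<star>\<^sub>0 t_m b c d) \<star>\<^sub>1 t_m a b d"
| "bicat_tgt (G_lambda a b) = Ident (t_e a b)"
| "bicat_tgt (G_rho a b) = Ident (t_e a b)"
| "bicat_tgt (G_pi a b c d e) =
     ((t_m a b c \<star>\<^sub>0 t_e c d \<star>\<^sub>0 t_e d e) \<star>\<^sub>1 t_alpha a c d e)
     \<star>\<^sub>2 ((t_e a b \<star>\<^sub>0 t_e b c \<star>\<^sub>0 t_m c d e) \<star>\<^sub>1 t_alpha a b c e)"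
| "bicat_tgt (G_kappa a b c) = (t_rho a b \<star>\<^sub>0 t_e b c) \<star>\<^sub>1 t_m a b c"

text \<open>\<open>set_bicat_gen g\<close> is the set of parameters of \<open>g\<close>.\<close>

definition BiCat :: "'a set \<Rightarrow> 'a bicat_gen polygraph_data" where
  "BiCat C = \<lparr> gens = {g. set_bicat_gen g \<subseteq> C}, gdim = bicat_dim,
     gsrc = bicat_src, gtgt = bicat_tgt \<rparr>"


subsection \<open>It is a 4-polygraph\<close>

lemma gens_update_simps [simp]:
  "tsrc (S\<lparr>gens := X\<rparr>) = tsrc S" "ttgt (S\<lparr>gens := X\<rparr>) = ttgt S"
  "tsrc_at (S\<lparr>gens := X\<rparr>) = tsrc_at S" "ttgt_at (S\<lparr>gens := X\<rparr>) = ttgt_at S"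
proof -
  have "tsrc (S\<lparr>gens := X\<rparr>) t = tsrc S t \<and> ttgt (S\<lparr>gens := X\<rparr>) t = ttgt S t" for t
    by (induction t) auto
  then show *: "tsrc (S\<lparr>gens := X\<rparr>) = tsrc S" "ttgt (S\<lparr>gens := X\<rparr>) = ttgt S" by auto
  show "tsrc_at (S\<lparr>gens := X\<rparr>) = tsrc_at S" "ttgt_at (S\<lparr>gens := X\<rparr>) = ttgt_at S"
    by (auto simp: tsrc_at_def ttgt_at_def * fun_eq_iff)
qed

lemma cat_law_gens_update: "cat_law (S\<lparr>gens := X\<rparr>) t u \<Longrightarrow> cat_law S t u"
proof (induction rule: cat_law.induct)
  case (unit_left i t)
  then show ?case using cat_law.unit_left[of i S t] by simp
next
  case (unit_right i t)
  then show ?case using cat_law.unit_right[of i S t] by simp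
next
  case (inv_right g i)
  then show ?case using cat_law.inv_right[of S g i] by simp
next
  case (inv_left g i)
  then show ?case using cat_law.inv_left[of S g i] by simp
qed (auto intro: cat_law.intros)

lemma wf_term_gens_update:
  assumes "X \<subseteq> gens S"
  shows "wf_term (S\<lparr>gens := X\<rparr>) n p t \<Longrightarrow> wf_term S n p t"
    and "term_eq (S\<lparr>gens := X\<rparr>) n p t u \<Longrightarrow> term_eq S n p t u"
proof (induction rule: wf_term_term_eq.inducts)
  case (wf_Gen g)
  then show ?case using assms by (auto intro: wf_term_term_eq.wf_Gen)
next
  case (wf_GenInv g)
  then show ?case using assms by (auto intro: wf_term_term_eq.wf_GenInv)
next
  case (teq_law t u)
  then show ?case by (auto intro: wf_term_term_eq.teq_law cat_law_gens_update)
qed (auto intro: wf_term_term_eq.intros)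

lemma BiCat_simps [simp]:
  "gens (BiCat C) = {g. set_bicat_gen g \<subseteq> C}" "gdim (BiCat C) = bicat_dim"
  "gsrc (BiCat C) = bicat_src" "gtgt (BiCat C) = bicat_tgt"
  by (simp_all add: BiCat_def)

definition BiCat3 :: "'a set \<Rightarrow> 'a bicat_gen polygraph_data" where
  "BiCat3 C = (BiCat C)\<lparr>gens := {g. set_bicat_gen g \<subseteq> C \<and> bicat_dim g \<le> 3}\<rparr>"

lemma BiCat3_simps [simp]:
  "gens (BiCat3 C) = {g. set_bicat_gen g \<subseteq> C \<and> bicat_dim g \<le> 3}" "gdim (BiCat3 C) = bicat_dim"
  "gsrc (BiCat3 C) = bicat_src" "gtgt (BiCat3 C) = bicat_tgt"
  by (simp_all add: BiCat3_def)

lemma wf_BiCat3: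
  "wf_term (BiCat3 C) n p t \<Longrightarrow> wf_term (BiCat C) n p t"
  "term_eq (BiCat3 C) n p t u \<Longrightarrow> term_eq (BiCat C) n p t u"
  unfolding BiCat3_def
  by (erule wf_term_gens_update[rotated]; auto)+

lemmas bicat_unfold = bicat_comp_def bicat_lift_def Let_def tsrc_at_def ttgt_at_def eval_nat_numeral

lemma wf_bicat_gen:
  assumes "set_bicat_gen g \<subseteq> C" "bicat_dim g \<le> n" "bicat_dim g \<le> 3"
  shows "wf_term (BiCat3 C) n p (Gen g)"
  using assms by (auto intro: wf_Gen)

context
  fixes C :: "'a set" and n p :: nat
  assumes n1: "1 \<le> n"
begin

lemma wf_gens1:
  "a \<in> C \<Longrightarrow> wf_term (BiCat3 C) n p (t_obj a)"
  "a \<in> C \<Longrightarrow> b \<in> C \<Longrightarrow> wf_term (BiCat3 C) n p (t_e a b)"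
  "a \<in> C \<Longrightarrow> wf_term (BiCat3 C) n p (Ident (t_obj a))"
  using n1 by (auto intro!: wf_bicat_gen wf_Ident)

lemma wf_1cells:
  assumes "a \<in> C" "b \<in> C" "c \<in> C" "d \<in> C"
  shows "wf_term (BiCat3 C) n p (Comp 0 (t_e a b) (t_e b c))"
    "wf_term (BiCat3 C) n p (Comp 0 (Comp 0 (t_e a b) (t_e b c)) (t_e c d))"
    "wf_term (BiCat3 C) n p (Comp 0 (t_e a b) (Comp 0 (t_e b c) (t_e c d)))"
    "wf_term (BiCat3 C) n p (Comp 0 (Ident (t_obj a)) (t_e a b))"
    "wf_term (BiCat3 C) n p (Comp 0 (t_e a b) (Ident (t_obj b)))"
  using assms by (auto intro!: wf_Comp wf_gens1 teq_refl simp: bicat_unfold)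

lemma eq_1cells:
  assumes "a \<in> C" "b \<in> C" "c \<in> C" "d \<in> C"
  shows "term_eq (BiCat3 C) n p (Comp 0 (Comp 0 (t_e a b) (t_e b c)) (t_e c d)) (Comp 0 (t_e a b) (Comp 0 (t_e b c) (t_e c d)))"
    "term_eq (BiCat3 C) n p (Comp 0 (Ident (t_obj a)) (t_e a b)) (t_e a b)"
    "term_eq (BiCat3 C) n p (Comp 0 (t_e a b) (Ident (t_obj b))) (t_e a b)"
proof -
  show "term_eq (BiCat3 C) n p (Comp 0 (Comp 0 (t_e a b) (t_e b c)) (t_e c d)) (Comp 0 (t_e a b) (Comp 0 (t_e b c) (t_e c d)))"
    by (rule teq_law[OF cat_law.assoc wf_1cells(2,3)[OF assms]])
  show "term_eq (BiCat3 C) n p (Comp 0 (Ident (t_obj a)) (t_e a b)) (t_e a b)"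
    using cat_law.unit_left[of 0 "BiCat3 C" "t_e a b"] wf_1cells(4)[OF assms] wf_gens1(2)[OF assms(1,2)]
    by (intro teq_law) (auto simp: bicat_unfold)
  show "term_eq (BiCat3 C) n p (Comp 0 (t_e a b) (Ident (t_obj b))) (t_e a b)"
    using cat_law.unit_right[of 0 "BiCat3 C" "t_e a b"] wf_1cells(5)[OF assms] wf_gens1(2)[OF assms(1,2)]
    by (intro teq_law) (auto simp: bicat_unfold)
qed

lemma wf_gens2:
  assumes n2: "2 \<le> n"
  shows "a \<in> C \<Longrightarrow> b \<in> C \<Longrightarrow> c \<in> C \<Longrightarrow> wf_term (BiCat3 C) n p (t_m a b c)"
    "a \<in> C \<Longrightarrow> wf_term (BiCat3 C) n p (t_i a)"
    "wf_term (BiCat3 C) n p t \<Longrightarrow> term_dim bicat_dim t \<le> 1 \<Longrightarrow> wf_term (BiCat3 C) n p (Ident t)"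
  using n2 by (auto intro!: wf_bicat_gen wf_Ident)

lemma wf_2cells:
  assumes n2: "2 \<le> n" and "a \<in> C" "b \<in> C" "c \<in> C" "d \<in> C"
  shows "wf_term (BiCat3 C) n p (bicat_src (G_alpha a b c d))" "wf_term (BiCat3 C) n p (bicat_tgt (G_alpha a b c d))"
    "wf_term (BiCat3 C) n p (bicat_src (G_lambda a b))" "wf_term (BiCat3 C) n p (bicat_src (G_rho a b))" "wf_term (BiCat3 C) n p (Ident (t_e a b))"
  using assms by (auto intro!: wf_Comp wf_gens1 wf_gens2 wf_1cells teq_refl simp: bicat_unfold)

end

lemma polygraph_BiCat3: "polygraph 3 (BiCat3 C)"
  unfolding polygraph_def
proof (intro ballI conjI allI impI)
  fix g assume "g \<in> gens (BiCat3 C)"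
  then have g: "set_bicat_gen g \<subseteq> C" "bicat_dim g \<le> 3" by auto
  show "gdim (BiCat3 C) g \<le> 3" using g by simp
  fix k assume "gdim (BiCat3 C) g = Suc k"
  then have k: "bicat_dim g = Suc k" by simp
  have w0: "wf_term (BiCat3 C) 0 0 (t_obj a)" if "a \<in> C" for a
    using that by (auto intro!: wf_Gen)
  note one = le_refl[of "1 :: nat"] one_le_numeral[where ?'a = nat, of "num.Bit0 num.One"]
  have w: "wf_term (BiCat3 C) k k (bicat_src g) \<and> wf_term (BiCat3 C) k k (bicat_tgt g)"
    using g k
  proof (cases g)
    case (G_m a b c)
    then have "k = 1" using k by simp
    then show ?thesis using G_m g wf_1cells(1)[OF one(1)] wf_gens1[OF one(1)] by (auto simp: bicat_unfold)
  next
    case (G_i a)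
    then have "k = 1" using k by simp
    then show ?thesis using G_i g wf_gens1[OF one(1)] by auto
  next
    case (G_alpha a b c d)
    then have "k = 2" using k by simp
    then show ?thesis using G_alpha g wf_2cells(1,2)[OF one(2) order.refl] by auto
  next
    case (G_lambda a b)
    then have "k = 2" using k by simp
    then show ?thesis using G_lambda g wf_2cells(3,5)[OF one(2) order.refl] by auto
  next
    case (G_rho a b)
    then have "k = 2" using k by simp
    then show ?thesis using G_rho g wf_2cells(4,5)[OF one(2) order.refl] by auto
  qed (auto intro: w0)
  then show "wf_term (BiCat3 C) k k (gsrc (BiCat3 C) g)" "wf_term (BiCat3 C) k k (gtgt (BiCat3 C) g)"
    by simp_all
  show "tdim (BiCat3 C) (gsrc (BiCat3 C) g) = k" "tdim (BiCat3 C) (gtgt (BiCat3 C) g) = k"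
    using k g by (cases g; simp add: bicat_unfold)+
  assume "0 < k"
  have "term_eq (BiCat3 C) k k (tsrc (BiCat3 C) (bicat_src g)) (tsrc (BiCat3 C) (bicat_tgt g)) \<and>
    term_eq (BiCat3 C) k k (ttgt (BiCat3 C) (bicat_src g)) (ttgt (BiCat3 C) (bicat_tgt g))"
    using g k \<open>0 < k\<close>
  proof (cases g)
    case (G_m a b c)
    then have "k = 1" using k by simp
    then show ?thesis using G_m g wf_gens1[OF one(1)] by (auto simp: bicat_unfold intro!: teq_refl)
  next
    case (G_i a)
    then have "k = 1" using k by simp
    then show ?thesis using G_i g wf_gens1[OF one(1)] by (auto intro!: teq_refl)
  next
    case (G_alpha a b c d)
    then have "k = 2" using k by simp
    then show ?thesis using G_alpha g eq_1cells(1)[OF one(2)] wf_gens1[OF one(2)]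
      by (auto simp: bicat_unfold intro!: teq_refl)
  next
    case (G_lambda a b)
    then have "k = 2" using k by simp
    then show ?thesis using G_lambda g eq_1cells(2)[OF one(2)] wf_gens1[OF one(2)]
      by (auto simp: bicat_unfold intro!: teq_refl)
  next
    case (G_rho a b)
    then have "k = 2" using k by simp
    then show ?thesis using G_rho g eq_1cells(3)[OF one(2)] wf_gens1[OF one(2)]
      by (auto simp: bicat_unfold intro!: teq_refl)
  qed auto
  then show "term_eq (BiCat3 C) k k (tsrc (BiCat3 C) (gsrc (BiCat3 C) g)) (tsrc (BiCat3 C) (gtgt (BiCat3 C) g))"
   "term_eq (BiCat3 C) k k (ttgt (BiCat3 C) (gsrc (BiCat3 C) g)) (ttgt (BiCat3 C) (gtgt (BiCat3 C) g))"
    by simp_all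
qed

context polygraph_loc
begin

lemma whisker_right:
  assumes w: "wf_term S n p (Comp 0 (Comp 1 x y) (Ident f))" and f: "tdim S f = 1"
  shows "term_eq S n p (Comp 0 (Comp 1 x y) (Ident f)) (Comp 1 (Comp 0 x (Ident f)) (Comp 0 y (Ident f)))"
    "wf_term S n p (Comp 1 (Comp 0 x (Ident f)) (Comp 0 y (Ident f)))"
proof -
  note c = wf_CompD[OF w]
  have ff: "wf_term S n p (Comp 1 (Ident f) (Ident f))"
    using c(2) f by (auto intro!: wf_Comp teq_refl simp: at_top elim: wf_IdentE)
  have "cat_law S (Comp 1 (Ident f) (Ident f)) (Ident f)"
    using cat_law.unit_left[of 1 S "Ident f"] f at_top(2)[of "Ident f" 1] by simp
  then have "term_eq S n p (Ident f) (Comp 1 (Ident f) (Ident f))"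
    by (intro teq_sym[OF teq_law] ff c(2))
  then have e: "term_eq S n p (Comp 0 (Comp 1 x y) (Ident f)) (Comp 0 (Comp 1 x y) (Comp 1 (Ident f) (Ident f)))"
    by (rule Comp_cong[OF w teq_refl[OF c(1)]])
  have w2: "wf_term S n p (Comp 0 (Comp 1 x y) (Comp 1 (Ident f) (Ident f)))" using term_eq_wf[OF e] by blast
  have 01: "(0::nat) < 1" by simp
  show w3: "wf_term S n p (Comp 1 (Comp 0 x (Ident f)) (Comp 0 y (Ident f)))" by (rule wf_exchange[OF 01 w2])
  show "term_eq S n p (Comp 0 (Comp 1 x y) (Ident f)) (Comp 1 (Comp 0 x (Ident f)) (Comp 0 y (Ident f)))"
    by (rule teq_trans[OF e teq_law[OF cat_law.exchange[OF 01] w2 w3]])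
qed

lemma whisker_left:
  assumes w: "wf_term S n p (Comp 0 (Ident f) (Comp 1 x y))" and f: "tdim S f = 1"
  shows "term_eq S n p (Comp 0 (Ident f) (Comp 1 x y)) (Comp 1 (Comp 0 (Ident f) x) (Comp 0 (Ident f) y))"
    "wf_term S n p (Comp 1 (Comp 0 (Ident f) x) (Comp 0 (Ident f) y))"
proof -
  note c = wf_CompD[OF w]
  have ff: "wf_term S n p (Comp 1 (Ident f) (Ident f))"
    using c(1) f by (auto intro!: wf_Comp teq_refl simp: at_top elim: wf_IdentE)
  have "cat_law S (Comp 1 (Ident f) (Ident f)) (Ident f)"
    using cat_law.unit_left[of 1 S "Ident f"] f at_top(2)[of "Ident f" 1] by simp
  then have "term_eq S n p (Ident f) (Comp 1 (Ident f) (Ident f))"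
    by (intro teq_sym[OF teq_law] ff c(1))
  then have e: "term_eq S n p (Comp 0 (Ident f) (Comp 1 x y)) (Comp 0 (Comp 1 (Ident f) (Ident f)) (Comp 1 x y))"
    by (rule Comp_cong[OF w _ teq_refl[OF c(2)]])
  have w2: "wf_term S n p (Comp 0 (Comp 1 (Ident f) (Ident f)) (Comp 1 x y))" using term_eq_wf[OF e] by blast
  have 01: "(0::nat) < 1" by simp
  show w3: "wf_term S n p (Comp 1 (Comp 0 (Ident f) x) (Comp 0 (Ident f) y))" by (rule wf_exchange[OF 01 w2])
  show "term_eq S n p (Comp 0 (Ident f) (Comp 1 x y)) (Comp 1 (Comp 0 (Ident f) x) (Comp 0 (Ident f) y))"
    by (rule teq_trans[OF e teq_law[OF cat_law.exchange[OF 01] w2 w3]])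
qed

lemma interchange:
  assumes w: "wf_term S n p (Comp 0 x y)" and d: "tdim S x = 2"
  shows "term_eq S n p (Comp 1 (Comp 0 x (Ident (tsrc S y))) (Comp 0 (Ident (ttgt S x)) y)) (Comp 0 x y)"
    "term_eq S n p (Comp 1 (Comp 0 (Ident (tsrc S x)) y) (Comp 0 x (Ident (ttgt S y)))) (Comp 0 x y)"
proof -
  note c = wf_CompD[OF w]
  have dy: "tdim S y = 2" using c d by simp
  have dx: "tdim S x = Suc 1" "tdim S y = Suc 1" using d dy by simp_all
  have 2: "2 \<le> n" using wf_term_dim[OF c(1)] d by simp
  note bx = boundary(1-4)[OF c(1) dx(1)] and bY = boundary(1-4)[OF c(2) dx(2)]
  have wi: "wf_term S n p (Ident (tsrc S x))" "wf_term S n p (Ident (ttgt S x))"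
    "wf_term S n p (Ident (tsrc S y))" "wf_term S n p (Ident (ttgt S y))"
    using bx bY 2 by (auto intro!: wf_Ident)
  have w1: "wf_term S n p (Comp 1 x (Ident (ttgt S x)))" "wf_term S n p (Comp 1 (Ident (tsrc S x)) x)"
    "wf_term S n p (Comp 1 y (Ident (ttgt S y)))" "wf_term S n p (Comp 1 (Ident (tsrc S y)) y)"
    using c bx bY wi dx by (auto intro!: wf_Comp teq_refl simp: at_top)
  have u: "term_eq S n p x (Comp 1 x (Ident (ttgt S x)))" "term_eq S n p x (Comp 1 (Ident (tsrc S x)) x)"
    "term_eq S n p y (Comp 1 y (Ident (ttgt S y)))" "term_eq S n p y (Comp 1 (Ident (tsrc S y)) y)"
    using cat_law.unit_right[of 1 S x] cat_law.unit_left[of 1 S x] cat_law.unit_right[of 1 S y]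
      cat_law.unit_left[of 1 S y] w1 c(1,2) dx
    by (auto simp: at_top intro!: teq_sym[OF teq_law])
  have 01: "(0::nat) < 1" by simp
  note e = Comp_cong[OF w u(1) u(4)] Comp_cong[OF w u(2) u(3)]
  have w2: "wf_term S n p (Comp 0 (Comp 1 x (Ident (ttgt S x))) (Comp 1 (Ident (tsrc S y)) y))"
    "wf_term S n p (Comp 0 (Comp 1 (Ident (tsrc S x)) x) (Comp 1 y (Ident (ttgt S y))))"
    using term_eq_wf[OF e(1)] term_eq_wf[OF e(2)] by blast+
  show "term_eq S n p (Comp 1 (Comp 0 x (Ident (tsrc S y))) (Comp 0 (Ident (ttgt S x)) y)) (Comp 0 x y)"
    by (rule teq_sym[OF teq_trans[OF e(1) teq_law[OF cat_law.exchange[OF 01] w2(1) wf_exchange[OF 01 w2(1)]]]])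
  show "term_eq S n p (Comp 1 (Comp 0 (Ident (tsrc S x)) y) (Comp 0 x (Ident (ttgt S y)))) (Comp 0 x y)"
    by (rule teq_sym[OF teq_trans[OF e(2) teq_law[OF cat_law.exchange[OF 01] w2(2) wf_exchange[OF 01 w2(2)]]]])
qed

lemma assoc_left:
  assumes "term_eq S n p x (Comp 1 y z)" "wf_term S n p (Comp 1 x v)"
  shows "term_eq S n p (Comp 1 x v) (Comp 1 y (Comp 1 z v))"
    "wf_term S n p (Comp 1 y (Comp 1 z v))"
proof -
  note c = wf_CompD[OF assms(2)]
  have e: "term_eq S n p (Comp 1 x v) (Comp 1 (Comp 1 y z) v)"
    by (rule Comp_cong[OF assms(2,1) teq_refl[OF c(2)]])
  have yz: "wf_term S n p (Comp 1 y z)" using term_eq_wf[OF assms(1)] by blast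
  note d = wf_CompD[OF yz]
  have e2: "wf_term S n p (Comp 1 (Comp 1 y z) v)" using term_eq_wf[OF e] by blast
  have zv: "wf_term S n p (Comp 1 z v)"
    using wf_CompD[OF e2] Comp_at(4)[OF yz] d by (auto intro!: wf_Comp)
  show "term_eq S n p (Comp 1 x v) (Comp 1 y (Comp 1 z v))" by (rule teq_trans[OF e eq_assoc[OF yz zv]])
  show "wf_term S n p (Comp 1 y (Comp 1 z v))" by (rule wf_assoc[OF yz zv])
qed

end

lemma polygraph_BiCat_aux:
  fixes N :: nat
  assumes N: "3 \<le> N" and C: "a \<in> C" "b \<in> C" "c \<in> C"
  shows "d \<in> C \<Longrightarrow> e \<in> C \<Longrightarrow>
      wf_term (BiCat3 C) N N (bicat_src (G_pi a b c d e)) \<and>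
      wf_term (BiCat3 C) N N (bicat_tgt (G_pi a b c d e)) \<and>
      term_eq (BiCat3 C) N N (tsrc (BiCat3 C) (bicat_src (G_pi a b c d e))) (tsrc (BiCat3 C) (bicat_tgt (G_pi a b c d e))) \<and>
      term_eq (BiCat3 C) N N (ttgt (BiCat3 C) (bicat_src (G_pi a b c d e))) (ttgt (BiCat3 C) (bicat_tgt (G_pi a b c d e)))"
    and "wf_term (BiCat3 C) N N (bicat_src (G_kappa a b c)) \<and>
      wf_term (BiCat3 C) N N (bicat_tgt (G_kappa a b c)) \<and>
      term_eq (BiCat3 C) N N (tsrc (BiCat3 C) (bicat_src (G_kappa a b c))) (tsrc (BiCat3 C) (bicat_tgt (G_kappa a b c))) \<and>
      term_eq (BiCat3 C) N N (ttgt (BiCat3 C) (bicat_src (G_kappa a b c))) (ttgt (BiCat3 C) (bicat_tgt (G_kappa a b c)))"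
proof -
  interpret polygraph_loc 3 "BiCat3 C" by unfold_locales (rule polygraph_BiCat3)
  let ?W = "wf_term (BiCat3 C) N N" and ?Q = "term_eq (BiCat3 C) N N"
  let ?s = "tsrc (BiCat3 C)" and ?t = "ttgt (BiCat3 C)" and ?I = Ident
  have 13: "1 \<le> N" "2 \<le> N" using N by simp_all
  have wm: "?W (t_m a b c)" if "a \<in> C" "b \<in> C" "c \<in> C" for a b c
    using that N by (auto intro!: wf_bicat_gen)
  have wi: "?W (t_i a)" if "a \<in> C" for a
    using that N by (auto intro!: wf_bicat_gen)
  have wa: "?W (t_alpha a b c d)" if "a \<in> C" "b \<in> C" "c \<in> C" "d \<in> C" for a b c d
    using that N by (auto intro!: wf_bicat_gen)
  have wlr: "?W (t_lambda a b)" "?W (t_rho a b)" if "a \<in> C" "b \<in> C" for a b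
    using that N by (auto intro!: wf_bicat_gen)
  have wI: "?W (Ident t)" if "?W t" "term_dim bicat_dim t \<le> 2" for t
    using that N by (auto intro!: wf_Ident)
  note wintro = wf_gens1(1,2)[OF 13(1)] wm wi wa wlr wI wf_Comp teq_refl
  have S23: "Suc 2 = 3" "Suc 1 = 2" by simp_all
  note C = C
  show "?W (bicat_src (G_pi a b c d e)) \<and> ?W (bicat_tgt (G_pi a b c d e)) \<and>
     ?Q (?s (bicat_src (G_pi a b c d e))) (?s (bicat_tgt (G_pi a b c d e))) \<and>
     ?Q (?t (bicat_src (G_pi a b c d e))) (?t (bicat_tgt (G_pi a b c d e)))"
    if "d \<in> C" "e \<in> C"
  proof -
    note C = C that
    let ?ab = "t_e a b" and ?bc = "t_e b c" and ?cd = "t_e c d" and ?de = "t_e d e"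
    define A1 where "A1 = Comp 1 (Comp 0 (t_alpha a b c d) (?I (?I (t_e d e)))) (?I (t_m a d e))"
    define A2 where "A2 = Comp 1 (?I (Comp 0 (Comp 0 (?I (t_e a b)) (t_m b c d)) (?I (t_e d e)))) (t_alpha a b d e)"
    define A3 where "A3 = Comp 1 (Comp 0 (?I (?I (t_e a b))) (t_alpha b c d e)) (?I (t_m a b e))"
    define B1 where "B1 = Comp 1 (?I (Comp 0 (Comp 0 (t_m a b c) (?I (t_e c d))) (?I (t_e d e)))) (t_alpha a c d e)"
    define B2 where "B2 = Comp 1 (?I (Comp 0 (?I (Comp 0 (t_e a b) (t_e b c))) (t_m c d e))) (t_alpha a b c e)"
    note defs = A1_def A2_def A3_def B1_def B2_def
    have eqs: "bicat_src (G_pi a b c d e) = Comp 2 (Comp 2 A1 A2) A3" "bicat_tgt (G_pi a b c d e) = Comp 2 B1 B2"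
      by (simp_all add: bicat_unfold defs)
    have W: "?W A1" "?W A2" "?W A3" "?W B1" "?W B2"
      unfolding defs using C by (auto intro!: wintro simp: bicat_unfold)
    have d: "tdim (BiCat3 C) A1 = Suc 2" "tdim (BiCat3 C) A2 = Suc 2" "tdim (BiCat3 C) A3 = Suc 2"
      "tdim (BiCat3 C) B1 = Suc 2" "tdim (BiCat3 C) B2 = Suc 2"
      by (simp_all add: defs)
    have b: "?s A1 = Comp 1 (Comp 0 (Comp 1 (Comp 0 (t_m a b c) (?I ?cd)) (t_m a c d)) (?I ?de)) (t_m a d e)"
      "?t A1 = Comp 1 (Comp 0 (Comp 1 (Comp 0 (?I ?ab) (t_m b c d)) (t_m a b d)) (?I ?de)) (t_m a d e)"
      "?s A2 = Comp 1 (Comp 0 (Comp 0 (?I ?ab) (t_m b c d)) (?I ?de)) (Comp 1 (Comp 0 (t_m a b d) (?I ?de)) (t_m a d e))"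
      "?t A2 = Comp 1 (Comp 0 (Comp 0 (?I ?ab) (t_m b c d)) (?I ?de)) (Comp 1 (Comp 0 (?I ?ab) (t_m b d e)) (t_m a b e))"
      "?s A3 = Comp 1 (Comp 0 (?I ?ab) (Comp 1 (Comp 0 (t_m b c d) (?I ?de)) (t_m b d e))) (t_m a b e)"
      "?t A3 = Comp 1 (Comp 0 (?I ?ab) (Comp 1 (Comp 0 (?I ?bc) (t_m c d e)) (t_m b c e))) (t_m a b e)"
      "?s B1 = Comp 1 (Comp 0 (Comp 0 (t_m a b c) (?I ?cd)) (?I ?de)) (Comp 1 (Comp 0 (t_m a c d) (?I ?de)) (t_m a d e))"
      "?t B1 = Comp 1 (Comp 0 (Comp 0 (t_m a b c) (?I ?cd)) (?I ?de)) (Comp 1 (Comp 0 (?I (t_e a c)) (t_m c d e)) (t_m a c e))"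
      "?s B2 = Comp 1 (Comp 0 (?I (Comp 0 ?ab ?bc)) (t_m c d e)) (Comp 1 (Comp 0 (t_m a b c) (?I (t_e c e))) (t_m a c e))"
      "?t B2 = Comp 1 (Comp 0 (?I (Comp 0 ?ab ?bc)) (t_m c d e)) (Comp 1 (Comp 0 (?I ?ab) (t_m b c e)) (t_m a b e))"
      by (simp_all add: defs bicat_unfold)
    note bw = boundary(1,2)[OF W(1) d(1), unfolded b] boundary(1,2)[OF W(2) d(2), unfolded b]
      boundary(1,2)[OF W(3) d(3), unfolded b] boundary(1,2)[OF W(4) d(4), unfolded b]
      boundary(1,2)[OF W(5) d(5), unfolded b]
    have de: "tdim (BiCat3 C) ?de = 1" "tdim (BiCat3 C) ?ab = 1" by simp_all
    have E1: "?Q (?s A1) (?s B1)"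
      unfolding b by (rule assoc_left(1)[OF whisker_right(1)[OF wf_CompD(1)[OF bw(1)] de(1)] bw(1)])
    have E2: "?Q (?t A1) (?s A2)"
      unfolding b by (rule assoc_left(1)[OF whisker_right(1)[OF wf_CompD(1)[OF bw(2)] de(1)] bw(2)])
    note l3 = assoc_left[OF whisker_left(1)[OF wf_CompD(1)[OF bw(5)] de(2)] bw(5)]
    have "?Q (Comp 0 (Comp 0 (?I ?ab) (t_m b c d)) (?I ?de)) (Comp 0 (?I ?ab) (Comp 0 (t_m b c d) (?I ?de)))"
      by (rule teq_law[OF cat_law.assoc wf_CompD(1)[OF bw(4)] wf_CompD(1)[OF l3(2)]])
    from Comp_cong[OF bw(4) this teq_refl[OF wf_CompD(2)[OF bw(4)]]]
    have E3: "?Q (?t A2) (?s A3)"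
      unfolding b using teq_sym[OF l3(1)] by (rule teq_trans)
    note l4 = assoc_left[OF whisker_left(1)[OF wf_CompD(1)[OF bw(6)] de(2)] bw(6)]
    have wm2: "?W (Comp 0 (?I (Comp 0 ?ab ?bc)) (t_m c d e))" by (rule wf_CompD(1)[OF bw(10)])
    have wii: "?W (Comp 0 (?I ?ab) (?I ?bc))" "?W (?I (Comp 0 ?ab ?bc))"
      "?W (Comp 0 (?I ?cd) (?I ?de))" "?W (?I (Comp 0 ?cd ?de))"
      using C by (auto intro!: wintro simp: bicat_unfold)
    have ii: "?Q (?I (Comp 0 ?ab ?bc)) (Comp 0 (?I ?ab) (?I ?bc))"
      "?Q (?I (Comp 0 ?cd ?de)) (Comp 0 (?I ?cd) (?I ?de))"
      using wii by (auto intro: teq_law[OF cat_law.id_comp])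
    have x1: "?Q (Comp 0 (?I (Comp 0 ?ab ?bc)) (t_m c d e)) (Comp 0 (Comp 0 (?I ?ab) (?I ?bc)) (t_m c d e))"
      by (rule Comp_cong[OF wm2 ii(1) teq_refl[OF wf_CompD(2)[OF wm2]]])
    have x2: "?Q (Comp 0 (Comp 0 (?I ?ab) (?I ?bc)) (t_m c d e)) (Comp 0 (?I ?ab) (Comp 0 (?I ?bc) (t_m c d e)))"
      using term_eq_wf[OF x1] wf_CompD(1)[OF l4(2)] by (blast intro: teq_law cat_law.assoc)
    from Comp_cong[OF bw(10) teq_trans[OF x1 x2] teq_refl[OF wf_CompD(2)[OF bw(10)]]]
    have E5: "?Q (?t A3) (?t B2)"
      unfolding b using l4(1) by (meson teq_sym teq_trans)
    have wmm: "?W (Comp 0 (t_m a b c) (t_m c d e))"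
      using C by (auto intro!: wintro simp: bicat_unfold)
    have dm: "tdim (BiCat3 C) (t_m a b c) = 2" by simp
    have ic: "?Q (Comp 1 (Comp 0 (t_m a b c) (?I (Comp 0 ?cd ?de))) (Comp 0 (?I (t_e a c)) (t_m c d e))) (Comp 0 (t_m a b c) (t_m c d e))"
      "?Q (Comp 1 (Comp 0 (?I (Comp 0 ?ab ?bc)) (t_m c d e)) (Comp 0 (t_m a b c) (?I (t_e c e)))) (Comp 0 (t_m a b c) (t_m c d e))"
      using interchange[OF wmm dm] by (simp_all add: bicat_unfold)
    have wL: "?W (Comp 1 (Comp 0 (t_m a b c) (?I (Comp 0 ?cd ?de))) (Comp 0 (?I (t_e a c)) (t_m c d e)))"
      using term_eq_wf[OF ic(1)] by blast
    have y1: "?Q (Comp 0 (t_m a b c) (?I (Comp 0 ?cd ?de))) (Comp 0 (t_m a b c) (Comp 0 (?I ?cd) (?I ?de)))"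
      by (rule Comp_cong[OF wf_CompD(1)[OF wL] teq_refl ii(2)]) (use C in \<open>auto intro!: wintro\<close>)
    have y2: "?Q (Comp 0 (Comp 0 (t_m a b c) (?I ?cd)) (?I ?de)) (Comp 0 (t_m a b c) (Comp 0 (?I ?cd) (?I ?de)))"
      using term_eq_wf[OF y1] wf_CompD(1)[OF bw(8)] by (blast intro: teq_law cat_law.assoc)
    note y = teq_trans[OF y2 teq_sym[OF y1]]
    have tB1: "?Q (?t B1) (Comp 1 (Comp 0 (t_m a b c) (?I (Comp 0 ?cd ?de))) (Comp 1 (Comp 0 (?I (t_e a c)) (t_m c d e)) (t_m a c e)))"
      unfolding b by (rule Comp_cong[OF bw(8) y teq_refl[OF wf_CompD(2)[OF bw(8)]]])
    have mm: "?W (Comp 1 (Comp 0 (t_m a b c) (t_m c d e)) (t_m a c e))"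
      using C by (auto intro!: wintro simp: bicat_unfold)
    have "?Q (Comp 1 (Comp 0 (t_m a b c) (t_m c d e)) (t_m a c e)) (?t B1)"
      "?Q (Comp 1 (Comp 0 (t_m a b c) (t_m c d e)) (t_m a c e)) (?s B2)"
      using assoc_left(1)[OF teq_sym[OF ic(1)] mm] assoc_left(1)[OF teq_sym[OF ic(2)] mm] teq_sym[OF tB1]
      by (auto simp: b(9) intro: teq_trans)
    then have E4: "?Q (?t B1) (?s B2)" by (meson teq_sym teq_trans)
    have at2: "tsrc_at (BiCat3 C) 2 X = ?s X" "ttgt_at (BiCat3 C) 2 X = ?t X"
      if "tdim (BiCat3 C) X = Suc 2" for X
      using at_top[OF that] by simp_all
    have w12: "?W (Comp 2 A1 A2)" by (rule wf_Comp[OF W(1,2)]) (simp_all only: d at2 E2)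
    have t12: "?t (Comp 2 A1 A2) = ?t A2" "?s (Comp 2 A1 A2) = ?s A1" "tdim (BiCat3 C) (Comp 2 A1 A2) = Suc 2"
      using d by simp_all
    have w123: "?W (Comp 2 (Comp 2 A1 A2) A3)"
      by (rule wf_Comp[OF w12 W(3)]) (simp_all only: d t12 at2 E3)
    have wB: "?W (Comp 2 B1 B2)" by (rule wf_Comp[OF W(4,5)]) (simp_all only: d at2 E4)
    have "?s (Comp 2 (Comp 2 A1 A2) A3) = ?s A1" "?t (Comp 2 (Comp 2 A1 A2) A3) = ?t A3"
      "?s (Comp 2 B1 B2) = ?s B1" "?t (Comp 2 B1 B2) = ?t B2"
      using d by simp_all
    then show ?thesis unfolding eqs using w123 wB E1 E5 by simp
  qed
  show "?W (bicat_src (G_kappa a b c)) \<and> ?W (bicat_tgt (G_kappa a b c)) \<and>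
     ?Q (?s (bicat_src (G_kappa a b c))) (?s (bicat_tgt (G_kappa a b c))) \<and>
     ?Q (?t (bicat_src (G_kappa a b c))) (?t (bicat_tgt (G_kappa a b c)))"
  proof -
    let ?ab = "t_e a b" and ?bc = "t_e b c"
    define K1 where "K1 = Comp 1 (?I (Comp 0 (Comp 0 (?I ?ab) (t_i b)) (?I ?bc))) (t_alpha a b b c)"
    define K2 where "K2 = Comp 1 (Comp 0 (?I (?I ?ab)) (t_lambda b c)) (?I (t_m a b c))"
    define R where "R = Comp 1 (Comp 0 (t_rho a b) (?I (?I ?bc))) (?I (t_m a b c))"
    note defs = K1_def K2_def R_def
    have eqs: "bicat_src (G_kappa a b c) = Comp 2 K1 K2" "bicat_tgt (G_kappa a b c) = R"
      by (simp_all add: bicat_unfold defs)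
    have W: "?W K1" "?W K2" "?W R"
      unfolding defs using C by (auto intro!: wintro simp: bicat_unfold)
    have d: "tdim (BiCat3 C) K1 = Suc 2" "tdim (BiCat3 C) K2 = Suc 2" "tdim (BiCat3 C) R = Suc 2"
      by (simp_all add: defs)
    have b: "?s K1 = Comp 1 (Comp 0 (Comp 0 (?I ?ab) (t_i b)) (?I ?bc)) (Comp 1 (Comp 0 (t_m a b b) (?I ?bc)) (t_m a b c))"
      "?t K1 = Comp 1 (Comp 0 (Comp 0 (?I ?ab) (t_i b)) (?I ?bc)) (Comp 1 (Comp 0 (?I ?ab) (t_m b b c)) (t_m a b c))"
      "?s K2 = Comp 1 (Comp 0 (?I ?ab) (Comp 1 (Comp 0 (t_i b) (?I ?bc)) (t_m b b c))) (t_m a b c)"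
      "?t K2 = Comp 1 (Comp 0 (?I ?ab) (?I ?bc)) (t_m a b c)"
      "?s R = Comp 1 (Comp 0 (Comp 1 (Comp 0 (?I ?ab) (t_i b)) (t_m a b b)) (?I ?bc)) (t_m a b c)"
      "?t R = Comp 1 (Comp 0 (?I ?ab) (?I ?bc)) (t_m a b c)"
      by (simp_all add: defs bicat_unfold)
    note bw = boundary(1,2)[OF W(1) d(1), unfolded b] boundary(1,2)[OF W(2) d(2), unfolded b]
      boundary(1,2)[OF W(3) d(3), unfolded b]
    have de: "tdim (BiCat3 C) ?bc = 1" "tdim (BiCat3 C) ?ab = 1" by simp_all
    have E1: "?Q (?s R) (?s K1)"
      unfolding b by (rule assoc_left(1)[OF whisker_right(1)[OF wf_CompD(1)[OF bw(5)] de(1)] bw(5)])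
    note l3 = assoc_left[OF whisker_left(1)[OF wf_CompD(1)[OF bw(3)] de(2)] bw(3)]
    have "?Q (Comp 0 (Comp 0 (?I ?ab) (t_i b)) (?I ?bc)) (Comp 0 (?I ?ab) (Comp 0 (t_i b) (?I ?bc)))"
      by (rule teq_law[OF cat_law.assoc wf_CompD(1)[OF bw(2)] wf_CompD(1)[OF l3(2)]])
    from Comp_cong[OF bw(2) this teq_refl[OF wf_CompD(2)[OF bw(2)]]]
    have E2: "?Q (?t K1) (?s K2)"
      unfolding b using teq_sym[OF l3(1)] by (rule teq_trans)
    have E3: "?Q (?t K2) (?t R)" unfolding b by (rule teq_refl[OF bw(4)])
    have w12: "?W (Comp 2 K1 K2)"
      by (rule wf_Comp[OF W(1,2)]) (simp_all only: d at_top[OF d(1)] at_top[OF d(2)] E2)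
    have "?s (Comp 2 K1 K2) = ?s K1" "?t (Comp 2 K1 K2) = ?t K2" using d by simp_all
    then show ?thesis unfolding eqs using w12 W(3) teq_sym[OF E1] E3 by simp
  qed
qed

theorem polygraph_BiCat: "polygraph 4 (BiCat C)"
  unfolding polygraph_def
proof (intro ballI conjI allI impI)
  fix g assume "g \<in> gens (BiCat C)"
  then have g: "set_bicat_gen g \<subseteq> C" by simp
  show "gdim (BiCat C) g \<le> 4" by (cases g) simp_all
  fix k assume "gdim (BiCat C) g = Suc k"
  then have k: "bicat_dim g = Suc k" by simp
  have st: "tsrc (BiCat3 C) = tsrc (BiCat C)" "ttgt (BiCat3 C) = ttgt (BiCat C)" by (simp_all add: BiCat3_def)
  show "tdim (BiCat C) (gsrc (BiCat C) g) = k" "tdim (BiCat C) (gtgt (BiCat C) g) = k"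
    using k by (cases g; simp add: bicat_unfold)+
  have "wf_term (BiCat3 C) k k (bicat_src g) \<and> wf_term (BiCat3 C) k k (bicat_tgt g) \<and>
    (0 < k \<longrightarrow> term_eq (BiCat3 C) k k (tsrc (BiCat3 C) (bicat_src g)) (tsrc (BiCat3 C) (bicat_tgt g)) \<and>
      term_eq (BiCat3 C) k k (ttgt (BiCat3 C) (bicat_src g)) (ttgt (BiCat3 C) (bicat_tgt g)))"
  proof (cases "bicat_dim g \<le> 3")
    case True
    then have "g \<in> gens (BiCat3 C)" using g by simp
    then show ?thesis using polygraph_BiCat3[of C] k unfolding polygraph_def by simp
  next
    case False
    then have "k = 3" using k by (cases g) simp_all
    then show ?thesis using False g polygraph_BiCat_aux[OF order.refl, of _ C]
      by (cases g) (simp_all del: bicat_src.simps bicat_tgt.simps)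
  qed
  note w = this[unfolded st]
  show "wf_term (BiCat C) k k (gsrc (BiCat C) g)" "wf_term (BiCat C) k k (gtgt (BiCat C) g)"
    using w by (simp_all add: wf_BiCat3)
  assume "0 < k"
  then show "term_eq (BiCat C) k k (tsrc (BiCat C) (gsrc (BiCat C) g)) (tsrc (BiCat C) (gtgt (BiCat C) g))"
   "term_eq (BiCat C) k k (ttgt (BiCat C) (gsrc (BiCat C) g)) (ttgt (BiCat C) (gtgt (BiCat C) g))"
    using w by (simp_all add: wf_BiCat3)
qed

end

theory Submission
  imports Defs
begin

text \<open>
  Every generating 2-cell has a single 1-cell as its target, so the 2-cells of the free category are
  forests: lists of binary trees with leaves \<open>e a b\<close> and nullary nodes \<open>i a\<close>. A 3-cell between two
  forests is a \<open>0\<close>-composite of 3-cells between the individual trees, and under the tensor product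
  \<open>f \<otimes> g = (f \<star>\<^sub>0 g) \<star>\<^sub>1 m\<close> the trees and the 3-cells between them form a bicategory-like structure whose
  constraints are the whiskered \<open>\<alpha>\<close>, \<open>\<lambda>\<close>, \<open>\<rho>\<close>. Rewriting decreases a polynomial weight of trees and
  preserves the list of leaves, while every tree rewrites to the right comb on its leaves; this gives
  convergence.

  For coherence, 3-cells are identified when a 4-cell connects them. For trees \<open>X\<close>, \<open>Z\<close> there is a
  3-cell \<open>n X Z\<close> from \<open>X \<otimes> Z\<close> to the tree obtained by prepending the leaves of \<open>X\<close> to \<open>Z\<close> one by one, built
  from \<open>\<alpha>\<close> and \<open>\<lambda>\<close> only. The pentagon, Kelly's unit law and the triangle say exactly that
  \<open>(f \<otimes> Z) \<star>\<^sub>2 n Y Z = n X Z\<close> for each constraint \<open>f\<close> from \<open>X\<close> to \<open>Y\<close>, hence this holds for every generated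
  3-cell \<open>f\<close>. So \<open>f \<otimes> Z\<close> only depends on \<open>X\<close> and \<open>Y\<close>; taking for \<open>Z\<close> a unit and using the naturality of
  \<open>\<rho>\<close>, so does \<open>f\<close>.
\<close>

section \<open>Coherence for bicategories whose objects are trees\<close>

text \<open>Two obstacles shape the argument. Cells of the free categories are classes of terms
  under a generated congruence, and a parallel pair only provides equal boundary classes, while the
  argument on trees needs equal trees. Hence the forest of a 2-dimensional term is computed by
  recursion on the raw term and shown to be invariant under every law; this also makes the weight of
  a 2-cell well defined. Secondly, \<open>G_pi\<close> and \<open>G_kappa\<close> only speak of
  generating 1-cells. Composing with a forest along 1-cells turns a constraint at leaves into the
  constraint at arbitrary trees, so the pentagon and the triangle spread to all trees.

  The tree to be normalized is \<open>X \<otimes> Z\<close> and not \<open>X\<close> because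
  absorbing \<open>X\<close> into \<open>Z\<close> from the left needs no right unit: \<rho> then
  occurs only as an arrow to be compared, and \<open>G_kappa\<close> is exactly that comparison. One
  development with parameters \<open>n\<close> and \<open>p\<close> serves both the 3-category
  without inverses and the (4,2)-category.\<close>

datatype 'a tree = Leaf 'a 'a | Unit 'a | Node "'a tree" "'a tree"

primrec left_end :: "'a tree \<Rightarrow> 'a" where
  "left_end (Leaf a b) = a"
| "left_end (Unit a) = a"
| "left_end (Node X Y) = left_end X"

primrec right_end :: "'a tree \<Rightarrow> 'a" where
  "right_end (Leaf a b) = b"
| "right_end (Unit a) = a"
| "right_end (Node X Y) = right_end Y"

primrec leaves :: "'a tree \<Rightarrow> ('a \<times> 'a) list" where
  "leaves (Leaf a b) = [(a, b)]"
| "leaves (Unit a) = []"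
| "leaves (Node X Y) = leaves X @ leaves Y"

primrec typed :: "'a set \<Rightarrow> 'a tree \<Rightarrow> bool" where
  "typed C (Leaf a b) \<longleftrightarrow> a \<in> C \<and> b \<in> C"
| "typed C (Unit a) \<longleftrightarrow> a \<in> C"
| "typed C (Node X Y) \<longleftrightarrow> typed C X \<and> typed C Y \<and> right_end X = left_end Y"

lemma typed_ends: "typed C X \<Longrightarrow> left_end X \<in> C \<and> right_end X \<in> C"
  by (induction X) auto

primrec prepend :: "'a tree \<Rightarrow> 'a tree \<Rightarrow> 'a tree" where
  "prepend (Leaf a b) Z = Node (Leaf a b) Z"
| "prepend (Unit a) Z = Z"
| "prepend (Node X Y) Z = prepend X (prepend Y Z)"

text \<open>The result depends on \<open>X\<close> only through its leaves. Arrows preserve leaves,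
  so both ends of an arrow have the same normal form, and \<open>normalize (src f) Z\<close> and
  \<open>normalize (trg f) Z\<close> have a common target.\<close>

lemma prepend_leaves: "prepend X Z = foldr (\<lambda>(a, b). Node (Leaf a b)) (leaves X) Z"
  by (induction X arbitrary: Z) auto

lemma typed_prepend:
  "typed C X \<Longrightarrow> typed C Z \<Longrightarrow> right_end X = left_end Z \<Longrightarrow>
    typed C (prepend X Z) \<and> left_end (prepend X Z) = left_end X \<and> right_end (prepend X Z) = right_end Z"
  by (induction X arbitrary: Z) auto

text \<open>A bicategory whose 1-cells are trees, composed by the constructor \<open>Node\<close>,
  and whose 2-cells are invertible and preserve ends and leaves. Sources and targets are total
  functions, so that the equations \<open>src_trg\<close> rewrite without side conditions;
  \<open>cmp_idn\<close> takes the object as a variable with an equation so that it also applies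
  when the object is not literally \<open>src f\<close>.\<close>

locale tree_bicategory =
  fixes C :: "'a set"
    and arr :: "'m \<Rightarrow> bool" and src trg :: "'m \<Rightarrow> 'a tree"
    and idn :: "'a tree \<Rightarrow> 'm"
    and cmp :: "'m \<Rightarrow> 'm \<Rightarrow> 'm" (infixr "\<cdot>" 65)
    and ten :: "'m \<Rightarrow> 'm \<Rightarrow> 'm" (infixr "\<otimes>" 70)
    and assr :: "'a tree \<Rightarrow> 'a tree \<Rightarrow> 'a tree \<Rightarrow> 'm"
    and lun run :: "'a tree \<Rightarrow> 'm"
  assumes arrD: "arr f \<Longrightarrow> typed C (src f) \<and> typed C (trg f) \<and> left_end (trg f) = left_end (src f) \<and>
        right_end (trg f) = right_end (src f) \<and> leaves (trg f) = leaves (src f)"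
    and src_trg [simp]: "src (idn X) = X" "trg (idn X) = X" "src (f \<cdot> g) = src f" "trg (f \<cdot> g) = trg g"
      "src (f \<otimes> g) = Node (src f) (src g)" "trg (f \<otimes> g) = Node (trg f) (trg g)"
      "src (assr X Y Z) = Node (Node X Y) Z" "trg (assr X Y Z) = Node X (Node Y Z)"
      "src (lun X) = Node (Unit (left_end X)) X" "trg (lun X) = X"
      "src (run X) = Node X (Unit (right_end X))" "trg (run X) = X"
    and arr_idn [simp]: "typed C X \<Longrightarrow> arr (idn X)"
    and arr_cmp [simp]: "arr f \<Longrightarrow> arr g \<Longrightarrow> trg f = src g \<Longrightarrow> arr (f \<cdot> g)"
    and arr_ten [simp]: "arr f \<Longrightarrow> arr g \<Longrightarrow> right_end (src f) = left_end (src g) \<Longrightarrow> arr (f \<otimes> g)"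
    and arr_assr [simp]: "typed C (Node (Node X Y) Z) \<Longrightarrow> arr (assr X Y Z)"
    and arr_un [simp]: "typed C X \<Longrightarrow> arr (lun X)" "typed C X \<Longrightarrow> arr (run X)"
    and cmp_assoc: "arr f \<Longrightarrow> arr g \<Longrightarrow> arr h \<Longrightarrow> trg f = src g \<Longrightarrow> trg g = src h \<Longrightarrow>
        (f \<cdot> g) \<cdot> h = f \<cdot> g \<cdot> h"
    and cmp_idn [simp]: "arr f \<Longrightarrow> X = src f \<Longrightarrow> idn X \<cdot> f = f" "arr f \<Longrightarrow> X = trg f \<Longrightarrow> f \<cdot> idn X = f"
    and inverse: "arr f \<Longrightarrow> \<exists>g. arr g \<and> src g = trg f \<and> trg g = src f \<and>
        f \<cdot> g = idn (src f) \<and> g \<cdot> f = idn (trg f)"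
    and ten_cmp: "arr f \<Longrightarrow> arr f' \<Longrightarrow> arr g \<Longrightarrow> arr g' \<Longrightarrow> trg f = src f' \<Longrightarrow> trg g = src g' \<Longrightarrow>
        right_end (src f) = left_end (src g) \<Longrightarrow> (f \<cdot> f') \<otimes> (g \<cdot> g') = (f \<otimes> g) \<cdot> (f' \<otimes> g')"
    and ten_idn: "typed C (Node X Y) \<Longrightarrow> idn X \<otimes> idn Y = idn (Node X Y)"
    and assr_natural: "arr f \<Longrightarrow> arr g \<Longrightarrow> arr h \<Longrightarrow> right_end (src f) = left_end (src g) \<Longrightarrow>
        right_end (src g) = left_end (src h) \<Longrightarrow>
        ((f \<otimes> g) \<otimes> h) \<cdot> assr (trg f) (trg g) (trg h) = assr (src f) (src g) (src h) \<cdot> (f \<otimes> g \<otimes> h)"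
    and lun_natural: "arr f \<Longrightarrow> (idn (Unit (left_end (src f))) \<otimes> f) \<cdot> lun (trg f) = lun (src f) \<cdot> f"
    and run_natural: "arr f \<Longrightarrow> (f \<otimes> idn (Unit (right_end (src f)))) \<cdot> run (trg f) = run (src f) \<cdot> f"
    and pentagon: "typed C (Node (Node (Node X Y) Z) W) \<Longrightarrow>
        (assr X Y Z \<otimes> idn W) \<cdot> assr X (Node Y Z) W \<cdot> (idn X \<otimes> assr Y Z W) =
        assr (Node X Y) Z W \<cdot> assr X Y (Node Z W)"
    and triangle: "typed C (Node X Y) \<Longrightarrow>
        assr X (Unit (right_end X)) Y \<cdot> (idn X \<otimes> lun Y) = run X \<otimes> idn Y"
begin

lemma arr_typed [simp]: "arr f \<Longrightarrow> typed C (src f)" "arr f \<Longrightarrow> typed C (trg f)"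
    "arr f \<Longrightarrow> left_end (trg f) = left_end (src f)" "arr f \<Longrightarrow> right_end (trg f) = right_end (src f)"
  using arrD by blast+

lemma cancel_left:
  assumes "arr f" "arr g" "arr h" "trg f = src g" "trg f = src h" "f \<cdot> g = f \<cdot> h"
  shows "g = h"
proof -
  obtain k where k: "arr k" "src k = trg f" "trg k = src f" "k \<cdot> f = idn (trg f)"
    using inverse[OF assms(1)] by blast
  have "g = (k \<cdot> f) \<cdot> g" using assms(2,4) by (simp add: k(4))
  also have "\<dots> = (k \<cdot> f) \<cdot> h" using assms k(1-3) by (simp add: cmp_assoc)
  also have "\<dots> = h" using assms(3,5) by (simp add: k(4))
  finally show ?thesis .
qed

lemma cancel_right:
  assumes "arr f" "arr g" "arr h" "trg g = src f" "trg h = src f" "g \<cdot> f = h \<cdot> f"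
  shows "g = h"
proof -
  obtain k where k: "arr k" "src k = trg f" "trg k = src f" "f \<cdot> k = idn (src f)"
    using inverse[OF assms(1)] by blast
  have "g = g \<cdot> f \<cdot> k" using assms(2,4) by (simp add: k(4))
  also have "\<dots> = (h \<cdot> f) \<cdot> k" using assms k(1-3) by (simp flip: cmp_assoc)
  also have "\<dots> = h" using assms(1,3,5) k(1-3) by (simp add: cmp_assoc k(4))
  finally show ?thesis .
qed

lemma ten_cmp_left: "arr f \<Longrightarrow> arr f' \<Longrightarrow> typed C X \<Longrightarrow> trg f = src f' \<Longrightarrow>
    right_end (src f) = left_end X \<Longrightarrow> (f \<cdot> f') \<otimes> idn X = (f \<otimes> idn X) \<cdot> (f' \<otimes> idn X)"
  using ten_cmp[of f f' "idn X" "idn X"] by simp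

lemma ten_cmp_right: "arr g \<Longrightarrow> arr g' \<Longrightarrow> typed C X \<Longrightarrow> trg g = src g' \<Longrightarrow>
    right_end X = left_end (src g) \<Longrightarrow> idn X \<otimes> (g \<cdot> g') = (idn X \<otimes> g) \<cdot> (idn X \<otimes> g')"
  using ten_cmp[of "idn X" "idn X" g g'] by simp

lemma ten_slide: "arr f \<Longrightarrow> arr g \<Longrightarrow> right_end (src f) = left_end (src g) \<Longrightarrow>
    (idn (src f) \<otimes> g) \<cdot> (f \<otimes> idn (trg g)) = f \<otimes> g"
  using ten_cmp[of "idn (src f)" f g "idn (trg g)"] by simp

text \<open>Kelly's argument: the pentagon with two units, tensored with a unit on the left.\<close>

lemma lun_tensor:
  assumes "typed C (Node X Y)"
  shows "assr (Unit (left_end X)) X Y \<cdot> lun (Node X Y) = lun X \<otimes> idn Y"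
proof -
  let ?I = "Unit (left_end X)" and ?i = "idn (Unit (left_end X))"
  have t [simp]: "typed C X" "typed C Y" "right_end X = left_end Y" "left_end X \<in> C"
    using assms typed_ends[of C X] by auto
  let ?u = "assr ?I X Y \<cdot> lun (Node X Y)" and ?v = "lun X \<otimes> idn Y"
  \<comment> \<open>The first two edges of the long side of the pentagon for I, I, X, Y. The aim is
    to show that \<open>?i \<otimes> ?u\<close> and \<open>?i \<otimes> ?v\<close> agree after this
    invertible composite.\<close>
  let ?p = "(assr ?I ?I X \<otimes> idn Y) \<cdot> assr ?I (Node ?I X) Y"
  have "?p \<cdot> (?i \<otimes> ?u) = ((assr ?I ?I X \<otimes> idn Y) \<cdot> assr ?I (Node ?I X) Y \<cdot> (?i \<otimes> assr ?I X Y)) \<cdot> (?i \<otimes> lun (Node X Y))"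
    by (simp add: ten_cmp_right cmp_assoc)
  also have "\<dots> = assr (Node ?I ?I) X Y \<cdot> assr ?I ?I (Node X Y) \<cdot> (?i \<otimes> lun (Node X Y))"
    by (simp add: pentagon cmp_assoc)
  also have "\<dots> = assr (Node ?I ?I) X Y \<cdot> (run ?I \<otimes> idn (Node X Y))"
    using triangle[of ?I "Node X Y"] by simp
  also have "\<dots> = ((run ?I \<otimes> idn X) \<otimes> idn Y) \<cdot> assr ?I X Y"
    using assr_natural[of "run ?I" "idn X" "idn Y"] by (simp add: ten_idn)
  also have "run ?I \<otimes> idn X = assr ?I ?I X \<cdot> (?i \<otimes> lun X)"
    using triangle[of ?I X] by simp
  also have "((assr ?I ?I X \<cdot> (?i \<otimes> lun X)) \<otimes> idn Y) \<cdot> assr ?I X Y =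
      (assr ?I ?I X \<otimes> idn Y) \<cdot> ((?i \<otimes> lun X) \<otimes> idn Y) \<cdot> assr ?I X Y"
    by (simp add: ten_cmp_left cmp_assoc)
  also have "((?i \<otimes> lun X) \<otimes> idn Y) \<cdot> assr ?I X Y = assr ?I (Node ?I X) Y \<cdot> (?i \<otimes> ?v)"
    using assr_natural[of ?i "lun X" "idn Y"] by simp
  finally have "?p \<cdot> (?i \<otimes> ?u) = ?p \<cdot> (?i \<otimes> ?v)"
    by (simp add: cmp_assoc)
  then have e: "?i \<otimes> ?u = ?i \<otimes> ?v" by (rule cancel_left[rotated 5]) simp_all
  \<comment> \<open>Naturality of \<open>lun\<close> removes the auxiliary unit: conjugating
    \<open>?i \<otimes> f\<close> by \<open>lun\<close> gives \<open>f\<close>, so tensoring with a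
    unit is injective on arrows.\<close>
  have "lun (src ?u) \<cdot> ?u = (?i \<otimes> ?u) \<cdot> lun (trg ?u)"
    using lun_natural[of ?u] by simp
  also have "\<dots> = lun (src ?v) \<cdot> ?v" unfolding e using lun_natural[of ?v] by simp
  finally have "lun (src ?u) \<cdot> ?u = lun (src ?u) \<cdot> ?v" by simp
  then show ?thesis by (rule cancel_left[rotated 5]) simp_all
qed

section \<open>Normalization from the left and uniqueness of generated arrows\<close>

primrec normalize :: "'a tree \<Rightarrow> 'a tree \<Rightarrow> 'm" where
  "normalize (Leaf a b) Z = idn (Node (Leaf a b) Z)"
| "normalize (Unit a) Z = lun Z"
| "normalize (Node X Y) Z = assr X Y Z \<cdot> (idn X \<otimes> normalize Y Z) \<cdot> normalize X (prepend Y Z)"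

lemma normalize_arr [simp]:
  assumes "typed C X" "typed C Z" "right_end X = left_end Z"
  shows "arr (normalize X Z)" "src (normalize X Z) = Node X Z" "trg (normalize X Z) = prepend X Z"
proof -
  have "arr (normalize X Z) \<and> src (normalize X Z) = Node X Z \<and> trg (normalize X Z) = prepend X Z"
    using assms by (induction X arbitrary: Z) (auto simp: typed_prepend)
  then show "arr (normalize X Z)" "src (normalize X Z) = Node X Z" "trg (normalize X Z) = prepend X Z"
    by auto
qed

text \<open>There is no operation of inversion, so closure under inverses admits every arrow that
  inverts a generated one on both sides.\<close>

inductive generated :: "'m \<Rightarrow> bool" where
  gen_idn: "typed C X \<Longrightarrow> generated (idn X)"
| gen_cmp: "generated f \<Longrightarrow> generated g \<Longrightarrow> trg f = src g \<Longrightarrow> generated (f \<cdot> g)"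
| gen_ten: "generated f \<Longrightarrow> generated g \<Longrightarrow> right_end (src f) = left_end (src g) \<Longrightarrow> generated (f \<otimes> g)"
| gen_assr: "typed C (Node (Node X Y) Z) \<Longrightarrow> generated (assr X Y Z)"
| gen_lun: "typed C X \<Longrightarrow> generated (lun X)"
| gen_run: "typed C X \<Longrightarrow> generated (run X)"
| gen_inv: "generated f \<Longrightarrow> arr g \<Longrightarrow> src g = trg f \<Longrightarrow> trg g = src f \<Longrightarrow>
    f \<cdot> g = idn (src f) \<Longrightarrow> g \<cdot> f = idn (trg f) \<Longrightarrow> generated g"

lemma generated_arr: "generated f \<Longrightarrow> arr f"
  by (induction rule: generated.induct) auto

text \<open>\<open>Z\<close> has to stay arbitrary: for a tensor \<open>f \<otimes> g\<close> the
  claim for \<open>f\<close> is used at the tree obtained by absorbing the leaves of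
  \<open>g\<close> into \<open>Z\<close>.\<close>

lemma normalize_generated:
  assumes "generated f" "typed C Z" "right_end (src f) = left_end Z"
  shows "(f \<otimes> idn Z) \<cdot> normalize (trg f) Z = normalize (src f) Z"
  using assms
proof (induction arbitrary: Z rule: generated.induct)
  case (gen_idn X)
  then show ?case by (simp add: ten_idn)
next
  case (gen_cmp f g)
  have [simp]: "arr f" "arr g" "trg f = src g" "right_end (src g) = left_end Z" "right_end (src f) = left_end Z" "typed C Z"
    using gen_cmp generated_arr arr_typed(4)[of f] by auto
  have "((f \<cdot> g) \<otimes> idn Z) \<cdot> normalize (trg (f \<cdot> g)) Z = (f \<otimes> idn Z) \<cdot> (g \<otimes> idn Z) \<cdot> normalize (trg g) Z"
    by (simp add: ten_cmp_left cmp_assoc)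
  also have "\<dots> = normalize (src f) Z"
    using gen_cmp.IH by simp
  finally show ?case by simp
next
  case (gen_ten f g)
  have [simp]: "arr f" "arr g" "right_end (src f) = left_end (src g)" "right_end (src g) = left_end Z" "typed C Z"
    using gen_ten generated_arr by auto
  let ?W = "prepend (trg g) Z"
  have W [simp]: "typed C ?W" "left_end ?W = left_end (src g)" "typed C (prepend (src g) Z)"
    using typed_prepend[of C "trg g" Z] typed_prepend[of C "src g" Z] by auto
  have W': "prepend (src g) Z = ?W"
    using arrD[of g] by (simp add: prepend_leaves)
  have "((f \<otimes> g) \<otimes> idn Z) \<cdot> normalize (trg (f \<otimes> g)) Z =
      (((f \<otimes> g) \<otimes> idn Z) \<cdot> assr (trg f) (trg g) (trg (idn Z))) \<cdot> (idn (trg f) \<otimes> normalize (trg g) Z) \<cdot> normalize (trg f) ?W"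
    by (simp add: cmp_assoc)
  also have "\<dots> = assr (src f) (src g) Z \<cdot> ((f \<otimes> g \<otimes> idn Z) \<cdot> (idn (trg f) \<otimes> normalize (trg g) Z)) \<cdot> normalize (trg f) ?W"
    by (subst assr_natural) (simp_all add: cmp_assoc)
  also have "(f \<otimes> g \<otimes> idn Z) \<cdot> (idn (trg f) \<otimes> normalize (trg g) Z) = f \<otimes> ((g \<otimes> idn Z) \<cdot> normalize (trg g) Z)"
    using ten_cmp[of f "idn (trg f)" "g \<otimes> idn Z" "normalize (trg g) Z"] by simp
  also have "(g \<otimes> idn Z) \<cdot> normalize (trg g) Z = normalize (src g) Z"
    using gen_ten.IH(2)[of Z] by simp
  also have "f \<otimes> normalize (src g) Z = (idn (src f) \<otimes> normalize (src g) Z) \<cdot> (f \<otimes> idn ?W)"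
    using ten_slide[of f "normalize (src g) Z"] by (simp add: W')
  also have "assr (src f) (src g) Z \<cdot> ((idn (src f) \<otimes> normalize (src g) Z) \<cdot> (f \<otimes> idn ?W)) \<cdot> normalize (trg f) ?W =
      assr (src f) (src g) Z \<cdot> (idn (src f) \<otimes> normalize (src g) Z) \<cdot> (f \<otimes> idn ?W) \<cdot> normalize (trg f) ?W"
    by (simp add: cmp_assoc W')
  also have "(f \<otimes> idn ?W) \<cdot> normalize (trg f) ?W = normalize (src f) ?W"
    using gen_ten.IH(1)[of ?W] by simp
  finally show ?case by (simp add: W')
next
  case (gen_assr X Y W)
  have t [simp]: "typed C X" "typed C Y" "typed C W" "typed C Z" "right_end X = left_end Y" "right_end Y = left_end W" "right_end W = left_end Z"
    using gen_assr by auto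
  let ?V = "prepend W Z"
  have p [simp]: "typed C ?V" "left_end ?V = left_end W" "typed C (prepend Y ?V)" "left_end (prepend Y ?V) = left_end Y"
    using typed_prepend[of C W Z] typed_prepend[of C Y ?V] by auto
  let ?e = "(idn X \<otimes> normalize Y ?V) \<cdot> normalize X (prepend Y ?V)"
  let ?n = "idn X \<otimes> (idn Y \<otimes> normalize W Z)"
  have "(assr X Y W \<otimes> idn Z) \<cdot> normalize (Node X (Node Y W)) Z =
     ((assr X Y W \<otimes> idn Z) \<cdot> assr X (Node Y W) Z \<cdot> (idn X \<otimes> assr Y W Z)) \<cdot> ?n \<cdot> ?e"
    by (simp add: ten_cmp_right cmp_assoc)
  also have "\<dots> = assr (Node X Y) W Z \<cdot> (assr X Y (Node W Z) \<cdot> ?n) \<cdot> ?e"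
    by (simp add: pentagon cmp_assoc)
  also have "assr X Y (Node W Z) \<cdot> ?n = (idn (Node X Y) \<otimes> normalize W Z) \<cdot> assr X Y ?V"
    using assr_natural[of "idn X" "idn Y" "normalize W Z"] by (simp add: ten_idn)
  finally show ?case by (simp add: cmp_assoc)
next
  case (gen_lun X)
  have t [simp]: "typed C X" "typed C Z" "right_end X = left_end Z" "left_end X \<in> C"
    using gen_lun typed_ends[of C X] by auto
  have p [simp]: "typed C (prepend X Z)" "left_end (prepend X Z) = left_end X"
    using typed_prepend[of C X Z] by auto
  have "(lun X \<otimes> idn Z) \<cdot> normalize X Z = assr (Unit (left_end X)) X Z \<cdot> lun (Node X Z) \<cdot> normalize X Z"
    using lun_tensor[of X Z, symmetric] by (simp add: cmp_assoc)
  also have "lun (Node X Z) \<cdot> normalize X Z = (idn (Unit (left_end X)) \<otimes> normalize X Z) \<cdot> lun (prepend X Z)"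
    using lun_natural[of "normalize X Z"] by simp
  finally show ?case by simp
next
  case (gen_run X)
  have t [simp]: "typed C X" "typed C Z" "right_end X = left_end Z" "right_end X \<in> C" "left_end Z \<in> C"
    using gen_run typed_ends[of C X] by auto
  \<comment> \<open>Normalizing the unit in the middle is \<open>lun Z\<close>, so this case is the
    triangle followed by \<open>normalize X Z\<close>.\<close>
  show ?case using triangle[of X Z, symmetric] by (simp add: cmp_assoc)
next
  case (gen_inv f g)
  have [simp]: "arr f" "arr g" "src g = trg f" "trg g = src f" "typed C Z" "right_end (src f) = left_end Z"
    using gen_inv generated_arr[of f] by auto
  have "(g \<otimes> idn Z) \<cdot> normalize (src f) Z = (g \<otimes> idn Z) \<cdot> (f \<otimes> idn Z) \<cdot> normalize (trg f) Z"
    using gen_inv.IH[of Z] by simp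
  also have "\<dots> = ((g \<cdot> f) \<otimes> idn Z) \<cdot> normalize (trg f) Z"
    by (simp add: ten_cmp_left cmp_assoc)
  also have "\<dots> = normalize (trg f) Z"
    using gen_inv.hyps(6) by (simp add: ten_idn)
  finally show ?case by simp
qed

theorem generated_unique:
  assumes "generated f" "generated g" "src f = src g" "trg f = trg g"
  shows "f = g"
proof -
  have [simp]: "arr f" "arr g" using assms generated_arr by auto
  let ?Z = "Unit (right_end (src g))"
  have [simp]: "right_end (src g) \<in> C" "right_end (trg g) = right_end (src g)"
    using typed_ends[of C "src g"] by auto
  have "(f \<otimes> idn ?Z) \<cdot> normalize (trg g) ?Z = (g \<otimes> idn ?Z) \<cdot> normalize (trg g) ?Z"
    using normalize_generated[OF assms(1), of ?Z] normalize_generated[OF assms(2), of ?Z] assms(3,4) by simp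
  then have "f \<otimes> idn ?Z = g \<otimes> idn ?Z"
    by (rule cancel_right[rotated 5]) (simp_all add: assms(3,4))
  then have "run (src g) \<cdot> f = run (src g) \<cdot> g"
    using run_natural[of f] run_natural[of g] assms(3,4) by simp
  then show ?thesis by (rule cancel_left[rotated 5]) (simp_all add: assms(3))
qed

end

section \<open>Paths, forests and grafting\<close>

primrec is_path :: "'a set \<Rightarrow> 'a \<Rightarrow> ('a \<times> 'a) list \<Rightarrow> 'a \<Rightarrow> bool" where
  "is_path C a [] b \<longleftrightarrow> a = b \<and> a \<in> C"
| "is_path C a (e # es) b \<longleftrightarrow> fst e = a \<and> a \<in> C \<and> is_path C (snd e) es b"

lemma is_path_append: "is_path C a (es @ fs) c \<longleftrightarrow> (\<exists>b. is_path C a es b \<and> is_path C b fs c)"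
proof (induction es arbitrary: a)
  case Nil
  show ?case by (cases fs) auto
qed auto

lemma is_path_ends: "is_path C a es b \<Longrightarrow> a \<in> C \<and> b \<in> C"
  by (induction es arbitrary: a) auto

lemma typed_is_path: "typed C X \<Longrightarrow> is_path C (left_end X) (leaves X) (right_end X)"
  by (induction X) (auto simp: is_path_append)

abbreviation leaf :: "'a \<times> 'a \<Rightarrow> 'a tree" where "leaf e \<equiv> Leaf (fst e) (snd e)"

definition root :: "'a tree \<Rightarrow> 'a \<times> 'a" where "root X = (left_end X, right_end X)"

abbreviation roots :: "'a tree list \<Rightarrow> ('a \<times> 'a) list" where "roots \<equiv> map root"

abbreviation forest_leaves :: "'a tree list \<Rightarrow> ('a \<times> 'a) list" where
  "forest_leaves Xs \<equiv> concat (map leaves Xs)"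

lemma root_simps [simp]: "root (Leaf a b) = (a, b)" "root (Unit a) = (a, a)"
    "root (Node X Y) = (left_end X, right_end Y)" "fst (root X) = left_end X" "snd (root X) = right_end X"
  by (auto simp: root_def)

definition is_forest :: "'a set \<Rightarrow> 'a \<Rightarrow> 'a tree list \<Rightarrow> 'a \<Rightarrow> bool" where
  "is_forest C a Xs b \<longleftrightarrow> (\<forall>X\<in>set Xs. typed C X) \<and> is_path C a (roots Xs) b"

lemma is_forest_simps [simp]:
  "is_forest C a [] b \<longleftrightarrow> a = b \<and> a \<in> C"
  "is_forest C a (X # Xs) b \<longleftrightarrow> left_end X = a \<and> typed C X \<and> is_forest C (right_end X) Xs b"
  using typed_ends[of C X] by (auto simp: is_forest_def)

lemma is_forest_append: "is_forest C a (Xs @ Ys) c \<longleftrightarrow> (\<exists>b. is_forest C a Xs b \<and> is_forest C b Ys c)"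
  by (auto simp: is_forest_def is_path_append)

lemma is_forest_leaves: "is_forest C a Xs b \<Longrightarrow> is_path C a (forest_leaves Xs) b"
  by (induction Xs arbitrary: a) (auto simp: is_path_append dest: typed_is_path)

text \<open>Composition in the multicategory of trees. The first argument is the later factor in
  diagrammatic order: \<open>graft_forest Xs Ys\<close> will be the forest of the composite along
  1-cells of \<open>Ys\<close> followed by \<open>Xs\<close>.\<close>

primrec graft :: "'a tree \<Rightarrow> 'a tree list \<Rightarrow> 'a tree" where
  "graft (Leaf a b) Ys = hd Ys"
| "graft (Unit a) Ys = Unit a"
| "graft (Node X X') Ys =
    Node (graft X (take (length (leaves X)) Ys)) (graft X' (drop (length (leaves X)) Ys))"

primrec graft_forest :: "'a tree list \<Rightarrow> 'a tree list \<Rightarrow> 'a tree list" where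
  "graft_forest [] Ys = []"
| "graft_forest (X # Xs) Ys =
    graft X (take (length (leaves X)) Ys) # graft_forest Xs (drop (length (leaves X)) Ys)"

lemma length_graft_forest [simp]: "length (graft_forest Xs Ys) = length Xs"
  by (induction Xs arbitrary: Ys) auto

lemma leaves_graft: "length Ys = length (leaves X) \<Longrightarrow> leaves (graft X Ys) = forest_leaves Ys"
proof (induction X arbitrary: Ys)
  case (Leaf a b)
  then show ?case by (cases Ys) auto
next
  case (Node X X')
  have "forest_leaves Ys = forest_leaves (take (length (leaves X)) Ys @ drop (length (leaves X)) Ys)"
    by (simp only: append_take_drop_id)
  then show ?case using Node by (simp del: append_take_drop_id)
qed auto

lemma leaves_graft_forest:
  "length Ys = length (forest_leaves Xs) \<Longrightarrow> forest_leaves (graft_forest Xs Ys) = forest_leaves Ys"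
proof (induction Xs arbitrary: Ys)
  case (Cons X Xs)
  have "forest_leaves Ys = forest_leaves (take (length (leaves X)) Ys @ drop (length (leaves X)) Ys)"
    by (simp only: append_take_drop_id)
  then show ?case using Cons by (simp del: append_take_drop_id add: leaves_graft)
qed auto

text \<open>On forests this is the exchange law between composition along objects (concatenation)
  and along 1-cells (grafting).\<close>

lemma graft_forest_append: "length Ys = length (forest_leaves Xs) \<Longrightarrow>
    graft_forest (Xs @ Xs') (Ys @ Ys') = graft_forest Xs Ys @ graft_forest Xs' Ys'"
  by (induction Xs arbitrary: Ys) auto

lemma graft_leaf: "graft X (map leaf (leaves X)) = X"
  by (induction X) auto

text \<open>Together with \<open>graft_forest_map_leaf\<close>, the two unit laws of grafting; a
  forest of leaves stands for an identity 2-cell.\<close>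

lemma graft_forest_leaf: "graft_forest Xs (map leaf (forest_leaves Xs)) = Xs"
  by (induction Xs) (auto simp: graft_leaf)

lemma graft_forest_map_leaf: "length Ys = length es \<Longrightarrow> graft_forest (map leaf es) Ys = Ys"
proof (induction es arbitrary: Ys)
  case (Cons e es)
  then show ?case by (cases Ys) auto
qed auto

text \<open>The number \<open>k\<close> counts the trees of \<open>Ys\<close> consumed by the first
  \<open>n\<close> trees of \<open>Xs\<close>, so cutting the outer forest after \<open>n\<close>
  trees cuts the inner one after \<open>k\<close>.\<close>

lemma graft_forest_split:
  assumes "n \<le> length Xs" "length Ys = length (forest_leaves Xs)"
  defines "k \<equiv> length (forest_leaves (take n Xs))"
  shows "take n (graft_forest Xs Ys) = graft_forest (take n Xs) (take k Ys)"
    "drop n (graft_forest Xs Ys) = graft_forest (drop n Xs) (drop k Ys)"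
    "k \<le> length Ys"
proof -
  have "forest_leaves Xs = forest_leaves (take n Xs @ drop n Xs)" by (simp only: append_take_drop_id)
  then have "length (forest_leaves Xs) = k + length (forest_leaves (drop n Xs))"
    by (simp add: k_def del: append_take_drop_id)
  then show k: "k \<le> length Ys" using assms(2) by simp
  have "graft_forest Xs Ys = graft_forest (take n Xs @ drop n Xs) (take k Ys @ drop k Ys)" by simp
  also have "\<dots> = graft_forest (take n Xs) (take k Ys) @ graft_forest (drop n Xs) (drop k Ys)"
    using k by (intro graft_forest_append) (simp add: k_def)
  finally show "take n (graft_forest Xs Ys) = graft_forest (take n Xs) (take k Ys)"
    "drop n (graft_forest Xs Ys) = graft_forest (drop n Xs) (drop k Ys)"
    using assms(1) by simp_all
qed

text \<open>Associativity of substitution. At a node, the cut of \<open>Ys\<close> after the leaves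
  of \<open>X\<close> induces the cut of \<open>Zs\<close> described by
  \<open>graft_forest_split\<close>.\<close>

lemma graft_graft:
  assumes "length Ys = length (leaves X)" "length Zs = length (forest_leaves Ys)"
  shows "graft (graft X Ys) Zs = graft X (graft_forest Ys Zs)"
  using assms
proof (induction X arbitrary: Ys Zs)
  case (Leaf a b)
  then show ?case by (cases Ys) auto
next
  case (Node X X')
  let ?n = "length (leaves X)"
  have n: "?n \<le> length Ys" using Node.prems by simp
  note s = graft_forest_split[OF n Node.prems(2)]
  let ?k = "length (forest_leaves (take ?n Ys))"
  have "forest_leaves Ys = forest_leaves (take ?n Ys @ drop ?n Ys)" by (simp only: append_take_drop_id)
  then have k: "length (forest_leaves Ys) = ?k + length (forest_leaves (drop ?n Ys))"
    by (simp del: append_take_drop_id)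
  show ?case
    using Node.prems Node.IH(1)[of "take ?n Ys" "take ?k Zs"] Node.IH(2)[of "drop ?n Ys" "drop ?k Zs"] s k
    by (simp add: leaves_graft)
qed auto

lemma graft_forest_assoc:
  assumes "length Ys = length (forest_leaves Xs)" "length Zs = length (forest_leaves Ys)"
  shows "graft_forest (graft_forest Xs Ys) Zs = graft_forest Xs (graft_forest Ys Zs)"
  using assms
proof (induction Xs arbitrary: Ys Zs)
  case (Cons X Xs)
  let ?n = "length (leaves X)"
  have n: "?n \<le> length Ys" using Cons.prems by simp
  note s = graft_forest_split[OF n Cons.prems(2)]
  let ?k = "length (forest_leaves (take ?n Ys))"
  have "forest_leaves Ys = forest_leaves (take ?n Ys @ drop ?n Ys)" by (simp only: append_take_drop_id)
  then have k: "length (forest_leaves Ys) = ?k + length (forest_leaves (drop ?n Ys))"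
    by (simp del: append_take_drop_id)
  show ?case
    using Cons.prems Cons.IH[of "drop ?n Ys" "drop ?k Zs"] s k
    by (simp add: leaves_graft graft_graft)
qed auto

lemma typed_graft:
  assumes "typed C X" "\<forall>Y\<in>set Ys. typed C Y" "roots Ys = leaves X"
  shows "typed C (graft X Ys) \<and> root (graft X Ys) = root X"
  using assms
proof (induction X arbitrary: Ys)
  case (Leaf a b)
  then show ?case by (cases Ys) auto
next
  case (Node X X')
  let ?n = "length (leaves X)"
  have "roots (take ?n Ys) = leaves X" "roots (drop ?n Ys) = leaves X'"
    using Node.prems(3) by (simp_all flip: take_map drop_map)
  then have "typed C (graft X (take ?n Ys)) \<and> root (graft X (take ?n Ys)) = root X"
    "typed C (graft X' (drop ?n Ys)) \<and> root (graft X' (drop ?n Ys)) = root X'"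
    using Node.prems(1,2) by (intro Node.IH; auto dest: in_set_takeD in_set_dropD)+
  then show ?case using Node.prems(1) by (simp add: root_def)
qed auto

lemma graft_ends:
  assumes "typed C X" "\<forall>Y\<in>set Ys. typed C Y" "roots Ys = leaves X"
  shows "left_end (graft X Ys) = left_end X" "right_end (graft X Ys) = right_end X"
  using typed_graft[OF assms] by (simp_all add: root_def)

lemma roots_graft_forest:
  assumes "\<forall>X\<in>set Xs. typed C X" "\<forall>Y\<in>set Ys. typed C Y" "roots Ys = forest_leaves Xs"
  shows "(\<forall>Z\<in>set (graft_forest Xs Ys). typed C Z) \<and> roots (graft_forest Xs Ys) = roots Xs"
  using assms
proof (induction Xs arbitrary: Ys)
  case (Cons X Xs)
  let ?n = "length (leaves X)"
  have r: "roots (take ?n Ys) = leaves X" "roots (drop ?n Ys) = forest_leaves Xs"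
    using Cons.prems(3) by (simp_all flip: take_map drop_map)
  have "typed C (graft X (take ?n Ys)) \<and> root (graft X (take ?n Ys)) = root X"
    using Cons.prems r by (intro typed_graft) (auto dest: in_set_takeD)
  moreover have "(\<forall>Z\<in>set (graft_forest Xs (drop ?n Ys)). typed C Z) \<and> roots (graft_forest Xs (drop ?n Ys)) = roots Xs"
    using Cons.prems r by (intro Cons.IH) (auto dest: in_set_dropD)
  ultimately show ?case by simp
qed auto

lemma is_forest_graft:
  assumes "is_forest C a Xs b" "is_forest C a Ys b" "roots Ys = forest_leaves Xs"
  shows "is_forest C a (graft_forest Xs Ys) b"
  using assms roots_graft_forest[of Xs C Ys] by (simp add: is_forest_def)

section \<open>Low-dimensional strict categories\<close>

context strict_ncategory
begin

abbreviation comp0 (infixr "\<odot>\<^sub>0" 75) where "comp0 \<equiv> ccomp K 0"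
abbreviation comp1 (infixr "\<odot>\<^sub>1" 70) where "comp1 \<equiv> ccomp K (Suc 0)"
abbreviation comp2 (infixr "\<odot>\<^sub>2" 65) where "comp2 \<equiv> ccomp K 2"
abbreviation \<iota> where "\<iota> \<equiv> cid K"

text \<open>The laws of a strict category carry composability hypotheses. The predicates
  \<open>hom1\<close>, \<open>hom2\<close>, \<open>hom3\<close> serve as typing judgements that list
  all boundaries, so that composability follows by resolution along the shape of a composite.
  Dimension one is written \<open>Suc 0\<close> because the simplifier rewrites it to this
  form.\<close>

definition hom1 :: "'c \<Rightarrow> 'c \<Rightarrow> 'c \<Rightarrow> bool" where
  "hom1 a b f \<longleftrightarrow> f \<in> cells K (Suc 0) \<and> csrc K f = a \<and> ctgt K f = b"

definition hom2 :: "'c \<Rightarrow> 'c \<Rightarrow> 'c \<Rightarrow> 'c \<Rightarrow> 'c \<Rightarrow> bool" where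
  "hom2 a b f g x \<longleftrightarrow> x \<in> cells K 2 \<and> csrc K x = f \<and> ctgt K x = g \<and> hom1 a b f \<and> hom1 a b g"

definition hom3 :: "'c \<Rightarrow> 'c \<Rightarrow> 'c \<Rightarrow> 'c \<Rightarrow> 'c \<Rightarrow> 'c \<Rightarrow> 'c \<Rightarrow> bool" where
  "hom3 a b f g x y A \<longleftrightarrow>
     A \<in> cells K 3 \<and> csrc K A = x \<and> ctgt K A = y \<and> hom2 a b f g x \<and> hom2 a b f g y"

lemmas hom_defs = hom1_def hom2_def hom3_def

lemma boundary_cells:
  "f \<in> cells K (Suc 0) \<Longrightarrow> csrc K f \<in> cells K 0" "f \<in> cells K (Suc 0) \<Longrightarrow> ctgt K f \<in> cells K 0"
  "x \<in> cells K 2 \<Longrightarrow> csrc K x \<in> cells K (Suc 0)" "x \<in> cells K 2 \<Longrightarrow> ctgt K x \<in> cells K (Suc 0)"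
  "A \<in> cells K 3 \<Longrightarrow> csrc K A \<in> cells K 2" "A \<in> cells K 3 \<Longrightarrow> ctgt K A \<in> cells K 2"
  using csrc_cell[of f 0] ctgt_cell[of f 0] csrc_cell[of x 1] ctgt_cell[of x 1]
    csrc_cell[of A 2] ctgt_cell[of A 2] by (simp_all add: eval_nat_numeral)

lemma at_unfold:
  "csrc_at K (Suc 0) 0 x = csrc K x" "csrc_at K 2 0 x = csrc K (csrc K x)" "csrc_at K 2 (Suc 0) x = csrc K x"
  "csrc_at K 3 0 x = csrc K (csrc K (csrc K x))" "csrc_at K 3 (Suc 0) x = csrc K (csrc K x)"
  "csrc_at K 3 2 x = csrc K x"
  "ctgt_at K (Suc 0) 0 x = ctgt K x" "ctgt_at K 2 0 x = ctgt K (ctgt K x)" "ctgt_at K 2 (Suc 0) x = ctgt K x"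
  "ctgt_at K 3 0 x = ctgt K (ctgt K (ctgt K x))" "ctgt_at K 3 (Suc 0) x = ctgt K (ctgt K x)"
  "ctgt_at K 3 2 x = ctgt K x"
  "cid_at K 0 (Suc 0) x = \<iota> x" "cid_at K 0 2 x = \<iota> (\<iota> x)" "cid_at K (Suc 0) 2 x = \<iota> x"
  "cid_at K 0 3 x = \<iota> (\<iota> (\<iota> x))" "cid_at K (Suc 0) 3 x = \<iota> (\<iota> x)" "cid_at K 2 3 x = \<iota> x"
  by (simp_all add: csrc_at_def ctgt_at_def cid_at_def eval_nat_numeral)

lemma hom3D:
  assumes "hom3 a b f g x y A"
  shows "hom2 a b f g x" "hom2 a b f g y" "csrc K A = x" "ctgt K A = y"
  using assms by (auto simp: hom3_def)

lemma hom2I: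
  assumes "x \<in> cells K 2"
  shows "hom2 (csrc K (csrc K x)) (ctgt K (csrc K x)) (csrc K x) (ctgt K x) x"
  using assms globular[of x 1] by (auto simp: hom_defs parallel_def eval_nat_numeral)

lemma composable1: "hom1 a b f \<Longrightarrow> hom1 b c g \<Longrightarrow> composable K (Suc 0) 0 f g"
  by (simp add: composable_def hom_defs at_unfold)

lemma composable2:
  "hom2 a b f g x \<Longrightarrow> hom2 b c f' g' y \<Longrightarrow> composable K 2 0 x y"
  "hom2 a b f g x \<Longrightarrow> hom2 a b g h z \<Longrightarrow> composable K 2 (Suc 0) x z"
  by (simp_all add: composable_def hom_defs at_unfold)

lemma composable3:
  "hom3 a b f g x y A \<Longrightarrow> hom3 b c f' g' x' y' B \<Longrightarrow> composable K 3 0 A B"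
  "hom3 a b f g x y A \<Longrightarrow> hom3 a b g h x' y' B \<Longrightarrow> composable K 3 (Suc 0) A B"
  "hom3 a b f g x y A \<Longrightarrow> hom3 a b f g y z B \<Longrightarrow> composable K 3 2 A B"
  by (simp_all add: composable_def hom_defs at_unfold)

lemma hom1_comp: "hom1 a b f \<Longrightarrow> hom1 b c g \<Longrightarrow> hom1 a c (f \<odot>\<^sub>0 g)"
  using ccomp_cell[OF composable1] csrc_ccomp[OF composable1] ctgt_ccomp[OF composable1]
  by (simp add: hom1_def)

lemma hom2_comp0:
  assumes "hom2 a b f g x" "hom2 b c f' g' y"
  shows "hom2 a c (f \<odot>\<^sub>0 f') (g \<odot>\<^sub>0 g') (x \<odot>\<^sub>0 y)"
  using ccomp_cell[OF composable2(1)[OF assms]] csrc_ccomp[OF composable2(1)[OF assms]]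
    ctgt_ccomp[OF composable2(1)[OF assms]] assms hom1_comp
  by (auto simp: hom2_def)

lemma hom2_comp1:
  assumes "hom2 a b f g x" "hom2 a b g h y"
  shows "hom2 a b f h (x \<odot>\<^sub>1 y)"
  using ccomp_cell[OF composable2(2)[OF assms]] csrc_ccomp[OF composable2(2)[OF assms]]
    ctgt_ccomp[OF composable2(2)[OF assms]] assms
  by (auto simp: hom2_def)

lemma hom3_comp0:
  assumes "hom3 a b f g x y A" "hom3 b c f' g' x' y' B"
  shows "hom3 a c (f \<odot>\<^sub>0 f') (g \<odot>\<^sub>0 g') (x \<odot>\<^sub>0 x') (y \<odot>\<^sub>0 y') (A \<odot>\<^sub>0 B)"
  using ccomp_cell[OF composable3(1)[OF assms]] csrc_ccomp[OF composable3(1)[OF assms]]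
    ctgt_ccomp[OF composable3(1)[OF assms]] assms hom2_comp0
  by (auto simp: hom3_def)

lemma hom3_comp1:
  assumes "hom3 a b f g x y A" "hom3 a b g h x' y' B"
  shows "hom3 a b f h (x \<odot>\<^sub>1 x') (y \<odot>\<^sub>1 y') (A \<odot>\<^sub>1 B)"
  using ccomp_cell[OF composable3(2)[OF assms]] csrc_ccomp[OF composable3(2)[OF assms]]
    ctgt_ccomp[OF composable3(2)[OF assms]] assms hom2_comp1
  by (auto simp: hom3_def)

lemma hom3_comp2:
  assumes "hom3 a b f g x y A" "hom3 a b f g y z B"
  shows "hom3 a b f g x z (A \<odot>\<^sub>2 B)"
  using ccomp_cell[OF composable3(3)[OF assms]] csrc_ccomp[OF composable3(3)[OF assms]]
    ctgt_ccomp[OF composable3(3)[OF assms]] assms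
  by (auto simp: hom3_def)

lemma assoc1: "hom1 a b f \<Longrightarrow> hom1 b c g \<Longrightarrow> hom1 c d h \<Longrightarrow> (f \<odot>\<^sub>0 g) \<odot>\<^sub>0 h = f \<odot>\<^sub>0 g \<odot>\<^sub>0 h"
  by (rule assoc[OF composable1 composable1])

lemma assoc2:
  "hom2 a b f g x \<Longrightarrow> hom2 b c f' g' y \<Longrightarrow> hom2 c d f'' g'' z \<Longrightarrow> (x \<odot>\<^sub>0 y) \<odot>\<^sub>0 z = x \<odot>\<^sub>0 y \<odot>\<^sub>0 z"
  "hom2 a b f g x \<Longrightarrow> hom2 a b g h u \<Longrightarrow> hom2 a b h k v \<Longrightarrow> (x \<odot>\<^sub>1 u) \<odot>\<^sub>1 v = x \<odot>\<^sub>1 u \<odot>\<^sub>1 v"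
  by (rule assoc[OF composable2(1) composable2(1)] assoc[OF composable2(2) composable2(2)]; assumption)+

lemma assoc3:
  "hom3 a b f g x y A \<Longrightarrow> hom3 b c f' g' x' y' B \<Longrightarrow> hom3 c d f'' g'' x'' y'' D \<Longrightarrow>
    (A \<odot>\<^sub>0 B) \<odot>\<^sub>0 D = A \<odot>\<^sub>0 B \<odot>\<^sub>0 D"
  "hom3 a b f g x y A \<Longrightarrow> hom3 a b g h x1 y1 B1 \<Longrightarrow> hom3 a b h k x2 y2 D1 \<Longrightarrow>
    (A \<odot>\<^sub>1 B1) \<odot>\<^sub>1 D1 = A \<odot>\<^sub>1 B1 \<odot>\<^sub>1 D1"
  "hom3 a b f g x y A \<Longrightarrow> hom3 a b f g y z B2 \<Longrightarrow> hom3 a b f g z w D2 \<Longrightarrow>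
    (A \<odot>\<^sub>2 B2) \<odot>\<^sub>2 D2 = A \<odot>\<^sub>2 B2 \<odot>\<^sub>2 D2"
  by (rule assoc[OF composable3(1) composable3(1)] assoc[OF composable3(2) composable3(2)]
      assoc[OF composable3(3) composable3(3)]; assumption)+

lemma exchange2:
  assumes "hom2 a b f g x" "hom2 a b g h x'" "hom2 b c k l y" "hom2 b c l r y'"
  shows "(x \<odot>\<^sub>1 x') \<odot>\<^sub>0 (y \<odot>\<^sub>1 y') = (x \<odot>\<^sub>0 y) \<odot>\<^sub>1 (x' \<odot>\<^sub>0 y')"
  by (rule exchange[OF _ composable2(2)[OF assms(1,2)] composable2(2)[OF assms(3,4)]
        composable2(1)[OF hom2_comp1[OF assms(1,2)] hom2_comp1[OF assms(3,4)]]]) simp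

lemma exchange3_01:
  assumes "hom3 a b f g x y A" "hom3 a b g h x' y' A'" "hom3 b c k l u v B" "hom3 b c l r u' v' B'"
  shows "(A \<odot>\<^sub>1 A') \<odot>\<^sub>0 (B \<odot>\<^sub>1 B') = (A \<odot>\<^sub>0 B) \<odot>\<^sub>1 (A' \<odot>\<^sub>0 B')"
  by (rule exchange[OF _ composable3(2)[OF assms(1,2)] composable3(2)[OF assms(3,4)]
        composable3(1)[OF hom3_comp1[OF assms(1,2)] hom3_comp1[OF assms(3,4)]]]) simp

lemma exchange3_02:
  assumes "hom3 a b f g x y A" "hom3 a b f g y z A'" "hom3 b c k l u v B" "hom3 b c k l v w B'"
  shows "(A \<odot>\<^sub>2 A') \<odot>\<^sub>0 (B \<odot>\<^sub>2 B') = (A \<odot>\<^sub>0 B) \<odot>\<^sub>2 (A' \<odot>\<^sub>0 B')"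
  by (rule exchange[OF _ composable3(3)[OF assms(1,2)] composable3(3)[OF assms(3,4)]
        composable3(1)[OF hom3_comp2[OF assms(1,2)] hom3_comp2[OF assms(3,4)]]]) simp

lemma exchange3_12:
  assumes "hom3 a b f g x y A" "hom3 a b f g y z A'" "hom3 a b g h u v B" "hom3 a b g h v w B'"
  shows "(A \<odot>\<^sub>2 A') \<odot>\<^sub>1 (B \<odot>\<^sub>2 B') = (A \<odot>\<^sub>1 B) \<odot>\<^sub>2 (A' \<odot>\<^sub>1 B')"
  by (rule exchange[OF _ composable3(3)[OF assms(1,2)] composable3(3)[OF assms(3,4)]
        composable3(2)[OF hom3_comp2[OF assms(1,2)] hom3_comp2[OF assms(3,4)]]]) simp

lemma unit1:
  assumes "hom1 a b f"
  shows "\<iota> a \<odot>\<^sub>0 f = f" "f \<odot>\<^sub>0 \<iota> b = f"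
  using unit_left[of f 1 0] unit_right[of f 1 0] assms by (simp_all add: at_unfold hom_defs)

lemma unit2:
  assumes "hom2 a b f g x"
  shows "\<iota> (\<iota> a) \<odot>\<^sub>0 x = x" "x \<odot>\<^sub>0 \<iota> (\<iota> b) = x" "\<iota> f \<odot>\<^sub>1 x = x" "x \<odot>\<^sub>1 \<iota> g = x"
  using unit_left[of x 2 0] unit_right[of x 2 0] unit_left[of x 2 1] unit_right[of x 2 1] assms
  by (simp_all add: at_unfold hom_defs)

lemma unit3:
  assumes "hom3 a b f g x y A"
  shows "\<iota> (\<iota> (\<iota> a)) \<odot>\<^sub>0 A = A" "A \<odot>\<^sub>0 \<iota> (\<iota> (\<iota> b)) = A"
    "\<iota> (\<iota> f) \<odot>\<^sub>1 A = A" "A \<odot>\<^sub>1 \<iota> (\<iota> g) = A" "\<iota> x \<odot>\<^sub>2 A = A" "A \<odot>\<^sub>2 \<iota> y = A"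
  using unit_left[of A 3 0] unit_right[of A 3 0] unit_left[of A 3 1] unit_right[of A 3 1]
    unit_left[of A 3 2] unit_right[of A 3 2] assms
  by (simp_all add: at_unfold hom_defs)

end

text \<open>The bound provides identities on all cells of dimension at most two, as whiskering of
  3-cells requires.\<close>

locale strict_category3 = strict_ncategory n K
  for n :: nat and K :: "('c, 'k) cat_data_scheme" +
  assumes dim3: "3 \<le> n"
begin

lemma hom1_id: "a \<in> cells K 0 \<Longrightarrow> hom1 a a (\<iota> a)"
  using dim3 cid_cell[of a 0] csrc_cid[of a 0] ctgt_cid[of a 0] by (simp add: hom1_def)

lemma hom2_id: "hom1 a b f \<Longrightarrow> hom2 a b f f (\<iota> f)"
  using dim3 cid_cell[of f 1] csrc_cid[of f 1] ctgt_cid[of f 1]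
  by (simp add: hom_defs eval_nat_numeral)

lemma hom3_id: "hom2 a b f g x \<Longrightarrow> hom3 a b f g x x (\<iota> x)"
  using dim3 cid_cell[of x 2] csrc_cid[of x 2] ctgt_cid[of x 2]
  by (simp add: hom_defs eval_nat_numeral)

lemma id_comp1: "hom1 a b f \<Longrightarrow> hom1 b c g \<Longrightarrow> \<iota> (f \<odot>\<^sub>0 g) = \<iota> f \<odot>\<^sub>0 \<iota> g"
  using dim3 by (intro cid_ccomp[OF composable1]) auto

lemma id_comp2:
  "hom2 a b f g x \<Longrightarrow> hom2 b c f' g' y \<Longrightarrow> \<iota> (x \<odot>\<^sub>0 y) = \<iota> x \<odot>\<^sub>0 \<iota> y"
  "hom2 a b f g x \<Longrightarrow> hom2 a b g h z \<Longrightarrow> \<iota> (x \<odot>\<^sub>1 z) = \<iota> x \<odot>\<^sub>1 \<iota> z"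
  using dim3 by (intro cid_ccomp[OF composable2(1)] cid_ccomp[OF composable2(2)]; simp)+

lemma hom3_unique_ends:
  assumes "hom3 a b f g x y A"
  shows "hom3 a b f g x x (\<iota> x)" "hom3 a b f g y y (\<iota> y)"
  using hom3_id hom3D(1,2)[OF assms] by auto

text \<open>The exchange law with identities inserted: acting on one factor and then on the other,
  in either order, gives the composite along 1-cells. Naturality of each constraint is the agreement
  of the two orders.\<close>

lemma slide12:
  assumes "hom3 a b f g x y A" "hom3 a b g h u v B"
  shows "(A \<odot>\<^sub>1 \<iota> u) \<odot>\<^sub>2 (\<iota> y \<odot>\<^sub>1 B) = A \<odot>\<^sub>1 B" "(\<iota> x \<odot>\<^sub>1 B) \<odot>\<^sub>2 (A \<odot>\<^sub>1 \<iota> v) = A \<odot>\<^sub>1 B"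
  using exchange3_12[OF assms(1) hom3_unique_ends(2)[OF assms(1)] hom3_unique_ends(1)[OF assms(2)] assms(2)]
    exchange3_12[OF hom3_unique_ends(1)[OF assms(1)] assms(1) assms(2) hom3_unique_ends(2)[OF assms(2)]]
    unit3(5,6)[OF assms(1)] unit3(5,6)[OF assms(2)]
  by simp_all

end

section \<open>Trees and forests as 2-cells\<close>

text \<open>Composability along 1-cells expressed on trees: the condition under which
  \<open>Ys\<close> can be grafted onto a tree with leaves \<open>es\<close>.\<close>

definition fits :: "'a set \<Rightarrow> 'a tree list \<Rightarrow> ('a \<times> 'a) list \<Rightarrow> bool" where
  "fits C Ys es \<longleftrightarrow> (\<forall>Y\<in>set Ys. typed C Y) \<and> roots Ys = es"

lemma fits_simps [simp]:
  "fits C [] es \<longleftrightarrow> es = []"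
  "fits C (Y # Ys) (e # es) \<longleftrightarrow> typed C Y \<and> root Y = e \<and> fits C Ys es"
  "fits C Ys [] \<longleftrightarrow> Ys = []"
  by (auto simp: fits_def)

lemma fits_append: "fits C Ys (es @ fs) \<longleftrightarrow> (\<exists>Y1 Y2. Ys = Y1 @ Y2 \<and> fits C Y1 es \<and> fits C Y2 fs)"
proof
  assume f: "fits C Ys (es @ fs)"
  then obtain Y1 Y2 where "Ys = Y1 @ Y2" "roots Y1 = es" "roots Y2 = fs"
    by (auto simp: fits_def map_eq_append_conv)
  with f show "\<exists>Y1 Y2. Ys = Y1 @ Y2 \<and> fits C Y1 es \<and> fits C Y2 fs"
    by (intro exI[of _ Y1] exI[of _ Y2]) (auto simp: fits_def)
qed (auto simp: fits_def)

lemma fits_length: "fits C Ys es \<Longrightarrow> length Ys = length es"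
  by (auto simp: fits_def)

lemma fits_graft:
  assumes "typed C X" "fits C Ys (leaves X)"
  shows "typed C (graft X Ys)" "left_end (graft X Ys) = left_end X" "right_end (graft X Ys) = right_end X"
    "leaves (graft X Ys) = forest_leaves Ys" "root (graft X Ys) = root X"
  using assms typed_graft[of C X Ys] graft_ends[of C X Ys] leaves_graft[of Ys X]
  by (auto simp: fits_def dest: arg_cong[of "roots Ys" _ length])

lemma fits_forest: "typed C X \<Longrightarrow> fits C Ys (leaves X) \<Longrightarrow> is_forest C (left_end X) Ys (right_end X)"
  using typed_is_path[of C X] by (simp add: fits_def is_forest_def)

text \<open>The two trees are recorded besides the 3-cell because they cannot be recovered from it:
  in a general \<open>K\<close> different trees may have the same realization.\<close>

type_synonym ('a, 'c) arrow = "'a tree \<times> 'a tree \<times> 'c"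

abbreviation src :: "('a, 'c) arrow \<Rightarrow> 'a tree" where "src \<equiv> fst"
abbreviation trg :: "('a, 'c) arrow \<Rightarrow> 'a tree" where "trg p \<equiv> fst (snd p)"
abbreviation cell :: "('a, 'c) arrow \<Rightarrow> 'c" where "cell p \<equiv> snd (snd p)"

text \<open>Cells of the shape of the generators up to dimension three in an arbitrary strict
  category. Both free categories are instances, and the calculations with trees take place away from
  classes of terms.\<close>

locale bicat_cells = strict_category3 n K
  for n :: nat and K :: "('c, 'k) cat_data_scheme" +
  fixes C :: "'a set" and ob :: "'a \<Rightarrow> 'c" and edge :: "'a \<Rightarrow> 'a \<Rightarrow> 'c"
    and mult :: "'a \<Rightarrow> 'a \<Rightarrow> 'a \<Rightarrow> 'c" and uni :: "'a \<Rightarrow> 'c"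
    and \<alpha> :: "'a \<Rightarrow> 'a \<Rightarrow> 'a \<Rightarrow> 'a \<Rightarrow> 'c" and \<l> \<r> :: "'a \<Rightarrow> 'a \<Rightarrow> 'c"
  assumes ob: "a \<in> C \<Longrightarrow> ob a \<in> cells K 0"
    and edge: "a \<in> C \<Longrightarrow> b \<in> C \<Longrightarrow> hom1 (ob a) (ob b) (edge a b)"
    and mult: "a \<in> C \<Longrightarrow> b \<in> C \<Longrightarrow> c \<in> C \<Longrightarrow>
      hom2 (ob a) (ob c) (edge a b \<odot>\<^sub>0 edge b c) (edge a c) (mult a b c)"
    and uni: "a \<in> C \<Longrightarrow> hom2 (ob a) (ob a) (\<iota> (ob a)) (edge a a) (uni a)"
    and \<alpha>: "a \<in> C \<Longrightarrow> b \<in> C \<Longrightarrow> c \<in> C \<Longrightarrow> d \<in> C \<Longrightarrow>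
      \<alpha> a b c d \<in> cells K 3 \<and>
      csrc K (\<alpha> a b c d) = (mult a b c \<odot>\<^sub>0 \<iota> (edge c d)) \<odot>\<^sub>1 mult a c d \<and>
      ctgt K (\<alpha> a b c d) = (\<iota> (edge a b) \<odot>\<^sub>0 mult b c d) \<odot>\<^sub>1 mult a b d"
    and \<l>: "a \<in> C \<Longrightarrow> b \<in> C \<Longrightarrow>
      \<l> a b \<in> cells K 3 \<and>
      csrc K (\<l> a b) = (uni a \<odot>\<^sub>0 \<iota> (edge a b)) \<odot>\<^sub>1 mult a a b \<and> ctgt K (\<l> a b) = \<iota> (edge a b)"
    and \<r>: "a \<in> C \<Longrightarrow> b \<in> C \<Longrightarrow>
      \<r> a b \<in> cells K 3 \<and>
      csrc K (\<r> a b) = (\<iota> (edge a b) \<odot>\<^sub>0 uni b) \<odot>\<^sub>1 mult a b b \<and> ctgt K (\<r> a b) = \<iota> (edge a b)"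
begin

primrec path :: "'a \<Rightarrow> ('a \<times> 'a) list \<Rightarrow> 'c" where
  "path a [] = \<iota> (ob a)"
| "path a (e # es) = edge (fst e) (snd e) \<odot>\<^sub>0 path (snd e) es"

primrec realize :: "'a tree \<Rightarrow> 'c" where
  "realize (Leaf a b) = \<iota> (edge a b)"
| "realize (Unit a) = uni a"
| "realize (Node X Y) = (realize X \<odot>\<^sub>0 realize Y) \<odot>\<^sub>1 mult (left_end X) (right_end X) (right_end Y)"

primrec forest :: "'a \<Rightarrow> 'a tree list \<Rightarrow> 'c" where
  "forest a [] = \<iota> (\<iota> (ob a))"
| "forest a (X # Xs) = realize X \<odot>\<^sub>0 forest (right_end X) Xs"

lemma path_hom: "is_path C a es b \<Longrightarrow> hom1 (ob a) (ob b) (path a es)"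
proof (induction es arbitrary: a)
  case Nil
  then show ?case using hom1_id[OF ob] by auto
next
  case (Cons e es)
  have "fst e = a" "a \<in> C" "snd e \<in> C" "is_path C (snd e) es b"
    using Cons.prems is_path_ends[of C "snd e" es b] by auto
  then show ?case using hom1_comp[OF edge Cons.IH, of a "snd e"] by simp
qed

lemma path_append:
  "is_path C a es b \<Longrightarrow> is_path C b fs c \<Longrightarrow> path a (es @ fs) = path a es \<odot>\<^sub>0 path b fs"
proof (induction es arbitrary: a)
  case Nil
  then show ?case using unit1(1)[OF path_hom[of b fs c]] by auto
next
  case (Cons e es)
  have h: "fst e = a" "a \<in> C" "snd e \<in> C" "is_path C (snd e) es b"
    using Cons.prems is_path_ends[of C "snd e" es b] by auto
  show ?case
    using Cons.IH[OF h(4) Cons.prems(2)] h(1)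
      assoc1[OF edge[OF h(2,3)] path_hom[OF h(4)] path_hom[OF Cons.prems(2)]]
    by simp
qed

lemma path_single: "a \<in> C \<Longrightarrow> b \<in> C \<Longrightarrow> path a [(a, b)] = edge a b"
  using unit1(2)[OF edge] by simp

lemma realize_hom:
  "typed C X \<Longrightarrow> hom2 (ob (left_end X)) (ob (right_end X)) (path (left_end X) (leaves X))
      (edge (left_end X) (right_end X)) (realize X)"
proof (induction X)
  case (Leaf a b)
  then show ?case using hom2_id[OF edge, of a b] path_single[of a b] by simp
next
  case (Unit a)
  then show ?case using uni by simp
next
  case (Node X Y)
  have t: "typed C X" "typed C Y" "right_end X = left_end Y" using Node.prems by auto
  note e = typed_ends[OF t(1)] typed_ends[OF t(2)]
  show ?case
    using hom2_comp1[OF hom2_comp0[OF Node.IH(1)[OF t(1)] Node.IH(2)[OF t(2), folded t(3)]] mult]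
      e path_append[OF typed_is_path[OF t(1)] typed_is_path[OF t(2), folded t(3)]] t(3)
    by simp
qed

lemma forest_hom:
  "is_forest C a Xs b \<Longrightarrow>
    hom2 (ob a) (ob b) (path a (forest_leaves Xs)) (path a (roots Xs)) (forest a Xs)"
proof (induction Xs arbitrary: a)
  case Nil
  then show ?case using hom2_id[OF hom1_id[OF ob]] by auto
next
  case (Cons X Xs)
  have t: "left_end X = a" "typed C X" "is_forest C (right_end X) Xs b" using Cons.prems by auto
  show ?case
    using hom2_comp0[OF realize_hom[OF t(2)] Cons.IH[OF t(3)]] t(1)
      path_append[OF typed_is_path[OF t(2)] is_forest_leaves[OF t(3)]]
    by simp
qed

lemma forest_append:
  "is_forest C a Xs b \<Longrightarrow> is_forest C b Ys c \<Longrightarrow> forest a (Xs @ Ys) = forest a Xs \<odot>\<^sub>0 forest b Ys"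
proof (induction Xs arbitrary: a)
  case Nil
  then show ?case using unit2(1)[OF forest_hom[of b Ys c]] by auto
next
  case (Cons X Xs)
  have t: "left_end X = a" "typed C X" "is_forest C (right_end X) Xs b" using Cons.prems by auto
  show ?case
    using Cons.IH[OF t(3) Cons.prems(2)]
      assoc2(1)[OF realize_hom[OF t(2)] forest_hom[OF t(3)] forest_hom[OF Cons.prems(2)]]
    by simp
qed

lemma forest_single: "typed C X \<Longrightarrow> forest (left_end X) [X] = realize X"
  using unit2(2)[OF realize_hom] by simp

lemma fits_hom:
  "typed C X \<Longrightarrow> fits C Ys (leaves X) \<Longrightarrow> hom2 (ob (left_end X)) (ob (right_end X))
    (path (left_end X) (forest_leaves Ys)) (path (left_end X) (leaves X)) (forest (left_end X) Ys)"
  using forest_hom[OF fits_forest[of C X Ys]] by (simp add: fits_def)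

text \<open>At a node the exchange law distributes the two halves of the forest over the two
  subtrees, so composing with a forest along 1-cells is substitution for the leaves.\<close>

lemma forest_graft:
  "typed C X \<Longrightarrow> fits C Ys (leaves X) \<Longrightarrow> forest (left_end X) Ys \<odot>\<^sub>1 realize X = realize (graft X Ys)"
proof (induction X arbitrary: Ys)
  case (Leaf a b)
  then obtain Y where Y: "Ys = [Y]" "typed C Y" "root Y = (a, b)"
    by (cases Ys) auto
  then have "left_end Y = a" "right_end Y = b" by (auto simp: root_def)
  then show ?case using Y unit2(4)[OF realize_hom[OF Y(2)]] forest_single[OF Y(2)] by simp
next
  case (Unit a)
  then show ?case using unit2(3)[OF uni] by simp
next
  case (Node X X')
  have t: "typed C X" "typed C X'" "right_end X = left_end X'" using Node.prems by auto
  obtain Y1 Y2 where Y: "Ys = Y1 @ Y2" "fits C Y1 (leaves X)" "fits C Y2 (leaves X')"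
    using Node.prems(2) by (auto simp: fits_append)
  note e = typed_ends[OF t(1)] typed_ends[OF t(2)]
  have f: "is_forest C (left_end X) Y1 (right_end X)" "is_forest C (right_end X) Y2 (right_end X')"
    using fits_forest[OF t(1) Y(2)] fits_forest[OF t(2) Y(3)] t(3) by auto
  note r = realize_hom[OF t(1)] realize_hom[OF t(2), folded t(3)]
  note h = fits_hom[OF t(1) Y(2)] fits_hom[OF t(2) Y(3), folded t(3)]
  have F: "forest (left_end X) Ys = forest (left_end X) Y1 \<odot>\<^sub>0 forest (right_end X) Y2"
    unfolding Y(1) by (rule forest_append[OF f])
  have "forest (left_end X) Ys \<odot>\<^sub>1 realize (Node X X') =
      ((forest (left_end X) Y1 \<odot>\<^sub>0 forest (right_end X) Y2) \<odot>\<^sub>1 (realize X \<odot>\<^sub>0 realize X')) \<odot>\<^sub>1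
      mult (left_end X) (right_end X) (right_end X')"
    unfolding F using assoc2(2)[OF hom2_comp0[OF h] hom2_comp0[OF r] mult] e t(3) by simp
  also have "(forest (left_end X) Y1 \<odot>\<^sub>0 forest (right_end X) Y2) \<odot>\<^sub>1 (realize X \<odot>\<^sub>0 realize X') =
      (forest (left_end X) Y1 \<odot>\<^sub>1 realize X) \<odot>\<^sub>0 (forest (right_end X) Y2 \<odot>\<^sub>1 realize X')"
    by (rule exchange2[OF h(1) r(1) h(2) r(2), symmetric])
  also have "\<dots> = realize (graft X Y1) \<odot>\<^sub>0 realize (graft X' Y2)"
    using Node.IH(1)[OF t(1) Y(2)] Node.IH(2)[OF t(2) Y(3)] t(3) by simp
  finally show ?case
    using Y fits_length[OF Y(2)] fits_graft[OF t(1) Y(2)] fits_graft[OF t(2) Y(3)] by simp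
qed

text \<open>Agreement of roots and leaves is demanded separately because in a general
  \<open>K\<close> it does not follow from the boundary of the 3-cell.\<close>

definition arrow :: "('a, 'c) arrow \<Rightarrow> bool" where
  "arrow p \<longleftrightarrow> typed C (src p) \<and> typed C (trg p) \<and> root (trg p) = root (src p) \<and>
     leaves (trg p) = leaves (src p) \<and> cell p \<in> cells K 3 \<and> csrc K (cell p) = realize (src p) \<and>
     ctgt K (cell p) = realize (trg p)"

lemma arrowD:
  assumes "arrow p"
  shows "typed C (src p)" "typed C (trg p)" "root (trg p) = root (src p)"
    "left_end (trg p) = left_end (src p)" "right_end (trg p) = right_end (src p)"
    "leaves (trg p) = leaves (src p)"
  using assms by (auto simp: arrow_def root_def)

lemma arrow_hom:
  assumes "arrow p"
  shows "hom3 (ob (left_end (src p))) (ob (right_end (src p))) (path (left_end (src p)) (leaves (src p)))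
    (edge (left_end (src p)) (right_end (src p))) (realize (src p)) (realize (trg p)) (cell p)"
  using assms realize_hom[of "src p"] realize_hom[of "trg p"] arrowD[OF assms]
  by (simp add: arrow_def hom3_def)

lemma arrowI:
  assumes "typed C X" "typed C Y" "root Y = root X" "leaves Y = leaves X" "hom3 a b f g (realize X) (realize Y) A"
  shows "arrow (X, Y, A)"
  using assms by (simp add: arrow_def hom3_def)

definition idn :: "'a tree \<Rightarrow> ('a, 'c) arrow" where
  "idn X = (X, X, \<iota> (realize X))"

definition cmp :: "('a, 'c) arrow \<Rightarrow> ('a, 'c) arrow \<Rightarrow> ('a, 'c) arrow" where
  "cmp p q = (src p, trg q, cell p \<odot>\<^sub>2 cell q)"

definition ten :: "('a, 'c) arrow \<Rightarrow> ('a, 'c) arrow \<Rightarrow> ('a, 'c) arrow" where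
  "ten p q = (Node (src p) (src q), Node (trg p) (trg q),
     (cell p \<odot>\<^sub>0 cell q) \<odot>\<^sub>1 \<iota> (mult (left_end (src p)) (right_end (src p)) (right_end (src q))))"

definition assr :: "'a tree \<Rightarrow> 'a tree \<Rightarrow> 'a tree \<Rightarrow> ('a, 'c) arrow" where
  "assr X Y Z = (Node (Node X Y) Z, Node X (Node Y Z),
     \<iota> (realize X \<odot>\<^sub>0 realize Y \<odot>\<^sub>0 realize Z) \<odot>\<^sub>1 \<alpha> (left_end X) (right_end X) (right_end Y) (right_end Z))"

definition lun :: "'a tree \<Rightarrow> ('a, 'c) arrow" where
  "lun X = (Node (Unit (left_end X)) X, X, \<iota> (realize X) \<odot>\<^sub>1 \<l> (left_end X) (right_end X))"

definition run :: "'a tree \<Rightarrow> ('a, 'c) arrow" where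
  "run X = (Node X (Unit (right_end X)), X, \<iota> (realize X) \<odot>\<^sub>1 \<r> (left_end X) (right_end X))"

lemmas arrow_op_defs = idn_def cmp_def ten_def assr_def lun_def run_def

lemma src_trg [simp]:
  "src (idn X) = X" "trg (idn X) = X" "src (cmp p q) = src p" "trg (cmp p q) = trg q"
  "src (ten p q) = Node (src p) (src q)" "trg (ten p q) = Node (trg p) (trg q)"
  "src (assr X Y Z) = Node (Node X Y) Z" "trg (assr X Y Z) = Node X (Node Y Z)"
  "src (lun X) = Node (Unit (left_end X)) X" "trg (lun X) = X"
  "src (run X) = Node X (Unit (right_end X))" "trg (run X) = X"
  by (simp_all add: arrow_op_defs)

lemma \<alpha>_hom:
  assumes "a \<in> C" "b \<in> C" "c \<in> C" "d \<in> C"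
  shows "hom3 (ob a) (ob d) (edge a b \<odot>\<^sub>0 edge b c \<odot>\<^sub>0 edge c d) (edge a d)
      ((mult a b c \<odot>\<^sub>0 \<iota> (edge c d)) \<odot>\<^sub>1 mult a c d) ((\<iota> (edge a b) \<odot>\<^sub>0 mult b c d) \<odot>\<^sub>1 mult a b d) (\<alpha> a b c d)"
proof -
  note e = edge[OF assms(1,2)] edge[OF assms(2,3)] edge[OF assms(3,4)]
  note s = hom2_comp1[OF hom2_comp0[OF mult[OF assms(1-3)] hom2_id[OF e(3)]] mult[OF assms(1,3,4)]]
  note t = hom2_comp1[OF hom2_comp0[OF hom2_id[OF e(1)] mult[OF assms(2-4)]] mult[OF assms(1,2,4)]]
  show ?thesis using s t \<alpha>[OF assms] assoc1[OF e] by (simp add: hom3_def)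
qed

lemma \<l>_hom:
  assumes "a \<in> C" "b \<in> C"
  shows "hom3 (ob a) (ob b) (edge a b) (edge a b)
      ((uni a \<odot>\<^sub>0 \<iota> (edge a b)) \<odot>\<^sub>1 mult a a b) (\<iota> (edge a b)) (\<l> a b)"
proof -
  note e = edge[OF assms]
  note s = hom2_comp1[OF hom2_comp0[OF uni[OF assms(1)] hom2_id[OF e]] mult[OF assms(1,1,2)]]
  show ?thesis using s hom2_id[OF e] \<l>[OF assms] unit1[OF e] by (simp add: hom3_def)
qed

lemma \<r>_hom:
  assumes "a \<in> C" "b \<in> C"
  shows "hom3 (ob a) (ob b) (edge a b) (edge a b)
      ((\<iota> (edge a b) \<odot>\<^sub>0 uni b) \<odot>\<^sub>1 mult a b b) (\<iota> (edge a b)) (\<r> a b)"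
proof -
  note e = edge[OF assms]
  note s = hom2_comp1[OF hom2_comp0[OF hom2_id[OF e] uni[OF assms(2)]] mult[OF assms(1,2,2)]]
  show ?thesis using s hom2_id[OF e] \<r>[OF assms] unit1[OF e] by (simp add: hom3_def)
qed

text \<open>Both boundaries of a whiskered constraint have the form of given cells followed by one fixed cell,
  also for 3-cells; this makes naturality an instance of the exchange law.\<close>

lemma node_node_left:
  assumes "typed C (Node (Node X Y) Z)"
  shows "realize (Node (Node X Y) Z) = (realize X \<odot>\<^sub>0 realize Y \<odot>\<^sub>0 realize Z) \<odot>\<^sub>1
    csrc K (\<alpha> (left_end X) (right_end X) (right_end Y) (right_end Z))"
proof -
  have t: "typed C X" "typed C Y" "typed C Z" "right_end X = left_end Y" "right_end Y = left_end Z"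
    using assms by auto
  note e = typed_ends[OF t(1)] typed_ends[OF t(2)] typed_ends[OF t(3)]
  note x = realize_hom[OF t(1)] and y = realize_hom[OF t(2), folded t(4)] and z = realize_hom[OF t(3), folded t(5)]
  let ?a = "left_end X" and ?b = "right_end X" and ?c = "right_end Y" and ?d = "right_end Z"
  have c: "?a \<in> C" "?b \<in> C" "?c \<in> C" "?d \<in> C" using e by auto
  note m = mult[OF c(1-3)] mult[OF c(1,3,4)]
  note ie = hom2_id[OF edge[OF c(3,4)]]
  have "((realize X \<odot>\<^sub>0 realize Y) \<odot>\<^sub>1 mult ?a ?b ?c) \<odot>\<^sub>0 realize Z =
      ((realize X \<odot>\<^sub>0 realize Y) \<odot>\<^sub>0 realize Z) \<odot>\<^sub>1 (mult ?a ?b ?c \<odot>\<^sub>0 \<iota> (edge ?c ?d))"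
    using exchange2[OF hom2_comp0[OF x y] m(1) z ie] unit2(4)[OF z] by simp
  moreover have "(((realize X \<odot>\<^sub>0 realize Y) \<odot>\<^sub>0 realize Z) \<odot>\<^sub>1 (mult ?a ?b ?c \<odot>\<^sub>0 \<iota> (edge ?c ?d))) \<odot>\<^sub>1 mult ?a ?c ?d
     = ((realize X \<odot>\<^sub>0 realize Y) \<odot>\<^sub>0 realize Z) \<odot>\<^sub>1 (mult ?a ?b ?c \<odot>\<^sub>0 \<iota> (edge ?c ?d)) \<odot>\<^sub>1 mult ?a ?c ?d"
    by (rule assoc2(2)[OF hom2_comp0[OF hom2_comp0[OF x y] z] hom2_comp0[OF m(1) ie] m(2)])
  ultimately show ?thesis
    using \<alpha>[OF c] assoc2(1)[OF x y z] by simp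
qed

lemma node_node_right:
  assumes "typed C (Node X (Node Y Z))"
  shows "realize (Node X (Node Y Z)) = (realize X \<odot>\<^sub>0 realize Y \<odot>\<^sub>0 realize Z) \<odot>\<^sub>1
    ctgt K (\<alpha> (left_end X) (right_end X) (right_end Y) (right_end Z))"
proof -
  have t: "typed C X" "typed C Y" "typed C Z" "right_end X = left_end Y" "right_end Y = left_end Z"
    using assms by auto
  note e = typed_ends[OF t(1)] typed_ends[OF t(2)] typed_ends[OF t(3)]
  note x = realize_hom[OF t(1)] and y = realize_hom[OF t(2), folded t(4)] and z = realize_hom[OF t(3), folded t(5)]
  let ?a = "left_end X" and ?b = "right_end X" and ?c = "right_end Y" and ?d = "right_end Z"
  have c: "?a \<in> C" "?b \<in> C" "?c \<in> C" "?d \<in> C" using e by auto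
  note m = mult[OF c(2-4)] mult[OF c(1,2,4)]
  note ie = hom2_id[OF edge[OF c(1,2)]]
  have "realize X \<odot>\<^sub>0 ((realize Y \<odot>\<^sub>0 realize Z) \<odot>\<^sub>1 mult ?b ?c ?d) =
      (realize X \<odot>\<^sub>0 realize Y \<odot>\<^sub>0 realize Z) \<odot>\<^sub>1 (\<iota> (edge ?a ?b) \<odot>\<^sub>0 mult ?b ?c ?d)"
    using exchange2[OF x ie hom2_comp0[OF y z] m(1)] unit2(4)[OF x] by simp
  moreover have "((realize X \<odot>\<^sub>0 realize Y \<odot>\<^sub>0 realize Z) \<odot>\<^sub>1 (\<iota> (edge ?a ?b) \<odot>\<^sub>0 mult ?b ?c ?d)) \<odot>\<^sub>1 mult ?a ?b ?d
     = (realize X \<odot>\<^sub>0 realize Y \<odot>\<^sub>0 realize Z) \<odot>\<^sub>1 (\<iota> (edge ?a ?b) \<odot>\<^sub>0 mult ?b ?c ?d) \<odot>\<^sub>1 mult ?a ?b ?d"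
    by (rule assoc2(2)[OF hom2_comp0[OF x hom2_comp0[OF y z]] hom2_comp0[OF ie m(1)] m(2)])
  ultimately show ?thesis
    using \<alpha>[OF c] t(4) by simp
qed

lemma node_unit_left:
  assumes "typed C X"
  shows "realize (Node (Unit (left_end X)) X) = realize X \<odot>\<^sub>1 csrc K (\<l> (left_end X) (right_end X))"
proof -
  let ?a = "left_end X" and ?b = "right_end X"
  have c: "?a \<in> C" "?b \<in> C" using typed_ends[OF assms] by auto
  note x = realize_hom[OF assms] and m = mult[OF c(1,1,2)] and ie = hom2_id[OF edge[OF c]] and u = uni[OF c(1)]
  note ii = hom2_id[OF hom1_id[OF ob[OF c(1)]]]
  have "uni ?a \<odot>\<^sub>0 realize X = realize X \<odot>\<^sub>1 (uni ?a \<odot>\<^sub>0 \<iota> (edge ?a ?b))"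
    using exchange2[OF ii u x ie] unit2(4)[OF x] unit2(3)[OF u] unit2(1)[OF x] by simp
  then show ?thesis
    using \<l>[OF c] assoc2(2)[OF x _ m] hom2_comp0[OF u ie] unit1(1)[OF edge[OF c]] by simp
qed

lemma node_unit_right:
  assumes "typed C X"
  shows "realize (Node X (Unit (right_end X))) = realize X \<odot>\<^sub>1 csrc K (\<r> (left_end X) (right_end X))"
proof -
  let ?a = "left_end X" and ?b = "right_end X"
  have c: "?a \<in> C" "?b \<in> C" using typed_ends[OF assms] by auto
  note x = realize_hom[OF assms] and m = mult[OF c(1,2,2)] and ie = hom2_id[OF edge[OF c]] and u = uni[OF c(2)]
  note ii = hom2_id[OF hom1_id[OF ob[OF c(2)]]]
  have "realize X \<odot>\<^sub>0 uni ?b = realize X \<odot>\<^sub>1 (\<iota> (edge ?a ?b) \<odot>\<^sub>0 uni ?b)"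
    using exchange2[OF x ie ii u] unit2(4)[OF x] unit2(3)[OF u] unit2(2)[OF x] by simp
  then show ?thesis
    using \<r>[OF c] assoc2(2)[OF x _ m] hom2_comp0[OF ie u] unit1(2)[OF edge[OF c]] by simp
qed

end

section \<open>Arrows between trees\<close>

context bicat_cells
begin

lemma arrow_idn: "typed C X \<Longrightarrow> arrow (idn X)"
  unfolding idn_def by (rule arrowI[OF _ _ _ _ hom3_id[OF realize_hom]]) auto

lemma arrow_cmp:
  assumes "arrow p" "arrow q" "trg p = src q"
  shows "arrow (cmp p q)"
proof -
  note p = arrow_hom[OF assms(1)] and q = arrow_hom[OF assms(2)]
  note d = arrowD[OF assms(1)] and d' = arrowD[OF assms(2)]
  have "hom3 (ob (left_end (src p))) (ob (right_end (src p))) (path (left_end (src p)) (leaves (src p)))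
    (edge (left_end (src p)) (right_end (src p))) (realize (trg p)) (realize (trg q)) (cell q)"
    using q d unfolding assms(3) by simp
  then show ?thesis unfolding cmp_def
    using d d' assms(3) by (intro arrowI[OF _ _ _ _ hom3_comp2[OF p]]) auto
qed

lemma mult_arrow_hom:
  assumes "typed C X" "typed C Y" "right_end X = left_end Y"
  shows "hom2 (ob (left_end X)) (ob (right_end Y))
    (edge (left_end X) (right_end X) \<odot>\<^sub>0 edge (left_end Y) (right_end Y)) (edge (left_end X) (right_end Y))
    (mult (left_end X) (right_end X) (right_end Y))"
  using mult[of "left_end X" "right_end X" "right_end Y"] assms typed_ends[of C X] typed_ends[of C Y] by auto

lemma arrow_ten:
  assumes "arrow p" "arrow q" "right_end (src p) = left_end (src q)"
  shows "arrow (ten p q)"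
proof -
  note d = arrowD[OF assms(1)] and d' = arrowD[OF assms(2)]
  note m = hom3_id[OF mult_arrow_hom[OF d(1) d'(1) assms(3)]]
  note h = hom3_comp1[OF hom3_comp0[OF arrow_hom[OF assms(1)] arrow_hom[OF assms(2), folded assms(3)]] m[folded assms(3)]]
  have "hom3 (ob (left_end (src p))) (ob (right_end (src q))) (path (left_end (src p)) (leaves (src p)) \<odot>\<^sub>0 path (left_end (src q)) (leaves (src q)))
     (edge (left_end (src p)) (right_end (src q))) (realize (Node (src p) (src q))) (realize (Node (trg p) (trg q))) (cell (ten p q))"
    using h assms(3) d d' by (simp add: ten_def)
  then show ?thesis
    unfolding ten_def using d d' assms(3) by (intro arrowI[where A = "_ \<odot>\<^sub>1 _"]) (auto simp: root_def)
qed

lemma realize3_hom: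
  assumes "typed C (Node (Node X Y) Z)"
  shows "hom2 (ob (left_end X)) (ob (right_end Z))
    (path (left_end X) (leaves X) \<odot>\<^sub>0 path (right_end X) (leaves Y) \<odot>\<^sub>0 path (right_end Y) (leaves Z))
    (edge (left_end X) (right_end X) \<odot>\<^sub>0 edge (right_end X) (right_end Y) \<odot>\<^sub>0 edge (right_end Y) (right_end Z))
    (realize X \<odot>\<^sub>0 realize Y \<odot>\<^sub>0 realize Z)"
proof -
  have t: "typed C X" "typed C Y" "typed C Z" "right_end X = left_end Y" "right_end Y = left_end Z"
    using assms by auto
  show ?thesis
    using hom2_comp0[OF realize_hom[OF t(1)] hom2_comp0[OF realize_hom[OF t(2), folded t(4)] realize_hom[OF t(3), folded t(5)]]]
    by simp
qed

lemma \<alpha>_hom_typed: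
  assumes "typed C (Node (Node X Y) Z)"
  shows "hom3 (ob (left_end X)) (ob (right_end Z))
    (edge (left_end X) (right_end X) \<odot>\<^sub>0 edge (right_end X) (right_end Y) \<odot>\<^sub>0 edge (right_end Y) (right_end Z))
    (edge (left_end X) (right_end Z))
    (csrc K (\<alpha> (left_end X) (right_end X) (right_end Y) (right_end Z)))
    (ctgt K (\<alpha> (left_end X) (right_end X) (right_end Y) (right_end Z)))
    (\<alpha> (left_end X) (right_end X) (right_end Y) (right_end Z))"
proof -
  have "left_end X \<in> C" "right_end X \<in> C" "right_end Y \<in> C" "right_end Z \<in> C"
    using assms typed_ends[of C X] typed_ends[of C Y] typed_ends[of C Z] by auto
  from \<alpha>_hom[OF this] show ?thesis using hom3D(3,4) by fastforce
qed

lemma \<l>_hom_typed: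
  assumes "typed C X"
  shows "hom3 (ob (left_end X)) (ob (right_end X)) (edge (left_end X) (right_end X)) (edge (left_end X) (right_end X))
    (csrc K (\<l> (left_end X) (right_end X))) (\<iota> (edge (left_end X) (right_end X))) (\<l> (left_end X) (right_end X))"
  using \<l>_hom[of "left_end X" "right_end X"] typed_ends[OF assms] hom3D(3) by fastforce

lemma \<r>_hom_typed:
  assumes "typed C X"
  shows "hom3 (ob (left_end X)) (ob (right_end X)) (edge (left_end X) (right_end X)) (edge (left_end X) (right_end X))
    (csrc K (\<r> (left_end X) (right_end X))) (\<iota> (edge (left_end X) (right_end X))) (\<r> (left_end X) (right_end X))"
  using \<r>_hom[of "left_end X" "right_end X"] typed_ends[OF assms] hom3D(3) by fastforce

lemma arrow_assr:
  assumes "typed C (Node (Node X Y) Z)"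
  shows "arrow (assr X Y Z)"
  unfolding assr_def
  using hom3_comp1[OF hom3_id[OF realize3_hom[OF assms]] \<alpha>_hom_typed[OF assms]]
    node_node_left[OF assms] node_node_right[of X Y Z] assms
  by (intro arrowI[where A = "_ \<odot>\<^sub>1 _"]) (auto simp: root_def)

lemma arrow_lun:
  assumes "typed C X"
  shows "arrow (lun X)"
  unfolding lun_def
  using hom3_comp1[OF hom3_id[OF realize_hom[OF assms]] \<l>_hom_typed[OF assms]] unit2(4)[OF realize_hom[OF assms]]
    node_unit_left[OF assms] assms typed_ends[OF assms]
  by (intro arrowI[where A = "_ \<odot>\<^sub>1 _"]) (auto simp: root_def)

lemma arrow_run:
  assumes "typed C X"
  shows "arrow (run X)"
  unfolding run_def
  using hom3_comp1[OF hom3_id[OF realize_hom[OF assms]] \<r>_hom_typed[OF assms]] unit2(4)[OF realize_hom[OF assms]]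
    node_unit_right[OF assms] assms typed_ends[OF assms]
  by (intro arrowI[where A = "_ \<odot>\<^sub>1 _"]) (auto simp: root_def)

lemma cmp_assoc:
  assumes "arrow p" "arrow q" "arrow r" "trg p = src q" "trg q = src r"
  shows "cmp (cmp p q) r = cmp p (cmp q r)"
proof -
  note d = arrowD[OF assms(1)] arrowD[OF assms(2)]
  note p = arrow_hom[OF assms(1)] and q = arrow_hom[OF assms(2)] and r = arrow_hom[OF assms(3)]
  have "left_end (src q) = left_end (src p)" "right_end (src q) = right_end (src p)" "leaves (src q) = leaves (src p)"
    "left_end (src r) = left_end (src p)" "right_end (src r) = right_end (src p)" "leaves (src r) = leaves (src p)"
    using d assms(4,5) by simp_all
  then show ?thesis unfolding cmp_def
    using assoc3(3)[OF p, of "realize (trg q)" "cell q" "realize (trg r)" "cell r"] q r assms(4,5) by simp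
qed

lemma cmp_idn:
  assumes "arrow p"
  shows "cmp (idn (src p)) p = p" "cmp p (idn (trg p)) = p"
  using unit3(5,6)[OF arrow_hom[OF assms]] by (simp_all add: cmp_def idn_def prod_eq_iff)

lemma ten_cmp:
  assumes "arrow p" "arrow p'" "arrow q" "arrow q'" "trg p = src p'" "trg q = src q'"
    "right_end (src p) = left_end (src q)"
  shows "ten (cmp p p') (cmp q q') = cmp (ten p q) (ten p' q')"
proof -
  note d = arrowD[OF assms(1)] arrowD[OF assms(3)]
  have e: "left_end (src p') = left_end (src p)" "right_end (src p') = right_end (src p)" "leaves (src p') = leaves (src p)"
    "left_end (src q') = left_end (src q)" "right_end (src q') = right_end (src q)" "leaves (src q') = leaves (src q)"
    using d assms(5,6) by simp_all
  note p = arrow_hom[OF assms(1)] and q = arrow_hom[OF assms(3), folded assms(7)]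
  note p' = arrow_hom[OF assms(2), unfolded e, folded assms(5)] and q' = arrow_hom[OF assms(4), unfolded e, folded assms(6) assms(7)]
  note m = hom3_id[OF mult_arrow_hom[OF d(1,7) assms(7)], folded assms(7)]
  show ?thesis
    unfolding cmp_def ten_def
    using exchange3_02[OF p p' q q'] exchange3_12[OF hom3_comp0[OF p q] hom3_comp0[OF p' q'] m m] unit3(5)[OF m]
    by (simp add: e)
qed

lemma ten_idn:
  assumes "typed C (Node X Y)"
  shows "ten (idn X) (idn Y) = idn (Node X Y)"
proof -
  have t: "typed C X" "typed C Y" "right_end X = left_end Y" using assms by auto
  note x = realize_hom[OF t(1)] and y = realize_hom[OF t(2), folded t(3)]
  note m = mult_arrow_hom[OF t, folded t(3)]
  show ?thesis
    unfolding idn_def ten_def using id_comp2(2)[OF hom2_comp0[OF x y] m] id_comp2(1)[OF x y] by simp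
qed

lemma node_node_left3:
  assumes "arrow p" "arrow q" "arrow r" "right_end (src p) = left_end (src q)" "right_end (src q) = left_end (src r)"
  shows "cell (ten (ten p q) r) = (cell p \<odot>\<^sub>0 cell q \<odot>\<^sub>0 cell r) \<odot>\<^sub>1
    \<iota> (csrc K (\<alpha> (left_end (src p)) (right_end (src p)) (right_end (src q)) (right_end (src r))))"
proof -
  note d = arrowD[OF assms(1)] arrowD[OF assms(2)] arrowD[OF assms(3)]
  note e = typed_ends[OF d(1)] typed_ends[OF d(7)] typed_ends[OF d(13)]
  note x = arrow_hom[OF assms(1)] and y = arrow_hom[OF assms(2), folded assms(4)] and z = arrow_hom[OF assms(3), folded assms(5)]
  let ?a = "left_end (src p)" and ?b = "right_end (src p)" and ?c = "right_end (src q)" and ?d = "right_end (src r)"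
  have c: "?a \<in> C" "?b \<in> C" "?c \<in> C" "?d \<in> C" using e by auto
  note m = mult[OF c(1-3)] mult[OF c(1,3,4)]
  note ie = hom2_id[OF edge[OF c(3,4)]]
  note M = hom3_id[OF m(1)] hom3_id[OF m(2)] hom3_id[OF ie]
  have "((cell p \<odot>\<^sub>0 cell q) \<odot>\<^sub>1 \<iota> (mult ?a ?b ?c)) \<odot>\<^sub>0 cell r =
      ((cell p \<odot>\<^sub>0 cell q) \<odot>\<^sub>0 cell r) \<odot>\<^sub>1 (\<iota> (mult ?a ?b ?c) \<odot>\<^sub>0 \<iota> (\<iota> (edge ?c ?d)))"
    using exchange3_01[OF hom3_comp0[OF x y] M(1) z M(3)] unit3(4)[OF z] by simp
  moreover have "(((cell p \<odot>\<^sub>0 cell q) \<odot>\<^sub>0 cell r) \<odot>\<^sub>1 (\<iota> (mult ?a ?b ?c) \<odot>\<^sub>0 \<iota> (\<iota> (edge ?c ?d)))) \<odot>\<^sub>1 \<iota> (mult ?a ?c ?d)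
     = ((cell p \<odot>\<^sub>0 cell q) \<odot>\<^sub>0 cell r) \<odot>\<^sub>1 (\<iota> (mult ?a ?b ?c) \<odot>\<^sub>0 \<iota> (\<iota> (edge ?c ?d))) \<odot>\<^sub>1 \<iota> (mult ?a ?c ?d)"
    by (rule assoc3(2)[OF hom3_comp0[OF hom3_comp0[OF x y] z] hom3_comp0[OF M(1,3)] M(2)])
  moreover have "\<iota> (csrc K (\<alpha> ?a ?b ?c ?d)) = (\<iota> (mult ?a ?b ?c) \<odot>\<^sub>0 \<iota> (\<iota> (edge ?c ?d))) \<odot>\<^sub>1 \<iota> (mult ?a ?c ?d)"
    using \<alpha>[OF c] id_comp2(2)[OF hom2_comp0[OF m(1) ie] m(2)] id_comp2(1)[OF m(1) ie] by simp
  ultimately show ?thesis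
    using assoc3(1)[OF x y z] by (simp add: ten_def)
qed

lemma node_node_right3:
  assumes "arrow p" "arrow q" "arrow r" "right_end (src p) = left_end (src q)" "right_end (src q) = left_end (src r)"
  shows "cell (ten p (ten q r)) = (cell p \<odot>\<^sub>0 cell q \<odot>\<^sub>0 cell r) \<odot>\<^sub>1
    \<iota> (ctgt K (\<alpha> (left_end (src p)) (right_end (src p)) (right_end (src q)) (right_end (src r))))"
proof -
  note d = arrowD[OF assms(1)] arrowD[OF assms(2)] arrowD[OF assms(3)]
  note e = typed_ends[OF d(1)] typed_ends[OF d(7)] typed_ends[OF d(13)]
  note x = arrow_hom[OF assms(1)] and y = arrow_hom[OF assms(2), folded assms(4)] and z = arrow_hom[OF assms(3), folded assms(5)]
  let ?a = "left_end (src p)" and ?b = "right_end (src p)" and ?c = "right_end (src q)" and ?d = "right_end (src r)"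
  have c: "?a \<in> C" "?b \<in> C" "?c \<in> C" "?d \<in> C" using e by auto
  note m = mult[OF c(2-4)] mult[OF c(1,2,4)]
  note ie = hom2_id[OF edge[OF c(1,2)]]
  note M = hom3_id[OF m(1)] hom3_id[OF m(2)] hom3_id[OF ie]
  have "cell p \<odot>\<^sub>0 ((cell q \<odot>\<^sub>0 cell r) \<odot>\<^sub>1 \<iota> (mult ?b ?c ?d)) =
      (cell p \<odot>\<^sub>0 cell q \<odot>\<^sub>0 cell r) \<odot>\<^sub>1 (\<iota> (\<iota> (edge ?a ?b)) \<odot>\<^sub>0 \<iota> (mult ?b ?c ?d))"
    using exchange3_01[OF x M(3) hom3_comp0[OF y z] M(1)] unit3(4)[OF x] by simp
  moreover have "((cell p \<odot>\<^sub>0 cell q \<odot>\<^sub>0 cell r) \<odot>\<^sub>1 (\<iota> (\<iota> (edge ?a ?b)) \<odot>\<^sub>0 \<iota> (mult ?b ?c ?d))) \<odot>\<^sub>1 \<iota> (mult ?a ?b ?d)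
     = (cell p \<odot>\<^sub>0 cell q \<odot>\<^sub>0 cell r) \<odot>\<^sub>1 (\<iota> (\<iota> (edge ?a ?b)) \<odot>\<^sub>0 \<iota> (mult ?b ?c ?d)) \<odot>\<^sub>1 \<iota> (mult ?a ?b ?d)"
    by (rule assoc3(2)[OF hom3_comp0[OF x hom3_comp0[OF y z]] hom3_comp0[OF M(3,1)] M(2)])
  moreover have "\<iota> (ctgt K (\<alpha> ?a ?b ?c ?d)) = (\<iota> (\<iota> (edge ?a ?b)) \<odot>\<^sub>0 \<iota> (mult ?b ?c ?d)) \<odot>\<^sub>1 \<iota> (mult ?a ?b ?d)"
    using \<alpha>[OF c] id_comp2(2)[OF hom2_comp0[OF ie m(1)] m(2)] id_comp2(1)[OF ie m(1)] by simp
  ultimately show ?thesis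
    using assms(4) by (simp add: ten_def)
qed

lemma node_unit_left3:
  assumes "arrow p"
  shows "cell (ten (idn (Unit (left_end (src p)))) p) =
    cell p \<odot>\<^sub>1 \<iota> (csrc K (\<l> (left_end (src p)) (right_end (src p))))"
proof -
  let ?a = "left_end (src p)" and ?b = "right_end (src p)"
  note d = arrowD[OF assms]
  have c: "?a \<in> C" "?b \<in> C" using typed_ends[OF d(1)] by auto
  note x = arrow_hom[OF assms] and m = mult[OF c(1,1,2)] and ie = hom2_id[OF edge[OF c]] and u = uni[OF c(1)]
  note M = hom3_id[OF m] hom3_id[OF ie] hom3_id[OF u]
  note ii = hom3_id[OF hom2_id[OF hom1_id[OF ob[OF c(1)]]]]
  have "\<iota> (uni ?a) \<odot>\<^sub>0 cell p = cell p \<odot>\<^sub>1 (\<iota> (uni ?a) \<odot>\<^sub>0 \<iota> (\<iota> (edge ?a ?b)))"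
    using exchange3_01[OF ii M(3) x M(2)] unit3(4)[OF x] unit3(3)[OF M(3)] unit3(1)[OF x] by simp
  moreover have "\<iota> (csrc K (\<l> ?a ?b)) = (\<iota> (uni ?a) \<odot>\<^sub>0 \<iota> (\<iota> (edge ?a ?b))) \<odot>\<^sub>1 \<iota> (mult ?a ?a ?b)"
    using \<l>[OF c] id_comp2(2)[OF hom2_comp0[OF u ie] m] id_comp2(1)[OF u ie] by simp
  ultimately show ?thesis
    using assoc3(2)[OF x _ M(1)] hom3_comp0[OF M(3,2)] unit1(1)[OF edge[OF c]]
    by (simp add: ten_def idn_def)
qed

lemma node_unit_right3:
  assumes "arrow p"
  shows "cell (ten p (idn (Unit (right_end (src p))))) =
    cell p \<odot>\<^sub>1 \<iota> (csrc K (\<r> (left_end (src p)) (right_end (src p))))"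
proof -
  let ?a = "left_end (src p)" and ?b = "right_end (src p)"
  note d = arrowD[OF assms]
  have c: "?a \<in> C" "?b \<in> C" using typed_ends[OF d(1)] by auto
  note x = arrow_hom[OF assms] and m = mult[OF c(1,2,2)] and ie = hom2_id[OF edge[OF c]] and u = uni[OF c(2)]
  note M = hom3_id[OF m] hom3_id[OF ie] hom3_id[OF u]
  note ii = hom3_id[OF hom2_id[OF hom1_id[OF ob[OF c(2)]]]]
  have "cell p \<odot>\<^sub>0 \<iota> (uni ?b) = cell p \<odot>\<^sub>1 (\<iota> (\<iota> (edge ?a ?b)) \<odot>\<^sub>0 \<iota> (uni ?b))"
    using exchange3_01[OF x M(2) ii M(3)] unit3(4)[OF x] unit3(3)[OF M(3)] unit3(2)[OF x] by simp
  moreover have "\<iota> (csrc K (\<r> ?a ?b)) = (\<iota> (\<iota> (edge ?a ?b)) \<odot>\<^sub>0 \<iota> (uni ?b)) \<odot>\<^sub>1 \<iota> (mult ?a ?b ?b)"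
    using \<r>[OF c] id_comp2(2)[OF hom2_comp0[OF ie u] m] id_comp2(1)[OF ie u] by simp
  ultimately show ?thesis
    using assoc3(2)[OF x _ M(1)] hom3_comp0[OF M(2,3)] unit1(2)[OF edge[OF c]]
    by (simp add: ten_def idn_def)
qed

text \<open>Both sides are the composite along 1-cells of
  \<open>cell p \<odot>\<^sub>0 cell q \<odot>\<^sub>0 cell r\<close> with \<alpha>, factored in the
  two orders of \<open>slide12\<close>.\<close>

lemma assr_natural:
  assumes "arrow p" "arrow q" "arrow r" "right_end (src p) = left_end (src q)" "right_end (src q) = left_end (src r)"
  shows "cmp (ten (ten p q) r) (assr (trg p) (trg q) (trg r)) =
    cmp (assr (src p) (src q) (src r)) (ten p (ten q r))"
proof -
  note d = arrowD[OF assms(1)] arrowD[OF assms(2)] arrowD[OF assms(3)]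
  note h = hom3_comp0[OF arrow_hom[OF assms(1)] hom3_comp0[OF arrow_hom[OF assms(2), folded assms(4)]
        arrow_hom[OF assms(3), folded assms(5)]]]
  have "typed C (Node (Node (src p) (src q)) (src r))" using d assms by simp
  note s = slide12[OF h \<alpha>_hom_typed[OF this]]
  show ?thesis
    using s node_node_left3[OF assms] node_node_right3[OF assms] d
    by (simp add: prod_eq_iff) (simp add: cmp_def assr_def)
qed

text \<open>As for the associator, except that the target of \<open>\<l>\<close> is an identity
  2-cell, so that the last factor on the right collapses to \<open>p\<close> itself.\<close>

lemma lun_natural:
  assumes "arrow p"
  shows "cmp (ten (idn (Unit (left_end (src p)))) p) (lun (trg p)) = cmp (lun (src p)) p"
proof -
  note d = arrowD[OF assms]
  note s = slide12[OF arrow_hom[OF assms] \<l>_hom_typed[OF d(1)]]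
  show ?thesis
    using s node_unit_left3[OF assms] d unit3(4)[OF arrow_hom[OF assms]]
    by (simp add: prod_eq_iff) (simp add: cmp_def lun_def)
qed

lemma run_natural:
  assumes "arrow p"
  shows "cmp (ten p (idn (Unit (right_end (src p))))) (run (trg p)) = cmp (run (src p)) p"
proof -
  note d = arrowD[OF assms]
  note s = slide12[OF arrow_hom[OF assms] \<r>_hom_typed[OF d(1)]]
  show ?thesis
    using s node_unit_right3[OF assms] d unit3(4)[OF arrow_hom[OF assms]]
    by (simp add: prod_eq_iff) (simp add: cmp_def run_def)
qed

end

section \<open>Whiskering and generated 3-cells\<close>

context bicat_cells
begin

text \<open>Whiskering by a forest on the side of the leaves. It commutes with all operations and
  sends the constraints at given trees to the constraints at the grafted trees; therefore it
  suffices to know the pentagon and the triangle at leaves.\<close>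

definition whisker :: "'a tree list \<Rightarrow> ('a, 'c) arrow \<Rightarrow> ('a, 'c) arrow" where
  "whisker Ys p = (graft (src p) Ys, graft (trg p) Ys, \<iota> (forest (left_end (src p)) Ys) \<odot>\<^sub>1 cell p)"

lemma src_trg_whisker [simp]: "src (whisker Ys p) = graft (src p) Ys" "trg (whisker Ys p) = graft (trg p) Ys"
  by (simp_all add: whisker_def)

lemma arrow_whisker:
  assumes "arrow p" "fits C Ys (leaves (src p))"
  shows "arrow (whisker Ys p)"
proof -
  note d = arrowD[OF assms(1)]
  have f: "fits C Ys (leaves (trg p))" using assms d by simp
  note g = fits_graft[OF d(1) assms(2)] fits_graft[OF d(2) f]
  note h = hom3_comp1[OF hom3_id[OF fits_hom[OF d(1) assms(2)]] arrow_hom[OF assms(1)]]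
  show ?thesis
    unfolding whisker_def using h forest_graft[OF d(1) assms(2)] forest_graft[OF d(2) f] d g
    by (intro arrowI[where A = "_ \<odot>\<^sub>1 _"]) auto
qed

lemma whisker_idn:
  assumes "typed C X" "fits C Ys (leaves X)"
  shows "whisker Ys (idn X) = idn (graft X Ys)"
  using id_comp2(2)[OF fits_hom[OF assms] realize_hom[OF assms(1)]] forest_graft[OF assms]
  by (simp add: whisker_def idn_def)

lemma whisker_cmp:
  assumes "arrow p" "arrow q" "trg p = src q" "fits C Ys (leaves (src p))"
  shows "whisker Ys (cmp p q) = cmp (whisker Ys p) (whisker Ys q)"
proof -
  note d = arrowD[OF assms(1)]
  have e: "left_end (src q) = left_end (src p)" "right_end (src q) = right_end (src p)" "leaves (src q) = leaves (src p)"
    using d assms(3) by simp_all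
  note p = arrow_hom[OF assms(1)] and q = arrow_hom[OF assms(2), unfolded e, folded assms(3)]
  note F = hom3_id[OF fits_hom[OF d(1) assms(4)]]
  show ?thesis
    using exchange3_12[OF F F p q] unit3(5)[OF F] by (simp add: whisker_def cmp_def e)
qed

lemma whisker_ten:
  assumes "arrow p" "arrow q" "right_end (src p) = left_end (src q)"
    "fits C Y1 (leaves (src p))" "fits C Y2 (leaves (src q))"
  shows "whisker (Y1 @ Y2) (ten p q) = ten (whisker Y1 p) (whisker Y2 q)"
proof -
  note d = arrowD[OF assms(1)] arrowD[OF assms(2)]
  note p = arrow_hom[OF assms(1)] and q = arrow_hom[OF assms(2), folded assms(3)]
  note m = hom3_id[OF mult_arrow_hom[OF d(1,7) assms(3)], folded assms(3)]
  note f1 = fits_hom[OF d(1) assms(4)] and f2 = fits_hom[OF d(7) assms(5), folded assms(3)]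
  note F = hom3_id[OF f1] hom3_id[OF f2]
  have "forest (left_end (src p)) (Y1 @ Y2) = forest (left_end (src p)) Y1 \<odot>\<^sub>0 forest (right_end (src p)) Y2"
    using fits_forest[OF d(1) assms(4)] fits_forest[OF d(7) assms(5)] assms(3) by (intro forest_append) auto
  then have "\<iota> (forest (left_end (src p)) (Y1 @ Y2)) = \<iota> (forest (left_end (src p)) Y1) \<odot>\<^sub>0 \<iota> (forest (right_end (src p)) Y2)"
    using id_comp2(1)[OF f1 f2] by simp
  moreover have "length Y1 = length (leaves (src p))" "length Y1 = length (leaves (trg p))"
    using fits_length[OF assms(4)] d by simp_all
  moreover note fits_graft[OF d(1) assms(4)] fits_graft[OF d(7) assms(5)]
    assoc3(2)[OF hom3_comp0[OF F] hom3_comp0[OF p q] m]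
    exchange3_01[OF F(1) p F(2) q]
  ultimately show ?thesis
    by (simp add: whisker_def ten_def assms(3))
qed

text \<open>The constraint absorbs the forests because it is defined with an identity factor in
  front of \<alpha>: by the exchange law only this factor changes, and it changes by
  grafting.\<close>

lemma whisker_assr:
  assumes "typed C (Node (Node X Y) Z)" "fits C X1 (leaves X)" "fits C Y1 (leaves Y)" "fits C Z1 (leaves Z)"
  shows "whisker (X1 @ Y1 @ Z1) (assr X Y Z) = assr (graft X X1) (graft Y Y1) (graft Z Z1)"
proof -
  have t: "typed C X" "typed C Y" "typed C Z" "right_end X = left_end Y" "right_end Y = left_end Z"
    using assms by auto
  note r = realize_hom[OF t(1)] realize_hom[OF t(2), folded t(4)] realize_hom[OF t(3), folded t(5)]
  note f = fits_hom[OF t(1) assms(2)] fits_hom[OF t(2) assms(3), folded t(4)] fits_hom[OF t(3) assms(4), folded t(5)]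
  note f' = fits_forest[OF t(1) assms(2)] fits_forest[OF t(2) assms(3), folded t(4)] fits_forest[OF t(3) assms(4), folded t(5)]
  have fYZ: "is_forest C (right_end X) (Y1 @ Z1) (right_end Z)"
    unfolding is_forest_append using f' by auto
  have "forest (left_end X) (X1 @ Y1 @ Z1) = forest (left_end X) X1 \<odot>\<^sub>0 forest (right_end X) Y1 \<odot>\<^sub>0 forest (right_end Y) Z1"
    using forest_append[OF f'(1) fYZ] forest_append[OF f'(2,3)] by simp
  then have "forest (left_end X) (X1 @ Y1 @ Z1) \<odot>\<^sub>1 (realize X \<odot>\<^sub>0 realize Y \<odot>\<^sub>0 realize Z) =
      (forest (left_end X) X1 \<odot>\<^sub>1 realize X) \<odot>\<^sub>0 (forest (right_end X) Y1 \<odot>\<^sub>1 realize Y) \<odot>\<^sub>0 (forest (right_end Y) Z1 \<odot>\<^sub>1 realize Z)"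
    using exchange2[OF f(1) r(1) hom2_comp0[OF f(2,3)] hom2_comp0[OF r(2,3)]] exchange2[OF f(2) r(2) f(3) r(3)] by simp
  also have "\<dots> = realize (graft X X1) \<odot>\<^sub>0 realize (graft Y Y1) \<odot>\<^sub>0 realize (graft Z Z1)"
    using forest_graft[OF t(1) assms(2)] forest_graft[OF t(2) assms(3)] forest_graft[OF t(3) assms(4)] t(4,5) by simp
  finally have e: "forest (left_end X) (X1 @ Y1 @ Z1) \<odot>\<^sub>1 (realize X \<odot>\<^sub>0 realize Y \<odot>\<^sub>0 realize Z) = \<dots>" .
  have F: "hom2 (ob (left_end X)) (ob (right_end Z)) (path (left_end X) (forest_leaves (X1 @ Y1 @ Z1)))
     (path (left_end X) (leaves X) \<odot>\<^sub>0 path (right_end X) (leaves Y) \<odot>\<^sub>0 path (right_end Y) (leaves Z)) (forest (left_end X) (X1 @ Y1 @ Z1))"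
  proof -
    have "is_forest C (left_end X) (X1 @ Y1 @ Z1) (right_end Z)"
      using f'(1) fYZ is_forest_append[of C "left_end X" X1 "Y1 @ Z1"] by blast
    moreover have "is_path C (right_end X) (leaves Y @ leaves Z) (right_end Z)"
      unfolding is_path_append
      using typed_is_path[OF t(2), folded t(4)] typed_is_path[OF t(3), folded t(5)] by blast
    ultimately show ?thesis
      using forest_hom[of "left_end X" "X1 @ Y1 @ Z1" "right_end Z"] assms(2-4)
        path_append[OF typed_is_path[OF t(1)], of "leaves Y @ leaves Z" "right_end Z"]
        path_append[OF typed_is_path[OF t(2), folded t(4)] typed_is_path[OF t(3), folded t(5)]]
      by (simp add: fits_def)
  qed
  have "\<iota> (forest (left_end X) (X1 @ Y1 @ Z1)) \<odot>\<^sub>1 \<iota> (realize X \<odot>\<^sub>0 realize Y \<odot>\<^sub>0 realize Z) =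
      \<iota> (realize (graft X X1) \<odot>\<^sub>0 realize (graft Y Y1) \<odot>\<^sub>0 realize (graft Z Z1))"
    using id_comp2(2)[OF F realize3_hom[OF assms(1)]] e by simp
  then show ?thesis
    using fits_graft[OF t(1) assms(2)] fits_graft[OF t(2) assms(3)] fits_graft[OF t(3) assms(4)]
      fits_length[OF assms(2)] fits_length[OF assms(3)]
      assoc3(2)[OF hom3_id[OF F] hom3_id[OF realize3_hom[OF assms(1)]] \<alpha>_hom_typed[OF assms(1)]]
    by (simp add: whisker_def assr_def)
qed

lemma whisker_lun:
  assumes "typed C X" "fits C Ys (leaves X)"
  shows "whisker Ys (lun X) = lun (graft X Ys)"
  using assoc3(2)[OF hom3_id[OF fits_hom[OF assms]] hom3_id[OF realize_hom[OF assms(1)]] \<l>_hom_typed[OF assms(1)]]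
    id_comp2(2)[OF fits_hom[OF assms] realize_hom[OF assms(1)]] forest_graft[OF assms] fits_graft[OF assms]
  by (simp add: whisker_def lun_def)

lemma whisker_run:
  assumes "typed C X" "fits C Ys (leaves X)"
  shows "whisker Ys (run X) = run (graft X Ys)"
  using assoc3(2)[OF hom3_id[OF fits_hom[OF assms]] hom3_id[OF realize_hom[OF assms(1)]] \<r>_hom_typed[OF assms(1)]]
    id_comp2(2)[OF fits_hom[OF assms] realize_hom[OF assms(1)]] forest_graft[OF assms] fits_graft[OF assms]
    fits_length[OF assms(2)]
  by (simp add: whisker_def run_def)

inductive generated :: "bool \<Rightarrow> ('a, 'c) arrow \<Rightarrow> bool" for v where
  gen_idn: "typed C X \<Longrightarrow> generated v (idn X)"
| gen_cmp: "generated v p \<Longrightarrow> generated v q \<Longrightarrow> trg p = src q \<Longrightarrow> generated v (cmp p q)"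
| gen_ten: "generated v p \<Longrightarrow> generated v q \<Longrightarrow> right_end (src p) = left_end (src q) \<Longrightarrow> generated v (ten p q)"
| gen_assr: "typed C (Node (Node X Y) Z) \<Longrightarrow> generated v (assr X Y Z)"
| gen_lun: "typed C X \<Longrightarrow> generated v (lun X)"
| gen_run: "typed C X \<Longrightarrow> generated v (run X)"
| gen_inv: "v \<Longrightarrow> generated v p \<Longrightarrow> arrow q \<Longrightarrow> src q = trg p \<Longrightarrow> trg q = src p \<Longrightarrow>
    cmp p q = idn (src p) \<Longrightarrow> cmp q p = idn (trg p) \<Longrightarrow> generated v q"

lemma generated_arrow: "generated v p \<Longrightarrow> arrow p"
  by (induction rule: generated.induct)
    (auto intro: arrow_idn arrow_cmp arrow_ten arrow_assr arrow_lun arrow_run)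

lemma generated_whisker:
  assumes "generated v p" "fits C Ys (leaves (src p))"
  shows "generated v (whisker Ys p)"
  using assms
proof (induction arbitrary: Ys rule: generated.induct)
  case (gen_idn X)
  then show ?case by (simp add: whisker_idn fits_graft generated.gen_idn)
next
  case (gen_cmp p q)
  note d = arrowD[OF generated_arrow[OF gen_cmp.hyps(1)]]
  have "fits C Ys (leaves (src q))" using gen_cmp.prems gen_cmp.hyps(3) d(6) by simp
  then show ?case
    using gen_cmp by (simp add: whisker_cmp generated_arrow generated.gen_cmp)
next
  case (gen_ten p q)
  obtain Y1 Y2 where Y: "Ys = Y1 @ Y2" "fits C Y1 (leaves (src p))" "fits C Y2 (leaves (src q))"
    using gen_ten.prems by (auto simp: fits_append)
  note a = generated_arrow[OF gen_ten.hyps(1)] generated_arrow[OF gen_ten.hyps(2)]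
  show ?case
    unfolding Y(1) whisker_ten[OF a gen_ten.hyps(3) Y(2,3)]
    using gen_ten.IH Y gen_ten.hyps(3) fits_graft[OF arrowD(1)[OF a(1)] Y(2)] fits_graft[OF arrowD(1)[OF a(2)] Y(3)]
    by (intro generated.gen_ten) simp_all
next
  case (gen_assr X Y Z)
  then obtain X1 Y1 Z1 where Y: "Ys = X1 @ Y1 @ Z1" "fits C X1 (leaves X)" "fits C Y1 (leaves Y)" "fits C Z1 (leaves Z)"
    by (auto simp: fits_append)
  show ?case
    unfolding Y(1) whisker_assr[OF gen_assr.hyps Y(2-4)] using gen_assr.hyps Y
    by (intro generated.gen_assr) (auto simp: fits_graft)
next
  case (gen_lun X)
  then show ?case by (simp add: whisker_lun fits_graft generated.gen_lun)
next
  case (gen_run X)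
  then have "fits C Ys (leaves X)" by simp
  then show ?case using gen_run.hyps by (simp add: whisker_run fits_graft generated.gen_run)
next
  case (gen_inv p q)
  note a = generated_arrow[OF gen_inv.hyps(2)]
  note d = arrowD[OF a]
  have f: "fits C Ys (leaves (src p))" using gen_inv.prems gen_inv.hyps(4) d(6) by simp
  show ?case
  proof (rule generated.gen_inv[OF gen_inv.hyps(1) gen_inv.IH[OF f]])
    show "arrow (whisker Ys q)" using gen_inv by (intro arrow_whisker)
    show "cmp (whisker Ys p) (whisker Ys q) = idn (src (whisker Ys p))"
      using whisker_cmp[OF a gen_inv.hyps(3) _ f] gen_inv.hyps(4-6) whisker_idn[OF d(1) f] by simp
    show "cmp (whisker Ys q) (whisker Ys p) = idn (trg (whisker Ys p))"
      using whisker_cmp[OF gen_inv.hyps(3) a _ gen_inv.prems] gen_inv.hyps(4,5,7) whisker_idn[OF d(2)] f d(6) by simp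
  qed (simp_all add: gen_inv.hyps)
qed

section \<open>Lists of arrows, composed along objects\<close>

primrec forest3 :: "'a \<Rightarrow> ('a, 'c) arrow list \<Rightarrow> 'c" where
  "forest3 a [] = \<iota> (\<iota> (\<iota> (ob a)))"
| "forest3 a (p # ps) = cell p \<odot>\<^sub>0 forest3 (right_end (src p)) ps"

abbreviation srcs where "srcs \<equiv> map (\<lambda>p :: ('a, 'c) arrow. src p)"
abbreviation trgs where "trgs \<equiv> map (\<lambda>p :: ('a, 'c) arrow. trg p)"

lemma roots_trgs: "\<forall>p\<in>set ps. arrow p \<Longrightarrow> roots (trgs ps) = roots (srcs ps)"
  by (induction ps) (auto dest: arrowD)

lemma leaves_trgs: "\<forall>p\<in>set ps. arrow p \<Longrightarrow> forest_leaves (trgs ps) = forest_leaves (srcs ps)"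
  by (induction ps) (auto dest: arrowD)

lemma typed_trgs: "\<forall>p\<in>set ps. arrow p \<Longrightarrow> \<forall>X\<in>set (trgs ps). typed C X"
  by (auto dest: arrowD)

lemma typed_srcs: "\<forall>p\<in>set ps. arrow p \<Longrightarrow> \<forall>X\<in>set (srcs ps). typed C X"
  by (auto dest: arrowD)

lemma forest_trgs: "\<forall>p\<in>set ps. arrow p \<Longrightarrow> is_forest C a (srcs ps) b \<Longrightarrow> is_forest C a (trgs ps) b"
  unfolding is_forest_def using roots_trgs[of ps] typed_trgs[of ps] by (simp only: simp_thms)

lemma forest3_hom:
  "\<forall>p\<in>set ps. arrow p \<Longrightarrow> is_forest C a (srcs ps) b \<Longrightarrow>
    hom3 (ob a) (ob b) (path a (forest_leaves (srcs ps))) (path a (roots (srcs ps)))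
      (forest a (srcs ps)) (forest a (trgs ps)) (forest3 a ps)"
proof (induction ps arbitrary: a)
  case Nil
  then show ?case using hom3_id[OF hom2_id[OF hom1_id[OF ob]]] by auto
next
  case (Cons p ps)
  have t: "left_end (src p) = a" "is_forest C (right_end (src p)) (srcs ps) b" using Cons.prems by auto
  have p: "arrow p" "\<forall>p\<in>set ps. arrow p" using Cons.prems by auto
  note d = arrowD[OF p(1)]
  show ?case
    using hom3_comp0[OF arrow_hom[OF p(1)] Cons.IH[OF p(2) t(2)]] t(1) d
      path_append[OF typed_is_path[OF d(1)] is_forest_leaves[OF t(2)]]
    by simp
qed

lemma forest3_append:
  "\<forall>p\<in>set ps. arrow p \<Longrightarrow> \<forall>p\<in>set qs. arrow p \<Longrightarrow> is_forest C a (srcs ps) b \<Longrightarrow> is_forest C b (srcs qs) c \<Longrightarrow>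
    forest3 a (ps @ qs) = forest3 a ps \<odot>\<^sub>0 forest3 b qs"
proof (induction ps arbitrary: a)
  case Nil
  then show ?case using unit3(1)[OF forest3_hom[of qs b c]] by auto
next
  case (Cons p ps)
  have t: "left_end (src p) = a" "is_forest C (right_end (src p)) (srcs ps) b" using Cons.prems by auto
  have p: "arrow p" "\<forall>p\<in>set ps. arrow p" using Cons.prems by auto
  show ?case
    using Cons.IH[OF p(2) Cons.prems(2) t(2) Cons.prems(4)]
      assoc3(1)[OF arrow_hom[OF p(1)] forest3_hom[OF p(2) t(2)] forest3_hom[OF Cons.prems(2,4)]]
    by simp
qed

lemma forest3_idn:
  "is_forest C a Xs b \<Longrightarrow> forest3 a (map idn Xs) = \<iota> (forest a Xs)"
proof (induction Xs arbitrary: a)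
  case (Cons X Xs)
  have t: "left_end X = a" "typed C X" "is_forest C (right_end X) Xs b" using Cons.prems by auto
  show ?case
    using Cons.IH[OF t(3)] id_comp2(1)[OF realize_hom[OF t(2)] forest_hom[OF t(3)]] by (simp add: idn_def)
qed simp

lemma forest3_cmp:
  assumes "length ps = length qs" "\<forall>p\<in>set ps. arrow p" "\<forall>p\<in>set qs. arrow p"
    "is_forest C a (srcs ps) b" "trgs ps = srcs qs"
  shows "forest3 a (map2 cmp ps qs) = forest3 a ps \<odot>\<^sub>2 forest3 a qs"
  using assms
proof (induction ps qs arbitrary: a rule: list_induct2)
  case Nil
  then have "a \<in> C" by auto
  then show ?case using unit3(5)[OF hom3_id[OF hom2_id[OF hom1_id[OF ob]]]] by simp
next
  case (Cons p ps q qs)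
  have t: "left_end (src p) = a" "is_forest C (right_end (src p)) (srcs ps) b" using Cons.prems by auto
  have p: "arrow p" "\<forall>p\<in>set ps. arrow p" "arrow q" "\<forall>p\<in>set qs. arrow p" "trg p = src q" "trgs ps = srcs qs"
    using Cons.prems by auto
  note d = arrowD[OF p(1)]
  have e: "left_end (src q) = left_end (src p)" "right_end (src q) = right_end (src p)" "leaves (src q) = leaves (src p)"
    using d p(5) by simp_all
  have f: "is_forest C (right_end (src p)) (srcs qs) b"
    using forest_trgs[OF p(2) t(2)] p(6) by simp
  have h: "forest_leaves (srcs qs) = forest_leaves (srcs ps)" "roots (srcs qs) = roots (srcs ps)"
    using leaves_trgs[OF p(2)] roots_trgs[OF p(2)] p(6) by simp_all
  have "(cell p \<odot>\<^sub>2 cell q) \<odot>\<^sub>0 (forest3 (right_end (src p)) ps \<odot>\<^sub>2 forest3 (right_end (src p)) qs) =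
      (cell p \<odot>\<^sub>0 forest3 (right_end (src p)) ps) \<odot>\<^sub>2 (cell q \<odot>\<^sub>0 forest3 (right_end (src p)) qs)"
    by (rule exchange3_02[OF arrow_hom[OF p(1)] arrow_hom[OF p(3), unfolded e, folded p(5)]
          forest3_hom[OF p(2) t(2)] forest3_hom[OF p(4) f, unfolded h, folded p(6)]])
  then show ?case
    using Cons.IH[OF p(2,4) t(2) p(6)] e by (simp add: cmp_def)
qed

lemma forest3_fits_hom:
  assumes "typed C X" "\<forall>p\<in>set ps. arrow p" "roots (srcs ps) = leaves X"
  shows "fits C (srcs ps) (leaves X)" "fits C (trgs ps) (leaves X)"
    "is_forest C (left_end X) (srcs ps) (right_end X)"
    "hom3 (ob (left_end X)) (ob (right_end X)) (path (left_end X) (forest_leaves (srcs ps)))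
       (path (left_end X) (leaves X)) (forest (left_end X) (srcs ps)) (forest (left_end X) (trgs ps))
       (forest3 (left_end X) ps)"
proof -
  show s: "fits C (srcs ps) (leaves X)" "fits C (trgs ps) (leaves X)"
    using assms typed_srcs[of ps] typed_trgs[of ps] roots_trgs[of ps] by (auto simp: fits_def)
  show f: "is_forest C (left_end X) (srcs ps) (right_end X)" by (rule fits_forest[OF assms(1) s(1)])
  show "hom3 (ob (left_end X)) (ob (right_end X)) (path (left_end X) (forest_leaves (srcs ps)))
       (path (left_end X) (leaves X)) (forest (left_end X) (srcs ps)) (forest (left_end X) (trgs ps))
       (forest3 (left_end X) ps)"
    using forest3_hom[OF assms(2) f] assms(3) by simp
qed

text \<open>Whiskering on the side of the root: the arrows act at the leaves of \<open>X\<close>,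
  and each node of \<open>X\<close> contributes one \<open>ten\<close>.\<close>

lemma generated_graft:
  assumes "typed C X" "\<forall>p\<in>set ps. generated v p" "roots (srcs ps) = leaves X"
  shows "generated v (graft X (srcs ps), graft X (trgs ps), forest3 (left_end X) ps \<odot>\<^sub>1 \<iota> (realize X))"
  using assms
proof (induction X arbitrary: ps)
  case (Leaf a b)
  then obtain p where p: "ps = [p]" "generated v p" "left_end (src p) = a" "right_end (src p) = b"
    by (cases ps) (auto simp: root_def)
  note h = arrow_hom[OF generated_arrow[OF p(2)]]
  show ?case using p unit3(2,4)[OF h] by simp
next
  case (Unit a)
  then show ?case using unit3(3)[OF hom3_id[OF uni]] gen_idn[of "Unit a" v] by (simp add: idn_def)
next
  case (Node X X')
  have t: "typed C X" "typed C X'" "right_end X = left_end X'" using Node.prems by auto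
  have "map (\<lambda>p. root (src p)) ps = leaves X @ leaves X'" using Node.prems(3) by (simp add: comp_def)
  then obtain qs rs where ps: "ps = qs @ rs" "roots (srcs qs) = leaves X" "roots (srcs rs) = leaves X'"
    by (auto simp: map_eq_append_conv comp_def)
  have g: "\<forall>p\<in>set qs. generated v p" "\<forall>p\<in>set rs. generated v p" using Node.prems ps by auto
  then have a: "\<forall>p\<in>set qs. arrow p" "\<forall>p\<in>set rs. arrow p" using generated_arrow by auto
  note q = forest3_fits_hom[OF t(1) a(1) ps(2)] and r = forest3_fits_hom[OF t(2) a(2) ps(3), folded t(3)]
  note x = realize_hom[OF t(1)] and x' = realize_hom[OF t(2), folded t(3)]
  note m = mult_arrow_hom[OF t, folded t(3)]
  let ?F = "forest3 (left_end X) qs" and ?G = "forest3 (right_end X) rs"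
  have F: "forest3 (left_end X) ps = ?F \<odot>\<^sub>0 ?G"
    unfolding ps(1) by (rule forest3_append[OF a q(3) r(3)])
  have "forest3 (left_end X) ps \<odot>\<^sub>1 \<iota> (realize (Node X X')) =
      ((?F \<odot>\<^sub>0 ?G) \<odot>\<^sub>1 (\<iota> (realize X) \<odot>\<^sub>0 \<iota> (realize X'))) \<odot>\<^sub>1 \<iota> (mult (left_end X) (right_end X) (right_end X'))"
    unfolding F using assoc3(2)[OF hom3_comp0[OF q(4) r(4)] hom3_comp0[OF hom3_id[OF x] hom3_id[OF x']] hom3_id[OF m]]
      id_comp2(2)[OF hom2_comp0[OF x x'] m] id_comp2(1)[OF x x'] by simp
  also have "(?F \<odot>\<^sub>0 ?G) \<odot>\<^sub>1 (\<iota> (realize X) \<odot>\<^sub>0 \<iota> (realize X')) = (?F \<odot>\<^sub>1 \<iota> (realize X)) \<odot>\<^sub>0 (?G \<odot>\<^sub>1 \<iota> (realize X'))"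
    by (rule exchange3_01[OF q(4) hom3_id[OF x] r(4) hom3_id[OF x'], symmetric])
  finally have e: "forest3 (left_end X) ps \<odot>\<^sub>1 \<iota> (realize (Node X X')) =
     ((?F \<odot>\<^sub>1 \<iota> (realize X)) \<odot>\<^sub>0 (?G \<odot>\<^sub>1 \<iota> (realize X'))) \<odot>\<^sub>1 \<iota> (mult (left_end X) (right_end X) (right_end X'))" .
  note gr = fits_graft[OF t(1) q(1)] fits_graft[OF t(2) r(1)]
  have "generated v (ten (graft X (srcs qs), graft X (trgs qs), ?F \<odot>\<^sub>1 \<iota> (realize X))
      (graft X' (srcs rs), graft X' (trgs rs), ?G \<odot>\<^sub>1 \<iota> (realize X')))"
    using Node.IH(1)[OF t(1) g(1) ps(2)] Node.IH(2)[OF t(2) g(2) ps(3)] gr t(3)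
    by (intro gen_ten) simp_all
  then show ?case
    using e ps fits_length[OF q(1)] fits_length[OF q(2)] gr by (simp add: ten_def)
qed

text \<open>Composition along 1-cells is not among the generating operations. By
  \<open>slide12\<close> it is expressed through them: the first factor acts on the leaves of the
  source trees of the second, and then the second acts, whiskered by the target trees of the
  first.\<close>

lemma forest3_comp1:
  assumes "\<forall>p\<in>set ps. generated v p" "\<forall>q\<in>set qs. generated v q"
    "is_forest C a (srcs qs) b" "roots (srcs ps) = forest_leaves (srcs qs)"
  shows "\<exists>rs. (\<forall>r\<in>set rs. generated v r) \<and> srcs rs = graft_forest (srcs qs) (srcs ps) \<and>
    trgs rs = graft_forest (trgs qs) (trgs ps) \<and> forest3 a ps \<odot>\<^sub>1 forest3 a qs = forest3 a rs"
  using assms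
proof (induction qs arbitrary: a ps)
  case Nil
  then show ?case using unit3(4)[OF hom3_id[OF hom2_id[OF hom1_id[OF ob[of a]]]]] by (intro exI[of _ "[]"]) auto
next
  case (Cons q qs)
  have t: "left_end (src q) = a" "is_forest C (right_end (src q)) (srcs qs) b" using Cons.prems by auto
  have "map (\<lambda>p. root (src p)) ps = leaves (src q) @ forest_leaves (srcs qs)"
    using Cons.prems(4) by (simp add: comp_def)
  then obtain p1 p2 where ps: "ps = p1 @ p2" "roots (srcs p1) = leaves (src q)" "roots (srcs p2) = forest_leaves (srcs qs)"
    by (auto simp: map_eq_append_conv comp_def)
  have g: "\<forall>p\<in>set p1. generated v p" "\<forall>p\<in>set p2. generated v p" "generated v q" "\<forall>p\<in>set qs. generated v p"
    using Cons.prems ps by auto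
  have a: "\<forall>p\<in>set p1. arrow p" "\<forall>p\<in>set p2. arrow p" "arrow q" "\<forall>p\<in>set qs. arrow p"
    using g generated_arrow by auto
  note d = arrowD[OF a(3)]
  obtain rs where rs: "\<forall>r\<in>set rs. generated v r" "srcs rs = graft_forest (srcs qs) (srcs p2)"
    "trgs rs = graft_forest (trgs qs) (trgs p2)"
    "forest3 (right_end (src q)) p2 \<odot>\<^sub>1 forest3 (right_end (src q)) qs = forest3 (right_end (src q)) rs"
    using Cons.IH[OF g(2,4) t(2) ps(3)] by blast
  note p1 = forest3_fits_hom[OF d(1) a(1) ps(2)]
  have f2: "is_forest C (right_end (src q)) (srcs p2) b"
    using typed_srcs[OF a(2)] is_forest_leaves[OF t(2)] ps(3) by (simp add: is_forest_def)
  note h2 = forest3_hom[OF a(2) f2, unfolded ps(3)] and hq = forest3_hom[OF a(4) t(2)]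
  let ?F = "forest3 (left_end (src q)) p1"
  let ?r = "cmp (graft (src q) (srcs p1), graft (src q) (trgs p1), ?F \<odot>\<^sub>1 \<iota> (realize (src q))) (whisker (trgs p1) q)"
  have gr: "generated v ?r"
    using generated_graft[OF d(1) g(1) ps(2)] generated_whisker[OF g(3) p1(2)] by (intro gen_cmp) simp_all
  have "cell ?r = ?F \<odot>\<^sub>1 cell q"
    using slide12(1)[OF p1(4) arrow_hom[OF a(3)]] by (simp add: cmp_def whisker_def)
  moreover have "forest3 a ps = ?F \<odot>\<^sub>0 forest3 (right_end (src q)) p2"
    using forest3_append[OF a(1,2) p1(3) f2] ps(1) t(1) by simp
  moreover note exchange3_01[OF p1(4) arrow_hom[OF a(3)] h2 hq]
  moreover have "right_end (src ?r) = right_end (src q)" using fits_graft(3)[OF d(1) p1(1)] by simp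
  ultimately have "forest3 a ps \<odot>\<^sub>1 forest3 a (q # qs) = forest3 a (?r # rs)"
    using rs(4) t(1) by simp
  moreover have "srcs (?r # rs) = graft_forest (srcs (q # qs)) (srcs ps)"
    "trgs (?r # rs) = graft_forest (trgs (q # qs)) (trgs ps)"
    using rs ps fits_length[OF p1(1)] d(6) by simp_all
  ultimately show ?case using gr rs(1) by (intro exI[of _ "?r # rs"]) simp
qed

text \<open>Leaves realize as identities on 1-cells, so the identity factors disappear and the
  generators themselves are recovered.\<close>

lemma leaf_cells:
  assumes "a \<in> C" "b \<in> C" "c \<in> C" "d \<in> C"
  shows "realize (Node (Leaf a b) (Leaf b c)) = mult a b c"
    "cell (assr (Leaf a b) (Leaf b c) (Leaf c d)) = \<alpha> a b c d"
    "cell (lun (Leaf a b)) = \<l> a b" "cell (run (Leaf a b)) = \<r> a b"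
proof -
  note e = edge[OF assms(1,2)] edge[OF assms(2,3)] edge[OF assms(3,4)]
  show "realize (Node (Leaf a b) (Leaf b c)) = mult a b c"
    using unit2(3)[OF mult[OF assms(1-3)]] id_comp1[OF e(1,2)] by simp
  show "cell (assr (Leaf a b) (Leaf b c) (Leaf c d)) = \<alpha> a b c d"
    using unit3(3)[OF \<alpha>_hom[OF assms]] id_comp1[OF e(1) hom1_comp[OF e(2,3)]] id_comp1[OF e(2,3)]
    by (simp add: assr_def)
  show "cell (lun (Leaf a b)) = \<l> a b" "cell (run (Leaf a b)) = \<r> a b"
    using unit3(3)[OF \<l>_hom[OF assms(1,2)]] unit3(3)[OF \<r>_hom[OF assms(1,2)]] by (simp_all add: lun_def run_def)
qed

end

section \<open>Passing to the quotient by 4-cells\<close>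

text \<open>The relation abstracts the existence of a connecting 4-cell. Its pentagon and triangle
  are bracketed in the way in which the boundaries of \<open>G_pi\<close> and \<open>G_kappa\<close>
  unfold.\<close>

locale coherent_cells = bicat_cells n K C ob edge mult uni \<alpha> \<l> \<r>
  for n :: nat and K :: "('c, 'k) cat_data_scheme"
    and C :: "'a set" and ob edge mult uni \<alpha> \<l> \<r> +
  fixes eqv :: "'c \<Rightarrow> 'c \<Rightarrow> bool" (infix "\<approx>" 50)
  assumes eqv_refl: "A \<in> cells K 3 \<Longrightarrow> A \<approx> A"
    and eqv_sym: "A \<approx> B \<Longrightarrow> B \<approx> A"
    and eqv_trans: "A \<approx> B \<Longrightarrow> B \<approx> D \<Longrightarrow> A \<approx> D"
    and eqv_parallel: "A \<approx> B \<Longrightarrow> parallel K 3 A B"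
    and eqv_comp: "A \<approx> A' \<Longrightarrow> B \<approx> B' \<Longrightarrow> composable K 3 i A B \<Longrightarrow> ccomp K i A B \<approx> ccomp K i A' B'"
    and invertible3: "A \<in> cells K 3 \<Longrightarrow> invertible_cell K 2 A"
    and pentagon: "a \<in> C \<Longrightarrow> b \<in> C \<Longrightarrow> c \<in> C \<Longrightarrow> d \<in> C \<Longrightarrow> e \<in> C \<Longrightarrow>
      (((\<alpha> a b c d \<odot>\<^sub>0 \<iota> (\<iota> (edge d e))) \<odot>\<^sub>1 \<iota> (mult a d e)) \<odot>\<^sub>2
       (\<iota> ((\<iota> (edge a b) \<odot>\<^sub>0 mult b c d) \<odot>\<^sub>0 \<iota> (edge d e)) \<odot>\<^sub>1 \<alpha> a b d e)) \<odot>\<^sub>2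
       ((\<iota> (\<iota> (edge a b)) \<odot>\<^sub>0 \<alpha> b c d e) \<odot>\<^sub>1 \<iota> (mult a b e)) \<approx>
      (\<iota> ((mult a b c \<odot>\<^sub>0 \<iota> (edge c d)) \<odot>\<^sub>0 \<iota> (edge d e)) \<odot>\<^sub>1 \<alpha> a c d e) \<odot>\<^sub>2
      (\<iota> (\<iota> (edge a b \<odot>\<^sub>0 edge b c) \<odot>\<^sub>0 mult c d e) \<odot>\<^sub>1 \<alpha> a b c e)"
    and triangle: "a \<in> C \<Longrightarrow> b \<in> C \<Longrightarrow> c \<in> C \<Longrightarrow>
      (\<iota> ((\<iota> (edge a b) \<odot>\<^sub>0 uni b) \<odot>\<^sub>0 \<iota> (edge b c)) \<odot>\<^sub>1 \<alpha> a b b c) \<odot>\<^sub>2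
      ((\<iota> (\<iota> (edge a b)) \<odot>\<^sub>0 \<l> b c) \<odot>\<^sub>1 \<iota> (mult a b c)) \<approx>
      (\<r> a b \<odot>\<^sub>0 \<iota> (\<iota> (edge b c))) \<odot>\<^sub>1 \<iota> (mult a b c)"
begin

definition arrow_eqv :: "('a, 'c) arrow \<Rightarrow> ('a, 'c) arrow \<Rightarrow> bool" where
  "arrow_eqv p q \<longleftrightarrow> src p = src q \<and> trg p = trg q \<and> cell p \<approx> cell q"

text \<open>The quotient is carried by chosen representatives, so that equivalent arrows become
  equal while staying in the same type; the trees are kept and only the 3-cell is replaced.\<close>

definition rep :: "('a, 'c) arrow \<Rightarrow> ('a, 'c) arrow" where
  "rep p = (src p, trg p, SOME A. cell p \<approx> A)"

lemma src_trg_rep [simp]: "src (rep p) = src p" "trg (rep p) = trg p"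
  by (simp_all add: rep_def)

lemma arrow_cell: "arrow p \<Longrightarrow> cell p \<in> cells K 3"
  by (simp add: arrow_def)

lemma arrow_eqv_rep: "arrow p \<Longrightarrow> arrow_eqv p (rep p)"
  using someI[of "\<lambda>A. cell p \<approx> A", OF eqv_refl[OF arrow_cell]] by (simp add: arrow_eqv_def rep_def)

lemma arrow_eqv_arrow: "arrow_eqv p q \<Longrightarrow> arrow p \<Longrightarrow> arrow q"
  using eqv_parallel[of "cell p" "cell q"] by (auto simp: arrow_eqv_def arrow_def parallel_def)

lemma arrow_rep [simp]: "arrow p \<Longrightarrow> arrow (rep p)"
  using arrow_eqv_arrow arrow_eqv_rep by blast

lemma rep_eqI: "arrow_eqv p q \<Longrightarrow> rep p = rep q"
proof -
  assume e: "arrow_eqv p q"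
  then have "(\<lambda>A. cell p \<approx> A) = (\<lambda>A. cell q \<approx> A)"
    using eqv_sym eqv_trans unfolding arrow_eqv_def by blast
  then show ?thesis using e by (simp add: rep_def arrow_eqv_def)
qed

lemma rep_rep [simp]: "arrow p \<Longrightarrow> rep (rep p) = rep p"
  using rep_eqI[OF arrow_eqv_rep] by simp

lemma rep_eqD: "arrow p \<Longrightarrow> arrow q \<Longrightarrow> rep p = rep q \<Longrightarrow> arrow_eqv p q"
  using arrow_eqv_rep[of p] arrow_eqv_rep[of q] eqv_sym eqv_trans unfolding arrow_eqv_def by metis

lemma arrow_eqv_refl: "arrow p \<Longrightarrow> arrow_eqv p p"
  by (simp add: arrow_eqv_def eqv_refl arrow_cell)

lemma arrow_eqv_cmp:
  assumes "arrow p" "arrow q" "trg p = src q" "arrow_eqv p p'" "arrow_eqv q q'"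
  shows "arrow_eqv (cmp p q) (cmp p' q')"
proof -
  have "composable K 3 2 (cell p) (cell q)"
    using assms(1-3) by (simp add: arrow_def composable_def at_unfold)
  from eqv_comp[OF _ _ this] show ?thesis
    using assms(4,5) by (simp add: arrow_eqv_def cmp_def)
qed

lemma arrow_eqv_ten:
  assumes "arrow p" "arrow q" "right_end (src p) = left_end (src q)" "arrow_eqv p p'" "arrow_eqv q q'"
  shows "arrow_eqv (ten p q) (ten p' q')"
proof -
  note d = arrowD(1)[OF assms(1)] arrowD(1)[OF assms(2)]
  note h = arrow_hom[OF assms(1)] arrow_hom[OF assms(2), folded assms(3)]
  note m = hom3_id[OF mult_arrow_hom[OF d assms(3)], folded assms(3)]
  have "cell p \<odot>\<^sub>0 cell q \<approx> cell p' \<odot>\<^sub>0 cell q'"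
    using assms(4,5) by (intro eqv_comp composable3(1)[OF h]) (auto simp: arrow_eqv_def)
  then show ?thesis
    using eqv_comp[OF _ eqv_refl composable3(2)[OF hom3_comp0[OF h] m]] m assms(4,5)
    by (simp add: arrow_eqv_def ten_def hom3_def)
qed

lemma arrow_eqv_whisker:
  assumes "arrow p" "fits C Ys (leaves (src p))" "arrow_eqv p q"
  shows "arrow_eqv (whisker Ys p) (whisker Ys q)"
proof -
  note h = hom3_id[OF fits_hom[OF arrowD(1)[OF assms(1)] assms(2)]]
  have "\<iota> (forest (left_end (src p)) Ys) \<odot>\<^sub>1 cell p \<approx> \<iota> (forest (left_end (src p)) Ys) \<odot>\<^sub>1 cell q"
    using assms(3) h eqv_refl by (intro eqv_comp composable3(2)[OF h arrow_hom[OF assms(1)]])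
      (auto simp: arrow_eqv_def hom3_def)
  then show ?thesis using assms(3) by (simp add: arrow_eqv_def whisker_def)
qed

text \<open>At four leaves this is the hypothesis on \<open>K\<close>; whiskering with
  \<open>[X, Y, Z, W]\<close> transports it to arbitrary trees.\<close>

lemma arrow_pentagon:
  assumes "typed C (Node (Node (Node X Y) Z) W)"
  shows "arrow_eqv (cmp (ten (assr X Y Z) (idn W)) (cmp (assr X (Node Y Z) W) (ten (idn X) (assr Y Z W))))
    (cmp (assr (Node X Y) Z W) (assr X Y (Node Z W)))"
proof -
  have t: "typed C X" "typed C Y" "typed C Z" "typed C W"
    "right_end X = left_end Y" "right_end Y = left_end Z" "right_end Z = left_end W" using assms by auto
  define a b c d e where "a = left_end X" "b = left_end Y" "c = left_end Z" "d = left_end W" "e = right_end W"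
  note ends = this[symmetric] and abcde = this
  have r: "right_end X = b" "right_end Y = c" "right_end Z = d" using t abcde by auto
  have C: "a \<in> C" "b \<in> C" "c \<in> C" "d \<in> C" "e \<in> C"
    using typed_ends[OF t(1)] typed_ends[OF t(2)] typed_ends[OF t(3)] typed_ends[OF t(4)] ends by auto
  let ?X = "Leaf a b" and ?Y = "Leaf b c" and ?Z = "Leaf c d" and ?W = "Leaf d e"
  note e = edge[OF C(1,2)] edge[OF C(2,3)] edge[OF C(3,4)] edge[OF C(4,5)]
  note ie = hom2_id[OF e(1)] hom2_id[OF e(2)] hom2_id[OF e(3)] hom2_id[OF e(4)]
  note ll = leaf_cells(1)[OF C(1-4)] leaf_cells(1)[OF C(2-5)] leaf_cells(1)[OF C(3,4,5,5)]
    leaf_cells(2)[OF C(1-4)] leaf_cells(2)[OF C(2-5)]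
  let ?A1 = "ten (assr ?X ?Y ?Z) (idn ?W)" and ?A2 = "assr ?X (Node ?Y ?Z) ?W" and ?A3 = "ten (idn ?X) (assr ?Y ?Z ?W)"
  let ?B1 = "assr (Node ?X ?Y) ?Z ?W" and ?B2 = "assr ?X ?Y (Node ?Z ?W)"
  have arr: "arrow ?A1" "arrow ?A2" "arrow ?A3" "arrow ?B1" "arrow ?B2" "arrow (assr ?X ?Y ?Z)" "arrow (assr ?Y ?Z ?W)" "arrow (idn ?X)" "arrow (idn ?W)"
    using C by (auto intro!: arrow_ten arrow_assr arrow_idn)
  have arrc: "arrow (cmp ?A1 (cmp ?A2 ?A3))" "arrow (cmp ?A2 ?A3)" "arrow (cmp ?B1 ?B2)"
    using arr by (auto intro!: arrow_cmp)
  \<comment> \<open>\<open>assr\<close> brackets its three factors to the right, the boundary of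
    \<open>G_pi\<close> to the left; associativity and the compatibility of identities with
    composition mediate.\<close>
  have cA: "cell ?A1 = (\<alpha> a b c d \<odot>\<^sub>0 \<iota> (\<iota> (edge d e))) \<odot>\<^sub>1 \<iota> (mult a d e)"
    "cell ?A2 = \<iota> ((\<iota> (edge a b) \<odot>\<^sub>0 mult b c d) \<odot>\<^sub>0 \<iota> (edge d e)) \<odot>\<^sub>1 \<alpha> a b d e"
    "cell ?A3 = (\<iota> (\<iota> (edge a b)) \<odot>\<^sub>0 \<alpha> b c d e) \<odot>\<^sub>1 \<iota> (mult a b e)"
    "cell ?B1 = \<iota> ((mult a b c \<odot>\<^sub>0 \<iota> (edge c d)) \<odot>\<^sub>0 \<iota> (edge d e)) \<odot>\<^sub>1 \<alpha> a c d e"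
    "cell ?B2 = \<iota> (\<iota> (edge a b \<odot>\<^sub>0 edge b c) \<odot>\<^sub>0 mult c d e) \<odot>\<^sub>1 \<alpha> a b c e"
  proof -
    show "cell ?A1 = (\<alpha> a b c d \<odot>\<^sub>0 \<iota> (\<iota> (edge d e))) \<odot>\<^sub>1 \<iota> (mult a d e)"
      using ll(4) by (simp add: ten_def idn_def)
    show "cell ?A2 = \<iota> ((\<iota> (edge a b) \<odot>\<^sub>0 mult b c d) \<odot>\<^sub>0 \<iota> (edge d e)) \<odot>\<^sub>1 \<alpha> a b d e"
      using leaf_cells(1)[OF C(2-5)] assoc2(1)[OF ie(1) mult[OF C(2-4)] ie(4)]
      by (simp add: assr_def del: realize.simps(3))
    show "cell ?A3 = (\<iota> (\<iota> (edge a b)) \<odot>\<^sub>0 \<alpha> b c d e) \<odot>\<^sub>1 \<iota> (mult a b e)"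
      using ll(5) by (simp add: ten_def idn_def)
    show "cell ?B1 = \<iota> ((mult a b c \<odot>\<^sub>0 \<iota> (edge c d)) \<odot>\<^sub>0 \<iota> (edge d e)) \<odot>\<^sub>1 \<alpha> a c d e"
      using leaf_cells(1)[OF C(1-4)] assoc2(1)[OF mult[OF C(1-3)] ie(3,4)]
      by (simp add: assr_def del: realize.simps(3))
    show "cell ?B2 = \<iota> (\<iota> (edge a b \<odot>\<^sub>0 edge b c) \<odot>\<^sub>0 mult c d e) \<odot>\<^sub>1 \<alpha> a b c e"
      using leaf_cells(1)[OF C(3,4,5,5)] assoc2(1)[OF ie(1,2) mult[OF C(3-5)]] id_comp1[OF e(1,2)]
      by (simp add: assr_def del: realize.simps(3))
  qed
  \<comment> \<open>The source of \<open>G_pi\<close> is bracketed to the left, the pentagon of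
    \<open>tree_bicategory\<close> to the right.\<close>
  have "cmp (cmp ?A1 ?A2) ?A3 = cmp ?A1 (cmp ?A2 ?A3)"
    using arr by (intro cmp_assoc) simp_all
  moreover have "arrow_eqv (cmp (cmp ?A1 ?A2) ?A3) (cmp ?B1 ?B2)"
    unfolding arrow_eqv_def using pentagon[OF C] cA by (simp add: cmp_def)
  ultimately have eq: "arrow_eqv (cmp ?A1 (cmp ?A2 ?A3)) (cmp ?B1 ?B2)" by simp
  have f: "fits C [X, Y, Z, W] (leaves (src (cmp ?A1 (cmp ?A2 ?A3))))"
    "fits C [X, Y, Z, W] (leaves (src ?A2))" "fits C [X, Y, Z, W] (leaves (src ?B1))"
    using t ends r by (auto simp: root_def)
  have f': "fits C [X] (leaves ?X)" "fits C [Y] (leaves ?Y)" "fits C [Z] (leaves ?Z)" "fits C [W] (leaves ?W)"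
    "fits C [X, Y] (leaves (Node ?X ?Y))" "fits C [Y, Z] (leaves (Node ?Y ?Z))" "fits C [Z, W] (leaves (Node ?Z ?W))"
    "fits C [X, Y, Z] (leaves (src (assr ?X ?Y ?Z)))" "fits C [Y, Z, W] (leaves (src (assr ?Y ?Z ?W)))"
    using t ends r by (auto simp: root_def)
  have w1: "whisker [X, Y, Z] (assr ?X ?Y ?Z) = assr X Y Z" "whisker [Y, Z, W] (assr ?Y ?Z ?W) = assr Y Z W"
    using whisker_assr[OF _ f'(1,2,3)] whisker_assr[OF _ f'(2,3,4)] C by simp_all
  have w2: "whisker [X] (idn ?X) = idn X" "whisker [W] (idn ?W) = idn W"
    using whisker_idn[OF _ f'(1)] whisker_idn[OF _ f'(4)] C by simp_all
  have w: "whisker [X, Y, Z, W] ?A1 = ten (assr X Y Z) (idn W)"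
    "whisker [X, Y, Z, W] ?A2 = assr X (Node Y Z) W"
    "whisker [X, Y, Z, W] ?A3 = ten (idn X) (assr Y Z W)"
    "whisker [X, Y, Z, W] ?B1 = assr (Node X Y) Z W"
    "whisker [X, Y, Z, W] ?B2 = assr X Y (Node Z W)"
    using whisker_ten[OF arr(6,9) _ f'(8)] whisker_ten[OF arr(8,7) _ _ f'(9), of "[X]"] f' w1 w2
      whisker_assr[OF _ f'(1,6,4)] whisker_assr[OF _ f'(5,3,4)] whisker_assr[OF _ f'(1,2,7)] C
    by simp_all
  have "whisker [X, Y, Z, W] (cmp ?A1 (cmp ?A2 ?A3)) =
      cmp (ten (assr X Y Z) (idn W)) (cmp (assr X (Node Y Z) W) (ten (idn X) (assr Y Z W)))"
    using whisker_cmp[OF arr(1) arrc(2)] whisker_cmp[OF arr(2,3)] f w by simp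
  moreover have "whisker [X, Y, Z, W] (cmp ?B1 ?B2) = cmp (assr (Node X Y) Z W) (assr X Y (Node Z W))"
    using whisker_cmp[OF arr(4,5)] f w by simp
  ultimately show ?thesis
    using arrow_eqv_whisker[OF arrc(1) f(1) eq] by simp
qed

text \<open>The same transport from leaves, now with \<open>[X, Y]\<close>; the unit in the middle
  has no leaves and receives the empty forest.\<close>

lemma arrow_triangle:
  assumes "typed C (Node X Y)"
  shows "arrow_eqv (cmp (assr X (Unit (right_end X)) Y) (ten (idn X) (lun Y))) (ten (run X) (idn Y))"
proof -
  have t: "typed C X" "typed C Y" "right_end X = left_end Y" using assms by auto
  define a b c where "a = left_end X" "b = left_end Y" "c = right_end Y"
  note ends = this[symmetric]
  have C: "a \<in> C" "b \<in> C" "c \<in> C"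
    using typed_ends[OF t(1)] typed_ends[OF t(2)] ends by auto
  let ?X = "Leaf a b" and ?Y = "Leaf b c"
  note e = edge[OF C(1,2)] edge[OF C(2,3)]
  note ie = hom2_id[OF e(1)] hom2_id[OF e(2)]
  let ?A1 = "assr ?X (Unit b) ?Y" and ?A2 = "ten (idn ?X) (lun ?Y)" and ?B = "ten (run ?X) (idn ?Y)"
  have arr: "arrow ?A1" "arrow ?A2" "arrow ?B" "arrow (idn ?X)" "arrow (idn ?Y)" "arrow (lun ?Y)" "arrow (run ?X)"
    using C by (auto intro!: arrow_ten arrow_assr arrow_idn arrow_lun arrow_run)
  have arrc: "arrow (cmp ?A1 ?A2)" using arr by (auto intro!: arrow_cmp)
  have "cell ?A1 = \<iota> ((\<iota> (edge a b) \<odot>\<^sub>0 uni b) \<odot>\<^sub>0 \<iota> (edge b c)) \<odot>\<^sub>1 \<alpha> a b b c"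
    using assoc2(1)[OF ie(1) uni[OF C(2)] ie(2)] by (simp add: assr_def)
  moreover have "cell ?A2 = (\<iota> (\<iota> (edge a b)) \<odot>\<^sub>0 \<l> b c) \<odot>\<^sub>1 \<iota> (mult a b c)"
    using leaf_cells(3)[OF C(2,3)] C by (simp add: ten_def idn_def)
  moreover have "cell ?B = (\<r> a b \<odot>\<^sub>0 \<iota> (\<iota> (edge b c))) \<odot>\<^sub>1 \<iota> (mult a b c)"
    using leaf_cells(4)[OF C(1,2)] C by (simp add: ten_def idn_def)
  ultimately have eq: "arrow_eqv (cmp ?A1 ?A2) ?B"
    unfolding arrow_eqv_def using triangle[OF C] by (simp add: cmp_def)
  have f: "fits C [X, Y] (leaves (src (cmp ?A1 ?A2)))" "fits C [X, Y] (leaves (src ?A1))"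
    "fits C [X] (leaves ?X)" "fits C [Y] (leaves ?Y)" "fits C [] (leaves (Unit b))"
    "fits C [X] (leaves (src (run ?X)))" "fits C [Y] (leaves (src (lun ?Y)))"
    using t ends by (auto simp: root_def)
  have w1: "whisker [X] (idn ?X) = idn X" "whisker [Y] (idn ?Y) = idn Y" "whisker [Y] (lun ?Y) = lun Y" "whisker [X] (run ?X) = run X"
    using whisker_idn[OF _ f(3)] whisker_idn[OF _ f(4)] whisker_lun[OF _ f(4)] whisker_run[OF _ f(3)] C by simp_all
  have w: "whisker [X, Y] ?A1 = assr X (Unit b) Y" "whisker [X, Y] ?A2 = ten (idn X) (lun Y)"
    "whisker [X, Y] ?B = ten (run X) (idn Y)"
    using whisker_ten[OF arr(4,6) _ _ f(7), of "[X]"] whisker_ten[OF arr(7,5) _ f(6), of "[Y]"] f w1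
      whisker_assr[OF _ f(3,5,4)] C
    by simp_all
  have "whisker [X, Y] (cmp ?A1 ?A2) = cmp (assr X (Unit b) Y) (ten (idn X) (lun Y))"
    using whisker_cmp[OF arr(1,2)] f w by simp
  then show ?thesis
    using arrow_eqv_whisker[OF arrc f(1) eq] w(3) t(3) ends by simp
qed

text \<open>As simplification rules, these equations and \<open>rep_ten\<close> remove inner
  representatives, so that each axiom of the quotient reduces to a statement about arrows.\<close>

lemma rep_cmp [simp]:
  assumes "arrow p" "arrow q" "trg p = src q"
  shows "rep (cmp (rep p) q) = rep (cmp p q)" "rep (cmp p (rep q)) = rep (cmp p q)"
  using assms arrow_eqv_cmp[OF assms arrow_eqv_rep arrow_eqv_refl] arrow_eqv_cmp[OF assms arrow_eqv_refl arrow_eqv_rep]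
  by (metis rep_eqI)+

lemma rep_ten [simp]:
  assumes "arrow p" "arrow q" "right_end (src p) = left_end (src q)"
  shows "rep (ten (rep p) q) = rep (ten p q)" "rep (ten p (rep q)) = rep (ten p q)"
  using assms arrow_eqv_ten[OF assms arrow_eqv_rep arrow_eqv_refl] arrow_eqv_ten[OF assms arrow_eqv_refl arrow_eqv_rep]
  by (metis rep_eqI)+

lemma arrow_inverse:
  assumes "arrow p"
  shows "\<exists>q. arrow q \<and> src q = trg p \<and> trg q = src p \<and> cmp p q = idn (src p) \<and> cmp q p = idn (trg p)"
proof -
  obtain B where B: "composable K 3 2 (cell p) B" "composable K 3 2 B (cell p)"
    "cell p \<odot>\<^sub>2 B = \<iota> (csrc K (cell p))" "B \<odot>\<^sub>2 cell p = \<iota> (ctgt K (cell p))"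
    using invertible3[OF arrow_cell[OF assms]] by (auto simp: invertible_cell_def eval_nat_numeral)
  have "arrow (trg p, src p, B)"
    using assms B(1,2) by (auto simp: arrow_def composable_def at_unfold)
  moreover have "cmp p (trg p, src p, B) = idn (src p)" "cmp (trg p, src p, B) p = idn (trg p)"
    using B(3,4) assms by (simp_all add: cmp_def idn_def arrow_def)
  ultimately show ?thesis by (intro exI[of _ "(trg p, src p, B)"]) simp
qed

lemma rep_tree_bicategory:
  "tree_bicategory C (\<lambda>p. arrow p \<and> rep p = p) src (\<lambda>p. trg p) (\<lambda>X. rep (idn X)) (\<lambda>p q. rep (cmp p q))
    (\<lambda>p q. rep (ten p q)) (\<lambda>X Y Z. rep (assr X Y Z)) (\<lambda>X. rep (lun X)) (\<lambda>X. rep (run X))"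
proof -
  note [simp] = arrow_idn arrow_cmp arrow_ten arrow_assr arrow_lun arrow_run arrowD
  show ?thesis
  proof
    fix p assume p: "arrow p \<and> rep p = p"
    then obtain q where q: "arrow q" "src q = trg p" "trg q = src p" "cmp p q = idn (src p)" "cmp q p = idn (trg p)"
      using arrow_inverse by blast
    then show "\<exists>q. (arrow q \<and> rep q = q) \<and> src q = trg p \<and> trg q = src p \<and>
        rep (cmp p q) = rep (idn (src p)) \<and> rep (cmp q p) = rep (idn (trg p))"
      using p by (intro exI[of _ "rep q"]) simp
    show "rep (cmp (rep (ten (rep (idn (Unit (left_end (src p))))) p)) (rep (lun (trg p)))) =
        rep (cmp (rep (lun (src p))) p)"
      using p lun_natural[of p] typed_ends[of C "src p"] by simp
    show "rep (cmp (rep (ten p (rep (idn (Unit (right_end (src p))))))) (rep (run (trg p)))) =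
        rep (cmp (rep (run (src p))) p)"
      using p run_natural[of p] typed_ends[of C "src p"] by simp
  next
    fix X Y Z W assume "typed C (Node (Node (Node X Y) Z) W)"
    then show "rep (cmp (rep (ten (rep (assr X Y Z)) (rep (idn W)))) (rep (cmp (rep (assr X (Node Y Z) W)) (rep (ten (rep (idn X)) (rep (assr Y Z W))))))) =
        rep (cmp (rep (assr (Node X Y) Z W)) (rep (assr X Y (Node Z W))))"
      using rep_eqI[OF arrow_pentagon[of X Y Z W]] by simp
  next
    fix X Y assume "typed C (Node X Y)"
    then show "rep (cmp (rep (assr X (Unit (right_end X)) Y)) (rep (ten (rep (idn X)) (rep (lun Y))))) = rep (ten (rep (run X)) (rep (idn Y)))"
      using rep_eqI[OF arrow_triangle[of X Y]] typed_ends[of C X] by simp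
  next
    fix p q r
    assume "arrow p \<and> rep p = p" "arrow q \<and> rep q = q" "arrow r \<and> rep r = r"
      "right_end (src p) = left_end (src q)" "right_end (src q) = left_end (src r)"
    then show "rep (cmp (rep (ten (rep (ten p q)) r)) (rep (assr (trg p) (trg q) (trg r)))) =
       rep (cmp (rep (assr (src p) (src q) (src r))) (rep (ten p (rep (ten q r)))))"
      using assr_natural[of p q r] by simp
  next
    fix p p' q q'
    assume "arrow p \<and> rep p = p" "arrow p' \<and> rep p' = p'" "arrow q \<and> rep q = q" "arrow q' \<and> rep q' = q'"
      "trg p = src p'" "trg q = src q'" "right_end (src p) = left_end (src q)"
    then show "rep (ten (rep (cmp p p')) (rep (cmp q q'))) = rep (cmp (rep (ten p q)) (rep (ten p' q')))"
      using ten_cmp[of p p' q q'] arrowD(5)[of p] arrowD(4)[of q] by simp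
  qed (auto simp: cmp_assoc cmp_idn ten_idn)
qed

theorem generated_eqv:
  assumes "generated True p" "generated True q" "src p = src q" "trg p = trg q"
  shows "cell p \<approx> cell q"
proof -
  interpret M: tree_bicategory C "\<lambda>p. arrow p \<and> rep p = p" src "\<lambda>p. trg p" "\<lambda>X. rep (idn X)" "\<lambda>p q. rep (cmp p q)"
    "\<lambda>p q. rep (ten p q)" "\<lambda>X Y Z. rep (assr X Y Z)" "\<lambda>X. rep (lun X)" "\<lambda>X. rep (run X)"
    by (rule rep_tree_bicategory)
  have g: "M.generated (rep p)" if "generated True p" for p
    using that
  proof (induction rule: generated.induct)
    case (gen_cmp p q)
    then have "rep (cmp p q) = rep (cmp (rep p) (rep q))"
      using generated_arrow by simp
    then show ?case using M.gen_cmp[OF gen_cmp.IH] gen_cmp.hyps by simp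
  next
    case (gen_ten p q)
    then have "rep (ten p q) = rep (ten (rep p) (rep q))"
      using generated_arrow by simp
    then show ?case using M.gen_ten[OF gen_ten.IH] gen_ten.hyps by simp
  next
    case (gen_inv p q)
    then show ?case
      using generated_arrow by (intro M.gen_inv[OF gen_inv.IH]) simp_all
  qed (auto intro: M.generated.intros)
  have "rep p = rep q"
    using M.generated_unique[OF g[OF assms(1)] g[OF assms(2)]] assms(3,4) by simp
  then show ?thesis
    using rep_eqD generated_arrow assms(1,2) unfolding arrow_eqv_def by blast
qed

lemma forest3_eqv:
  assumes "\<forall>p\<in>set ps. generated True p" "\<forall>q\<in>set qs. generated True q" "srcs ps = srcs qs" "trgs ps = trgs qs"
    "is_forest C a (srcs ps) b"
  shows "forest3 a ps \<approx> forest3 a qs"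
  using assms
proof (induction ps arbitrary: a qs)
  case Nil
  then show ?case using hom3_id[OF hom2_id[OF hom1_id[OF ob[of a]]]] by (auto intro!: eqv_refl simp: hom3_def)
next
  case (Cons p ps)
  then obtain q qs' where q: "qs = q # qs'" by (cases qs) auto
  have t: "is_forest C (right_end (src p)) (srcs ps) b" using Cons.prems by auto
  have g: "\<forall>p\<in>set ps. arrow p" "arrow p"
    using Cons.prems(1) generated_arrow[of True p] generated_arrow[of True] by (simp, simp)
  have "composable K 3 0 (cell p) (forest3 (right_end (src p)) ps)"
    by (rule composable3(1)[OF arrow_hom[OF g(2)] forest3_hom[OF g(1) t]])
  moreover have "cell p \<approx> cell q" "forest3 (right_end (src p)) ps \<approx> forest3 (right_end (src p)) qs'"
    using Cons.prems q t by (auto intro!: generated_eqv Cons.IH)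
  ultimately show ?case using eqv_comp Cons.prems(3) q by simp
qed

end

section \<open>Interpreting terms by paths and forests\<close>

text \<open>Ends are read off syntactically, so that paths and forests can be typed by recursion on
  raw terms, before anything is known about well-formedness.\<close>

primrec gen_start :: "'a bicat_gen \<Rightarrow> 'a" where
  "gen_start (G_obj a) = a"
| "gen_start (G_e a b) = a"
| "gen_start (G_m a b c) = a"
| "gen_start (G_i a) = a"
| "gen_start (G_alpha a b c d) = a"
| "gen_start (G_lambda a b) = a"
| "gen_start (G_rho a b) = a"
| "gen_start (G_pi a b c d e) = a"
| "gen_start (G_kappa a b c) = a"

primrec gen_end :: "'a bicat_gen \<Rightarrow> 'a" where
  "gen_end (G_obj a) = a"
| "gen_end (G_e a b) = b"
| "gen_end (G_m a b c) = c"
| "gen_end (G_i a) = a"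
| "gen_end (G_alpha a b c d) = d"
| "gen_end (G_lambda a b) = b"
| "gen_end (G_rho a b) = b"
| "gen_end (G_pi a b c d e) = e"
| "gen_end (G_kappa a b c) = c"

primrec term_start :: "'a bicat_term \<Rightarrow> 'a" where
  "term_start (Gen g) = gen_start g"
| "term_start (GenInv g) = gen_start g"
| "term_start (Ident t) = term_start t"
| "term_start (Comp i t u) = term_start t"

primrec term_end :: "'a bicat_term \<Rightarrow> 'a" where
  "term_end (Gen g) = gen_end g"
| "term_end (GenInv g) = gen_end g"
| "term_end (Ident t) = term_end t"
| "term_end (Comp i t u) = term_end u"

text \<open>\<open>term_path\<close> is meaningful on 1-dimensional terms, \<open>term_forest\<close> on 2-dimensional ones.\<close>

primrec term_path :: "'a bicat_term \<Rightarrow> ('a \<times> 'a) list" where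
  "term_path (Gen g) = (case g of G_e a b \<Rightarrow> [(a, b)] | _ \<Rightarrow> [])"
| "term_path (GenInv g) = []"
| "term_path (Ident t) = []"
| "term_path (Comp i t u) = term_path t @ term_path u"

primrec term_forest :: "'a bicat_term \<Rightarrow> 'a tree list" where
  "term_forest (Gen g) = (case g of G_m a b c \<Rightarrow> [Node (Leaf a b) (Leaf b c)] | G_i a \<Rightarrow> [Unit a] | _ \<Rightarrow> [])"
| "term_forest (GenInv g) = []"
| "term_forest (Ident t) = map leaf (term_path t)"
| "term_forest (Comp i t u) =
    (if i = 0 then term_forest t @ term_forest u else graft_forest (term_forest u) (term_forest t))"

abbreviation bdim :: "'a bicat_term \<Rightarrow> nat" where "bdim \<equiv> term_dim bicat_dim"

text \<open>A version of well-formedness of terms of dimension at most 2 by structural recursion: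
  composability is compared on the interpretations instead of on the boundaries.\<close>

primrec well_matched :: "'a set \<Rightarrow> 'a bicat_term \<Rightarrow> bool" where
  "well_matched C (Gen g) \<longleftrightarrow> set_bicat_gen g \<subseteq> C"
| "well_matched C (GenInv g) \<longleftrightarrow> 2 < bicat_dim g"
| "well_matched C (Ident t) \<longleftrightarrow> well_matched C t"
| "well_matched C (Comp i t u) \<longleftrightarrow> well_matched C t \<and> well_matched C u \<and> bdim t = bdim u \<and> i < bdim t \<and>
    (bdim t \<le> 2 \<longrightarrow> (if i = 0 then term_end t = term_start u
      else term_start t = term_start u \<and> term_end t = term_end u \<and>
        roots (term_forest t) = forest_leaves (term_forest u)))"

text \<open>This invariant and \<open>good2\<close> tie the interpretation of a term to its formal
  boundary terms, on which \<open>wf_term\<close> tests composability.\<close>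

definition good1 :: "'a set \<Rightarrow> 'a bicat_term \<Rightarrow> bool" where
  "good1 C t \<longleftrightarrow> bdim t = 1 \<and> is_path C (term_start t) (term_path t) (term_end t) \<and>
    tsrc (BiCat C) t = t_obj (term_start t) \<and> ttgt (BiCat C) t = t_obj (term_end t)"

definition good2 :: "'a set \<Rightarrow> 'a bicat_term \<Rightarrow> bool" where
  "good2 C t \<longleftrightarrow> bdim t = 2 \<and> is_forest C (term_start t) (term_forest t) (term_end t) \<and>
    good1 C (tsrc (BiCat C) t) \<and> good1 C (ttgt (BiCat C) t) \<and>
    term_path (tsrc (BiCat C) t) = forest_leaves (term_forest t) \<and>
    term_path (ttgt (BiCat C) t) = roots (term_forest t) \<and>
    term_start (tsrc (BiCat C) t) = term_start t \<and> term_start (ttgt (BiCat C) t) = term_start t \<and>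
    term_end (tsrc (BiCat C) t) = term_end t \<and> term_end (ttgt (BiCat C) t) = term_end t"

lemma is_forest_leaf: "is_path C a es b \<Longrightarrow> is_forest C a (map leaf es) b"
  by (induction es arbitrary: a) (auto dest: is_path_ends)

lemma map_leaf_simps [simp]: "concat (map (leaves \<circ> leaf) es) = es" "map (root \<circ> leaf) es = es"
  by (induction es) auto

lemma well_matched0: "well_matched C t \<Longrightarrow> bdim t = 0 \<Longrightarrow> \<exists>a\<in>C. t = t_obj a"
proof (cases t)
  case (Gen g)
  assume "well_matched C t" "bdim t = 0"
  then show ?thesis using Gen by (cases g) auto
qed auto

text \<open>Here and in \<open>good2I\<close> only \<open>well_matched\<close> is assumed: both are
  applied inside the mutual induction on \<open>wf_term\<close> and \<open>term_eq\<close>, where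
  the boundary terms are not yet under control.\<close>

lemma good1I: "well_matched C t \<Longrightarrow> bdim t = 1 \<Longrightarrow> good1 C t"
proof (induction t)
  case (Gen g)
  then show ?case by (cases g) (auto simp: good1_def)
next
  case (Ident t)
  then obtain a where "a \<in> C" "t = t_obj a" using well_matched0[of C t] by auto
  then show ?case by (simp add: good1_def)
next
  case (Comp i t u)
  then show ?case by (auto simp: good1_def is_path_append)
qed auto

lemma good2I: "well_matched C t \<Longrightarrow> bdim t = 2 \<Longrightarrow> good2 C t"
proof (induction t)
  case (Gen g)
  then show ?case by (cases g) (auto simp: good1_def good2_def bicat_unfold)
next
  case (Ident t)
  then have "good1 C t" using good1I[of C t] by simp
  then show ?case using Ident.prems is_forest_leaf by (auto simp: good1_def good2_def)
next
  case (Comp i t u)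
  have d: "bdim t = 2" "bdim u = 2" "i < 2" "well_matched C t" "well_matched C u" using Comp.prems by auto
  have g: "good2 C t" "good2 C u" using Comp.IH d by auto
  show ?case
  proof (cases "i = 0")
    case True
    then have "term_end t = term_start u" using Comp.prems by auto
    then show ?thesis
      using True g d by (auto simp: good2_def good1_def is_forest_append is_path_append)
  next
    case False
    then have i: "i = 1" using d by simp
    then have m: "term_start t = term_start u" "term_end t = term_end u"
      "roots (term_forest t) = forest_leaves (term_forest u)" using Comp.prems by auto
    then have l: "length (term_forest t) = length (forest_leaves (term_forest u))"
      by (metis length_map)
    have "roots (graft_forest (term_forest u) (term_forest t)) = roots (term_forest u)"
      using roots_graft_forest[OF _ _ m(3)] g unfolding good2_def is_forest_def by blast
    then show ?thesis
      using i g d m is_forest_graft[of C "term_start u" "term_forest u" "term_end u" "term_forest t"]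
        leaves_graft_forest[OF l] by (simp add: good2_def)
  qed
qed auto

text \<open>The invariant that separates cells of dimension at most two. Above that only the
  dimension is compared, as no interpretation is attempted there.\<close>

definition same_cell :: "'a bicat_term \<Rightarrow> 'a bicat_term \<Rightarrow> bool" where
  "same_cell t u \<longleftrightarrow> bdim t = bdim u \<and>
    (bdim t \<le> 2 \<longrightarrow> term_start t = term_start u \<and> term_end t = term_end u) \<and>
    (bdim t = 1 \<longrightarrow> term_path t = term_path u) \<and> (bdim t = 2 \<longrightarrow> term_forest t = term_forest u)"

text \<open>The laws turn into identities on lists and forests: associativity and units of grafting,
  and compatibility of grafting with concatenation for the exchange law. The laws for inverses arise
  only above dimension two, where nothing but dimensions is compared.\<close>

lemma same_cell_law:
  assumes "cat_law (BiCat C) t u" "well_matched C t" "well_matched C u" "bdim t = bdim u"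
  shows "same_cell t u"
  using assms
proof (induction rule: cat_law.induct)
  case (assoc i t u v)
  show ?case
  proof (cases "i = 0 \<or> bdim t \<noteq> 2")
    case True
    then show ?thesis using assoc.prems by (auto simp: same_cell_def)
  next
    case False
    then have "length (term_forest u) = length (forest_leaves (term_forest v))"
      "length (term_forest t) = length (forest_leaves (term_forest u))"
      using assoc.prems by (auto dest!: arg_cong[of "map root _" _ length])
    then show ?thesis using False assoc.prems by (simp add: same_cell_def graft_forest_assoc)
  qed
next
  case (unit_left i t)
  have t: "well_matched C t" using unit_left.prems by simp
  show ?case
  proof (cases "bdim t \<le> 2")
    case False
    then show ?thesis using unit_left.prems by (simp add: same_cell_def)
  next
    case True
    then consider "bdim t = 1" "i = 0" | "bdim t = 2" "i = 0" | "bdim t = 2" "i = 1"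
      using unit_left.hyps by fastforce
    then show ?thesis
    proof cases
      case 1
      then show ?thesis using good1I[OF t] by (simp add: same_cell_def tsrc_at_def good1_def)
    next
      case 2
      then show ?thesis using good2I[OF t] by (simp add: same_cell_def bicat_unfold good1_def good2_def)
    next
      case 3
      then show ?thesis using good2I[OF t] by (simp add: same_cell_def bicat_unfold good1_def good2_def graft_forest_leaf)
    qed
  qed
next
  case (unit_right i t)
  have t: "well_matched C t" using unit_right.prems by simp
  show ?case
  proof (cases "bdim t \<le> 2")
    case False
    then show ?thesis using unit_right.prems by (simp add: same_cell_def)
  next
    case True
    then consider "bdim t = 1" "i = 0" | "bdim t = 2" "i = 0" | "bdim t = 2" "i = 1"
      using unit_right.hyps by fastforce
    then show ?thesis
    proof cases
      case 1
      then show ?thesis using good1I[OF t] by (simp add: same_cell_def ttgt_at_def good1_def)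
    next
      case 2
      then show ?thesis using good2I[OF t] by (simp add: same_cell_def bicat_unfold good1_def good2_def)
    next
      case 3
      then show ?thesis
        using good2I[OF t] graft_forest_map_leaf[of "term_forest t" "roots (term_forest t)"]
        by (simp add: same_cell_def bicat_unfold good1_def good2_def)
    qed
  qed
next
  case (exchange i j t t' u u')
  show ?case
  proof (cases "bdim t = 2")
    case True
    then have ij: "i = 0" "j = 1" using exchange by auto
    then have "length (term_forest t) = length (forest_leaves (term_forest t'))"
      using exchange.prems True by (auto dest!: arg_cong[of "map root _" _ length])
    then show ?thesis using exchange.prems ij True by (simp add: same_cell_def graft_forest_append)
  next
    case False
    then show ?thesis using exchange by (auto simp: same_cell_def)
  qed
next
  case (id_comp i t u)
  then show ?case by (auto simp: same_cell_def)
qed (auto simp: same_cell_def)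

text \<open>For a composite, the induction hypothesis says that the two middle boundary terms have
  the same interpretation, and \<open>good1I\<close>, \<open>good2I\<close> translate this into the
  matching of ends or of roots with leaves. With \<open>2 \<le> p\<close>, formal inverses occur
  only above dimension two.\<close>

lemma wf_term_well_matched:
  assumes "2 \<le> p"
  shows "wf_term (BiCat C) n p t \<Longrightarrow> well_matched C t"
    and "term_eq (BiCat C) n p t u \<Longrightarrow> well_matched C t \<and> well_matched C u \<and> same_cell t u"
proof (induction rule: wf_term_term_eq.inducts)
  case (wf_GenInv g)
  then show ?case using assms by simp
next
  case (wf_Comp t u i)
  have d: "bdim t = bdim u" "i < bdim t" using wf_Comp by auto
  have s: "same_cell (ttgt_at (BiCat C) i t) (tsrc_at (BiCat C) i u)" using wf_Comp by blast
  have "(if i = 0 then term_end t = term_start u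
      else term_start t = term_start u \<and> term_end t = term_end u \<and>
        roots (term_forest t) = forest_leaves (term_forest u))" if le: "bdim t \<le> 2"
  proof -
    consider "bdim t = 1" "i = 0" | "bdim t = 2" "i = 0" | "bdim t = 2" "i = 1"
      using le d by fastforce
    then show ?thesis
    proof cases
      case 1
      then show ?thesis
        using s d good1I[of C t] good1I[of C u] wf_Comp by (simp add: same_cell_def ttgt_at_def tsrc_at_def good1_def)
    next
      case 2
      then show ?thesis
        using s d good2I[of C t] good2I[of C u] wf_Comp
        by (simp add: same_cell_def bicat_unfold good1_def good2_def)
    next
      case 3
      then show ?thesis
        using s d good2I[of C t] good2I[of C u] wf_Comp
        by (simp add: same_cell_def bicat_unfold good1_def good2_def)
    qed
  qed
  then show ?case using wf_Comp d by simp
next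
  case (teq_law t u)
  interpret polygraph_loc 4 "BiCat C" by unfold_locales (rule polygraph_BiCat)
  have "bdim t = bdim u" using cat_law_dim[OF teq_law(1,2)] by simp
  then show ?case using same_cell_law teq_law by blast
qed (auto simp: same_cell_def split: if_splits)

section \<open>The cells of the free categories\<close>

text \<open>Used with \<open>n = p = 3\<close> for rewriting and with \<open>n = 4\<close>,
  \<open>p = 2\<close> for coherence. The bound on \<open>p\<close> excludes formal inverses up to
  dimension two, so that 2-cells are forests in both cases.\<close>

locale free_bicat =
  fixes C :: "'a set" and n p :: nat
  assumes np: "3 \<le> n" "2 \<le> p"

sublocale free_bicat \<subseteq> polygraph_loc 4 "BiCat C"
  by unfold_locales (rule polygraph_BiCat)

context free_bicat
begin

abbreviation "K \<equiv> free_npcat n p (BiCat C)"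
abbreviation "cl \<equiv> cell_class (BiCat C) n p"
abbreviation "W \<equiv> wf_term (BiCat C) n p"
abbreviation "bsrc \<equiv> tsrc (BiCat C)"
abbreviation "btgt \<equiv> ttgt (BiCat C)"

text \<open>Evaluates a raw term with the operations of \<open>K\<close>. Unfolded at the boundary
  of a generator, it gives a composite in exactly the form required by
  \<open>bicat_cells\<close>.\<close>

primrec denote :: "'a bicat_term \<Rightarrow> 'a bicat_term set" where
  "denote (Gen g) = cl (Gen g)"
| "denote (GenInv g) = cl (GenInv g)"
| "denote (Ident t) = cid K (denote t)"
| "denote (Comp i t u) = ccomp K i (denote t) (denote u)"

lemma cl_denote: "W t \<Longrightarrow> cl t = denote t"
proof (induction t)
  case (Ident t)
  then have "W t" "tdim (BiCat C) t < n" by (auto elim: wf_IdentE)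
  then show ?case using Ident.IH cid_class[of n p t] by simp
next
  case (Comp i t u)
  then show ?case using ccomp_class[of n p i t u] wf_CompD(1,2)[of "BiCat C" n p i t u] by simp
qed simp_all

lemma wf_gen:
  assumes "set_bicat_gen g \<subseteq> C" "bicat_dim g \<le> n"
  shows "W (Gen g)" "bicat_dim g = Suc k \<Longrightarrow> W (bicat_src g) \<and> W (bicat_tgt g)"
proof -
  show "W (Gen g)" using assms by (auto intro: wf_Gen)
  show "W (bicat_src g) \<and> W (bicat_tgt g)" if "bicat_dim g = Suc k"
    using gen_dims(3,4)[of g k] assms that by (auto intro: wf_term_mono)
qed

lemma gen_cell:
  assumes "set_bicat_gen g \<subseteq> C" "bicat_dim g \<le> n" "bicat_dim g = Suc k"
  shows "cl (Gen g) \<in> cells K (Suc k)" "csrc K (cl (Gen g)) = denote (bicat_src g)"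
    "ctgt K (cl (Gen g)) = denote (bicat_tgt g)"
  using wf_gen(1)[OF assms(1,2)] wf_gen(2)[OF assms] class_boundary[of n p "Gen g" k] class_cell_iff[of n p "Gen g" "Suc k"] assms(3)
  by (simp_all flip: cl_denote)

end

sublocale free_bicat \<subseteq> strict_category3 n "free_npcat n p (BiCat C)"
proof -
  interpret strict_ncategory n "free_npcat n p (BiCat C)" by (rule free_strict_ncategory)
  show "strict_category3 n (free_npcat n p (BiCat C))" by unfold_locales (rule np)
qed

context free_bicat
begin

lemma bicat_cells_free:
  "bicat_cells n K C (\<lambda>a. cl (t_obj a)) (\<lambda>a b. cl (t_e a b)) (\<lambda>a b c. cl (t_m a b c)) (\<lambda>a. cl (t_i a))
    (\<lambda>a b c d. cl (t_alpha a b c d)) (\<lambda>a b. cl (t_lambda a b)) (\<lambda>a b. cl (t_rho a b))"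
proof
  fix a b c d
  have n: "1 \<le> n" "2 \<le> n" "3 \<le> n" using np by auto
  have obj: "cl (t_obj a) \<in> cells K 0" if "a \<in> C" for a
    using wf_gen(1)[of "G_obj a"] that class_cell_iff[of n p "t_obj a" 0] by simp
  have e: "hom1 (cl (t_obj a)) (cl (t_obj b)) (cl (t_e a b))" if "a \<in> C" "b \<in> C" for a b
    using gen_cell[of "G_e a b" 0] that n by (simp add: hom1_def)
  have m: "hom2 (cl (t_obj a)) (cl (t_obj c)) (ccomp K 0 (cl (t_e a b)) (cl (t_e b c))) (cl (t_e a c)) (cl (t_m a b c))"
    if "a \<in> C" "b \<in> C" "c \<in> C" for a b c
    using gen_cell[of "G_m a b c" 1] that n hom1_comp[OF e e, of a b c] e[of a c]
    by (simp add: hom2_def bicat_unfold)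
  show "a \<in> C \<Longrightarrow> cl (t_obj a) \<in> cells K 0" by (rule obj)
  show "a \<in> C \<Longrightarrow> b \<in> C \<Longrightarrow> hom1 (cl (t_obj a)) (cl (t_obj b)) (cl (t_e a b))" by (rule e)
  show "a \<in> C \<Longrightarrow> b \<in> C \<Longrightarrow> c \<in> C \<Longrightarrow>
     hom2 (cl (t_obj a)) (cl (t_obj c)) (ccomp K 0 (cl (t_e a b)) (cl (t_e b c))) (cl (t_e a c)) (cl (t_m a b c))" by (rule m)
  show "a \<in> C \<Longrightarrow> hom2 (cl (t_obj a)) (cl (t_obj a)) (cid K (cl (t_obj a))) (cl (t_e a a)) (cl (t_i a))"
    using gen_cell[of "G_i a" 1] n hom1_id[OF obj] e[of a a] by (simp add: hom2_def bicat_unfold)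
  show "a \<in> C \<Longrightarrow> b \<in> C \<Longrightarrow> c \<in> C \<Longrightarrow> d \<in> C \<Longrightarrow> cl (t_alpha a b c d) \<in> cells K 3 \<and>
      csrc K (cl (t_alpha a b c d)) = ccomp K (Suc 0) (ccomp K 0 (cl (t_m a b c)) (cid K (cl (t_e c d)))) (cl (t_m a c d)) \<and>
      ctgt K (cl (t_alpha a b c d)) = ccomp K (Suc 0) (ccomp K 0 (cid K (cl (t_e a b))) (cl (t_m b c d))) (cl (t_m a b d))"
    using gen_cell[of "G_alpha a b c d" 2] n by (simp add: bicat_unfold)
  show "a \<in> C \<Longrightarrow> b \<in> C \<Longrightarrow> cl (t_lambda a b) \<in> cells K 3 \<and>
      csrc K (cl (t_lambda a b)) = ccomp K (Suc 0) (ccomp K 0 (cl (t_i a)) (cid K (cl (t_e a b)))) (cl (t_m a a b)) \<and>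
      ctgt K (cl (t_lambda a b)) = cid K (cl (t_e a b))"
    using gen_cell[of "G_lambda a b" 2] n by (simp add: bicat_unfold)
  show "a \<in> C \<Longrightarrow> b \<in> C \<Longrightarrow> cl (t_rho a b) \<in> cells K 3 \<and>
      csrc K (cl (t_rho a b)) = ccomp K (Suc 0) (ccomp K 0 (cid K (cl (t_e a b))) (cl (t_i b))) (cl (t_m a b b)) \<and>
      ctgt K (cl (t_rho a b)) = cid K (cl (t_e a b))"
    using gen_cell[of "G_rho a b" 2] n by (simp add: bicat_unfold)
qed

end

sublocale free_bicat \<subseteq> bicat_cells n "free_npcat n p (BiCat C)" C
    "\<lambda>a. cl (t_obj a)" "\<lambda>a b. cl (t_e a b)" "\<lambda>a b c. cl (t_m a b c)" "\<lambda>a. cl (t_i a)"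
    "\<lambda>a b c d. cl (t_alpha a b c d)" "\<lambda>a b. cl (t_lambda a b)" "\<lambda>a b. cl (t_rho a b)"
  by (rule bicat_cells_free)

section \<open>Identities on paths and composites of forests\<close>

context bicat_cells
begin

lemma id_path: "is_path C a es b \<Longrightarrow> \<iota> (path a es) = forest a (map leaf es)"
proof (induction es arbitrary: a)
  case (Cons e es)
  have h: "fst e = a" "a \<in> C" "snd e \<in> C" "is_path C (snd e) es b"
    using Cons.prems is_path_ends[of C "snd e" es b] by auto
  show ?case
    using Cons.IH[OF h(4)] h(1) id_comp1[OF edge[OF h(2,3)] path_hom[OF h(4)]] by simp
qed simp

text \<open>Obtained from the 3-dimensional statement \<open>forest3_comp1\<close> for identity
  arrows by comparing sources, instead of by a second induction.\<close>

lemma forest_comp1: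
  assumes "is_forest C a Xs b" "is_forest C a Ys b" "roots Xs = forest_leaves Ys"
  shows "forest a Xs \<odot>\<^sub>1 forest a Ys = forest a (graft_forest Ys Xs)"
proof -
  have t: "\<forall>X\<in>set Xs. typed C X" "\<forall>X\<in>set Ys. typed C X" using assms by (auto simp: is_forest_def)
  have s: "srcs (map idn Xs) = Xs" "srcs (map idn Ys) = Ys" by (simp_all add: comp_def)
  have g: "\<forall>p\<in>set (map idn Xs). generated False p" "\<forall>p\<in>set (map idn Ys). generated False p"
    using t by (auto intro: gen_idn)
  obtain rs where rs: "\<forall>r\<in>set rs. generated False r" "srcs rs = graft_forest Ys Xs"
    "forest3 a (map idn Xs) \<odot>\<^sub>1 forest3 a (map idn Ys) = forest3 a rs"
    using forest3_comp1[OF g, of a b] assms unfolding s by blast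
  have r: "\<forall>r\<in>set rs. arrow r" using rs(1) generated_arrow by blast
  have "csrc K (forest3 a rs) = forest a (graft_forest Ys Xs)"
    using hom3D(3)[OF forest3_hom[OF r]] rs(2) is_forest_graft[OF assms(2,1,3)] by metis
  moreover note h = forest_hom[OF assms(1), unfolded assms(3)] forest_hom[OF assms(2)]
  have "csrc K (forest3 a rs) = forest a Xs \<odot>\<^sub>1 forest a Ys"
    using rs(3) forest3_idn[OF assms(1)] forest3_idn[OF assms(2)] id_comp2(2)[OF h]
      hom3D(3)[OF hom3_id[OF hom2_comp1[OF h]]] by simp
  ultimately show ?thesis by simp
qed

end

section \<open>Cells of the free categories as paths, forests and lists of arrows\<close>

context free_bicat
begin

lemma well_matched: "W t \<Longrightarrow> well_matched C t"
  using wf_term_well_matched(1) np by blast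

lemma same_cell: "term_eq (BiCat C) n p t u \<Longrightarrow> same_cell t u"
  using wf_term_well_matched(2) np by blast

lemma good1: "W t \<Longrightarrow> bdim t = 1 \<Longrightarrow> good1 C t"
  by (rule good1I[OF well_matched])

lemma good2: "W t \<Longrightarrow> bdim t = 2 \<Longrightarrow> good2 C t"
  by (rule good2I[OF well_matched])

lemma cl_path:
  assumes "W t" "bdim t = 1"
  shows "cl t = path (term_start t) (term_path t)"
  using assms
proof (induction t rule: cell_term.induct)
  case (Gen g)
  then have "set_bicat_gen g \<subseteq> C" using well_matched[of "Gen g"] by simp
  then show ?case using Gen path_single by (cases g) auto
next
  case (GenInv g)
  then show ?case using well_matched by fastforce
next
  case (Ident t)
  then obtain a where "t = t_obj a" using well_matched0[of C t] well_matched[of "Ident t"] by auto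
  then show ?case using cl_denote[OF Ident.prems(1)] by simp
next
  case (Comp i t u)
  note w = wf_CompD[OF Comp.prems(1)]
  have d: "bdim t = 1" "bdim u = 1" "i = 0" using w Comp.prems(2) by auto
  have "is_path C (term_start t) (term_path t) (term_start u)"
    using good1[OF w(1) d(1)] well_matched[OF Comp.prems(1)] d by (simp add: good1_def)
  then show ?case
    using path_append[of "term_start t" "term_path t" "term_start u" "term_path u" "term_end u"] good1[OF w(2) d(2)]
      Comp.IH(1)[OF w(1) d(1)] Comp.IH(2)[OF w(2) d(2)] ccomp_class[OF Comp.prems(1)] d(3)
    by (simp add: good1_def)
qed

text \<open>Together with \<open>same_cell\<close> this describes 2-cells completely: equal classes
  have equal forests, and the forest with its starting object determines the class.\<close>

lemma cl_forest:
  assumes "W t" "bdim t = 2"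
  shows "cl t = forest (term_start t) (term_forest t)"
  using assms
proof (induction t rule: cell_term.induct)
  case (Gen g)
  then have g: "set_bicat_gen g \<subseteq> C" using well_matched[of "Gen g"] by simp
  show ?case
  proof (cases g)
    case (G_m a b c)
    then have "a \<in> C" "b \<in> C" "c \<in> C" using g by auto
    then show ?thesis using G_m forest_single[of "Node (Leaf a b) (Leaf b c)"] leaf_cells(1)[of a b c c] by simp
  next
    case (G_i a)
    then show ?thesis using g forest_single[of "Unit a"] by simp
  qed (use Gen.prems in auto)
next
  case (GenInv g)
  then show ?case using well_matched by fastforce
next
  case (Ident t)
  have t: "W t" "bdim t = 1" using Ident.prems by (auto elim: wf_IdentE)
  have "cl (Ident t) = cid K (cl t)" using cid_class[of n p t] t np by simp
  then show ?case using cl_path[OF t] id_path[of "term_start t" "term_path t" "term_end t"] good1[OF t] by (simp add: good1_def)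
next
  case (Comp i t u)
  note w = wf_CompD[OF Comp.prems(1)]
  have d: "bdim t = 2" "bdim u = 2" "i < 2" using w Comp.prems(2) by auto
  note g = good2[OF w(1) d(1)] good2[OF w(2) d(2)]
  note IH = Comp.IH(1)[OF w(1) d(1)] Comp.IH(2)[OF w(2) d(2)] ccomp_class[OF Comp.prems(1)]
  have m: "well_matched C (Comp i t u)" by (rule well_matched[OF Comp.prems(1)])
  show ?case
  proof (cases "i = 0")
    case True
    then show ?thesis
      using IH g m d forest_append[of "term_start t" "term_forest t" "term_start u" "term_forest u" "term_end u"]
      by (simp add: good2_def)
  next
    case False
    then have "i = Suc 0" using d by simp
    then show ?thesis
      using IH g m d forest_comp1[of "term_start u" "term_forest t" "term_end u" "term_forest u"]
      by (simp add: good2_def)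
  qed
qed

lemma boundary3:
  assumes "W t" "bdim t = 3"
  shows "W (bsrc t)" "W (btgt t)" "good2 C (bsrc t)" "good2 C (btgt t)"
    "term_start (btgt t) = term_start (bsrc t)" "term_end (btgt t) = term_end (bsrc t)"
    "csrc K (cl t) = forest (term_start (bsrc t)) (term_forest (bsrc t))"
    "ctgt K (cl t) = forest (term_start (bsrc t)) (term_forest (btgt t))"
proof -
  have d: "tdim (BiCat C) t = Suc 2" using assms(2) by simp
  note b = boundary(1-4)[OF assms(1) d] boundary(5,6)[OF assms(1) d]
  show w: "W (bsrc t)" "W (btgt t)" by fact+
  show g: "good2 C (bsrc t)" "good2 C (btgt t)" using good2 b by simp_all
  have "same_cell (bsrc (bsrc t)) (bsrc (btgt t))" using same_cell b by simp
  then show e: "term_start (btgt t) = term_start (bsrc t)" "term_end (btgt t) = term_end (bsrc t)"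
    using g by (simp_all add: same_cell_def good2_def good1_def)
  show "csrc K (cl t) = forest (term_start (bsrc t)) (term_forest (bsrc t))"
    "ctgt K (cl t) = forest (term_start (bsrc t)) (term_forest (btgt t))"
    using class_boundary[OF assms(1) d] cl_forest[OF w(1)] cl_forest[OF w(2)] b e by simp_all
qed

lemma cl_generator3:
  assumes "set_bicat_gen g \<subseteq> C" "bicat_dim g = 3"
  shows "\<exists>q. generated (p \<le> 2) q \<and> term_forest (bicat_src g) = [src q] \<and> term_forest (bicat_tgt g) = [trg q] \<and>
    cell q = cl (Gen g) \<and> term_start (bicat_src g) = left_end (src q) \<and> term_start (bicat_tgt g) = left_end (src q)"
proof (cases g)
  case (G_alpha a b c d)
  then have c: "a \<in> C" "b \<in> C" "c \<in> C" "d \<in> C" using assms by auto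
  let ?q = "assr (Leaf a b) (Leaf b c) (Leaf c d)"
  have "generated (p \<le> 2) ?q" using c by (intro gen_assr) simp
  then show ?thesis
    using leaf_cells(2)[OF c] G_alpha by (intro exI[of _ ?q]) (simp add: bicat_unfold)
next
  case (G_lambda a b)
  then have c: "a \<in> C" "b \<in> C" using assms by auto
  let ?q = "lun (Leaf a b)"
  have "generated (p \<le> 2) ?q" using c by (intro gen_lun) simp
  then show ?thesis
    using leaf_cells(3)[OF c c] G_lambda by (intro exI[of _ ?q]) (simp add: bicat_unfold)
next
  case (G_rho a b)
  then have c: "a \<in> C" "b \<in> C" using assms by auto
  let ?q = "run (Leaf a b)"
  have "generated (p \<le> 2) ?q" using c by (intro gen_run) simp
  then show ?thesis
    using leaf_cells(4)[OF c c] G_rho by (intro exI[of _ ?q]) (simp add: bicat_unfold)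
qed (use assms in auto)

lemma forest3_single: "arrow q \<Longrightarrow> forest3 a [q] = cell q"
  using unit3(2)[OF arrow_hom] by simp

text \<open>The three compositions become concatenation of lists, \<open>forest3_comp1\<close> and
  entrywise \<open>cmp\<close>. Entrywise composition needs the trees in the middle to coincide, and
  not merely their realizations; this is where \<open>same_cell\<close> enters.\<close>

lemma cl_forest3:
  assumes "W t" "bdim t = 3"
  shows "\<exists>ps. (\<forall>q\<in>set ps. generated (p \<le> 2) q) \<and> srcs ps = term_forest (bsrc t) \<and>
    trgs ps = term_forest (btgt t) \<and> cl t = forest3 (term_start (bsrc t)) ps"
  using assms
proof (induction t rule: cell_term.induct)
  case (Gen g)
  then have g: "set_bicat_gen g \<subseteq> C" "bicat_dim g = 3" using well_matched[of "Gen g"] by simp_all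
  obtain q where q: "generated (p \<le> 2) q" "term_forest (bicat_src g) = [src q]" "term_forest (bicat_tgt g) = [trg q]"
    "cell q = cl (Gen g)"
    using cl_generator3[OF g] by blast
  then show ?case using forest3_single[OF generated_arrow[OF q(1)]] by (intro exI[of _ "[q]"]) simp
next
  case (GenInv g)
  \<comment> \<open>A formal inverse of a 3-dimensional generator exists only for
    \<open>p \<le> 2\<close>, which is exactly when the flag admits inverses.\<close>
  from GenInv.prems(1) have "g \<in> gens (BiCat C) \<and> gdim (BiCat C) g \<le> n \<and> p < gdim (BiCat C) g"
    by (rule wf_GenInvE) simp
  then have g: "set_bicat_gen g \<subseteq> C" "bicat_dim g = 3" "p \<le> 2" "bicat_dim g \<le> n"
    using GenInv.prems(2) by auto
  obtain q where q: "generated (p \<le> 2) q" "term_forest (bicat_src g) = [src q]" "term_forest (bicat_tgt g) = [trg q]"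
    "cell q = cl (Gen g)"
    using cl_generator3[OF g(1,2)] by blast
  note a = generated_arrow[OF q(1)]
  have wg: "W (Gen g)" using wf_gen(1)[OF g(1,4)] .
  have d: "tdim (BiCat C) (Gen g) = Suc 2" "tdim (BiCat C) (GenInv g) = Suc 2" using g by simp_all
  note b = boundary(1-4)[OF wg d(1)]
  note cb = class_boundary[OF wg d(1)] class_boundary[OF GenInv.prems(1) d(2)]
  let ?r = "(trg q, src q, cl (GenInv g))"
  have "cl (GenInv g) \<in> cells K 3" using GenInv.prems class_cell_iff by simp
  then have r: "arrow ?r" using a cb q(4) by (simp add: arrow_def)
  have w: "W (Comp 2 (Gen g) (GenInv g))" "W (Comp 2 (GenInv g) (Gen g))"
    using wg GenInv.prems b d by (auto intro!: wf_Comp teq_refl simp: at_top)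
  have wi: "W (Ident (bicat_src g))" "W (Ident (bicat_tgt g))"
    using b np d by (auto intro!: wf_Ident)
  have gd: "gdim (BiCat C) g = Suc 2" using g(2) by simp
  have "term_eq (BiCat C) n p (Comp 2 (Gen g) (GenInv g)) (Ident (bicat_src g))"
    "term_eq (BiCat C) n p (Comp 2 (GenInv g) (Gen g)) (Ident (bicat_tgt g))"
    using cat_law.inv_right[OF gd] cat_law.inv_left[OF gd] w wi by (simp_all only: BiCat_simps teq_law)
  then have e: "cl (Comp 2 (Gen g) (GenInv g)) = cl (Ident (bicat_src g))"
    "cl (Comp 2 (GenInv g) (Gen g)) = cl (Ident (bicat_tgt g))"
    by (simp_all only: cell_class_eq_iff[OF w(1)] cell_class_eq_iff[OF w(2)])
  have k: "W (bicat_src g)" "W (bicat_tgt g)" "bdim (bicat_src g) < n" "bdim (bicat_tgt g) < n"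
    using b np by simp_all
  have r': "cl (bicat_src g) = realize (src q)" "cl (bicat_tgt g) = realize (trg q)"
    using a cb(1,2) by (simp_all add: arrow_def q(4))
  have "ccomp K 2 (cl (Gen g)) (cl (GenInv g)) = cid K (realize (src q))"
    unfolding ccomp_class[OF w(1)] e r'[symmetric] using cid_class[of n p "bicat_src g"] k by simp
  moreover have "ccomp K 2 (cl (GenInv g)) (cl (Gen g)) = cid K (realize (trg q))"
    unfolding ccomp_class[OF w(2)] e r'[symmetric] using cid_class[of n p "bicat_tgt g"] k by simp
  ultimately have "generated (p \<le> 2) ?r"
    using r g(3) by (intro gen_inv[OF _ q(1)]) (simp_all add: cmp_def idn_def q(4))
  then show ?case using q forest3_single[OF r] by (intro exI[of _ "[?r]"]) simp
next
  case (Ident t)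
  have t: "W t" "bdim t = 2" using Ident.prems by (auto elim: wf_IdentE)
  note g = good2[OF t]
  have "cl (Ident t) = cid K (cl t)" using cid_class[of n p t] t np by simp
  then have "cl (Ident t) = forest3 (term_start t) (map idn (term_forest t))"
    using cl_forest[OF t] forest3_idn[of "term_start t" "term_forest t" "term_end t"] g by (simp add: good2_def)
  then show ?case
    using g by (intro exI[of _ "map idn (term_forest t)"])
      (auto simp: good2_def is_forest_def comp_def intro!: gen_idn)
next
  case (Comp i t u)
  note w = wf_CompD[OF Comp.prems(1)]
  have d: "bdim t = 3" "bdim u = 3" "i < 3" using w Comp.prems(2) by auto
  obtain ps where ps: "\<forall>q\<in>set ps. generated (p \<le> 2) q" "srcs ps = term_forest (bsrc t)"
    "trgs ps = term_forest (btgt t)" "cl t = forest3 (term_start (bsrc t)) ps"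
    using Comp.IH(1)[OF w(1) d(1)] by blast
  obtain qs where qs: "\<forall>q\<in>set qs. generated (p \<le> 2) q" "srcs qs = term_forest (bsrc u)"
    "trgs qs = term_forest (btgt u)" "cl u = forest3 (term_start (bsrc u)) qs"
    using Comp.IH(2)[OF w(2) d(2)] by blast
  have arr: "\<forall>p\<in>set ps. arrow p" "\<forall>p\<in>set qs. arrow p"
    using ps(1) qs(1) generated_arrow by blast+
  note bt = boundary3[OF w(1) d(1)] and bu = boundary3[OF w(2) d(2)]
  have cc: "cl (Comp i t u) = ccomp K i (cl t) (cl u)" using ccomp_class[OF Comp.prems(1)] by simp
  have s: "same_cell (ttgt_at (BiCat C) i t) (tsrc_at (BiCat C) i u)" by (rule same_cell[OF w(5)])
  have ft: "is_forest C (term_start (bsrc t)) (srcs ps) (term_end (bsrc t))"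
    and fu: "is_forest C (term_start (bsrc u)) (srcs qs) (term_end (bsrc u))"
    using bt(3) bu(3) ps(2) qs(2) by (simp_all add: good2_def)
  consider "i = 0" | "i = 1" | "i = 2" using d(3) by fastforce
  then show ?case
  proof cases
    case 1
    have "term_end (bsrc t) = term_start (bsrc u)"
      using s 1 d bt bu by (simp add: same_cell_def bicat_unfold good2_def good1_def)
    then have "cl (Comp i t u) = forest3 (term_start (bsrc t)) (ps @ qs)"
      using forest3_append[OF arr ft] fu cc 1 ps(4) qs(4) by simp
    then show ?thesis
      using 1 d ps qs by (intro exI[of _ "ps @ qs"]) auto
  next
    case 2
    have e: "term_start (bsrc t) = term_start (bsrc u)"
      "term_path (btgt (btgt t)) = term_path (bsrc (bsrc u))"
      using s 2 d bt bu by (simp_all add: same_cell_def bicat_unfold good2_def good1_def)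
    have "roots (srcs ps) = forest_leaves (srcs qs)"
      using e(2) bt(4) bu(3) ps(3) qs(2) roots_trgs[OF arr(1)] by (simp add: good2_def)
    then obtain rs where rs: "\<forall>r\<in>set rs. generated (p \<le> 2) r" "srcs rs = graft_forest (srcs qs) (srcs ps)"
      "trgs rs = graft_forest (trgs qs) (trgs ps)"
      "ccomp K (Suc 0) (forest3 (term_start (bsrc u)) ps) (forest3 (term_start (bsrc u)) qs) = forest3 (term_start (bsrc u)) rs"
      using forest3_comp1[OF ps(1) qs(1) fu] by blast
    show ?thesis
      using rs 2 d ps qs cc e(1) by (intro exI[of _ rs]) simp
  next
    case 3
    have e: "term_start (bsrc u) = term_start (bsrc t)" "trgs ps = srcs qs"
      using s 3 d bt bu ps(3) qs(2) by (simp_all add: same_cell_def bicat_unfold good2_def good1_def)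
    have l: "length ps = length qs" using e(2) by (metis length_map)
    have m: "\<forall>q\<in>set (map2 cmp ps qs). generated (p \<le> 2) q" "srcs (map2 cmp ps qs) = srcs ps" "trgs (map2 cmp ps qs) = trgs qs"
      using l e(2) ps(1) qs(1) by (induction ps qs rule: list_induct2) (auto intro: gen_cmp)
    have "cl (Comp i t u) = forest3 (term_start (bsrc t)) (map2 cmp ps qs)"
      using forest3_cmp[OF l arr ft e(2)] cc 3 ps(4) qs(4) e(1) by (simp add: eval_nat_numeral)
    then show ?thesis
      using m 3 d ps(2) qs(3) by (intro exI[of _ "map2 cmp ps qs"]) simp
  qed
qed

end

section \<open>Termination, confluence and coherence\<close>

text \<open>A polynomial interpretation for which all three rewriting rules are strictly decreasing.\<close>

primrec weight :: "'a tree \<Rightarrow> nat" where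
  "weight (Leaf a b) = 0"
| "weight (Unit a) = 0"
| "weight (Node X Y) = 2 * weight X + weight Y + 1"

abbreviation forest_weight :: "'a tree list \<Rightarrow> nat" where
  "forest_weight Xs \<equiv> sum_list (map weight Xs)"

text \<open>The normal forms for rewriting. The separate clause for a single leaf avoids a final
  unit, which \<rho> would still remove.\<close>

fun comb :: "'a \<Rightarrow> ('a \<times> 'a) list \<Rightarrow> 'a tree" where
  "comb a [] = Unit a"
| "comb a [e] = leaf e"
| "comb a (e # es) = Node (leaf e) (comb (snd e) es)"

lemma comb_Cons: "es \<noteq> [] \<Longrightarrow> comb a (e # es) = Node (leaf e) (comb (snd e) es)"
  by (cases es) auto

lemma comb_typed:
  assumes "is_path C a es b"
  shows "typed C (comb a es) \<and> left_end (comb a es) = a \<and> right_end (comb a es) = b \<and> leaves (comb a es) = es"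
  using assms by (induction a es rule: comb.induct) (auto dest: is_path_ends)

section \<open>Decrease of the weight and rewriting to right combs\<close>

context bicat_cells
begin

text \<open>Doubling the left factor makes reassociation decrease: for subtrees of weights x, y, z
  it takes 4x + 2y + z + 3 to 2x + 2y + z + 2. The summand 1 takes care of both unit rules, and
  strict monotonicity in each factor of the tensor product.\<close>

lemma generated_weight: "generated False p \<Longrightarrow> src p = trg p \<or> weight (trg p) < weight (src p)"
  by (induction rule: generated.induct) (auto simp: arrow_op_defs)

lemma forest_weight:
  "\<forall>p\<in>set ps. generated False p \<Longrightarrow> srcs ps = trgs ps \<or> forest_weight (trgs ps) < forest_weight (srcs ps)"
proof (induction ps)
  case (Cons p ps)
  then have IH: "srcs ps = trgs ps \<or> forest_weight (trgs ps) < forest_weight (srcs ps)" by simp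
  then have "forest_weight (trgs ps) \<le> forest_weight (srcs ps)"
    by (metis less_imp_le order_refl)
  then show ?case
    using IH generated_weight[of p] Cons.prems by auto
qed simp

text \<open>An associator moves the first leaf out of the left comb and the rest is merged
  recursively. An empty left comb is removed by \<open>lun\<close>; \<open>run\<close> is needed
  exactly when a single leaf meets an empty right comb.\<close>

lemma generated_merge:
  assumes "is_path C a es b" "is_path C b fs c"
  shows "\<exists>p. generated v p \<and> src p = Node (comb a es) (comb b fs) \<and> trg p = comb a (es @ fs)"
  using assms
proof (induction a es rule: comb.induct)
  case (1 a)
  then have "a = b" by simp
  then show ?case
    using comb_typed[OF 1(2)] by (intro exI[of _ "lun (comb b fs)"]) (simp add: gen_lun)
next
  case (2 a e)
  then have e: "fst e = a" "snd e = b" "a \<in> C" "b \<in> C" by auto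
  show ?case
  proof (cases "fs = []")
    case True
    then show ?thesis using e by (intro exI[of _ "run (leaf e)"]) (simp add: gen_run)
  next
    case False
    then show ?thesis
      using e comb_typed[OF 2(2)]
      by (intro exI[of _ "idn (Node (leaf e) (comb b fs))"]) (simp add: gen_idn comb_Cons)
  qed
next
  case (3 a e e' es)
  let ?es = "e' # es"
  have e: "fst e = a" "a \<in> C" "is_path C (snd e) ?es b" using "3.prems" by auto
  have c: "snd e \<in> C" using is_path_ends[OF e(3)] by simp
  obtain p where p: "generated v p" "src p = Node (comb (snd e) ?es) (comb b fs)" "trg p = comb (snd e) (?es @ fs)"
    using "3.IH"[OF e(3) "3.prems"(2)] by blast
  note t = comb_typed[OF e(3)] comb_typed[OF "3.prems"(2)]
  let ?p = "cmp (assr (leaf e) (comb (snd e) ?es) (comb b fs)) (ten (idn (leaf e)) p)"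
  have "generated v ?p"
    using p t e c by (intro gen_cmp gen_ten gen_assr gen_idn) simp_all
  then show ?case using p(3) by (intro exI[of _ ?p]) simp
qed

lemma generated_comb:
  "typed C X \<Longrightarrow> \<exists>p. generated v p \<and> src p = X \<and> trg p = comb (left_end X) (leaves X)"
proof (induction X)
  case (Leaf a b)
  then show ?case by (intro exI[of _ "idn (Leaf a b)"]) (simp add: gen_idn)
next
  case (Unit a)
  then show ?case by (intro exI[of _ "idn (Unit a)"]) (simp add: gen_idn)
next
  case (Node X Y)
  have t: "typed C X" "typed C Y" "right_end X = left_end Y" using Node.prems by auto
  obtain p where p: "generated v p" "src p = X" "trg p = comb (left_end X) (leaves X)" using Node.IH(1)[OF t(1)] by blast
  obtain q where q: "generated v q" "src q = Y" "trg q = comb (left_end Y) (leaves Y)" using Node.IH(2)[OF t(2)] by blast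
  obtain r where r: "generated v r" "src r = Node (comb (left_end X) (leaves X)) (comb (left_end Y) (leaves Y))"
    "trg r = comb (left_end X) (leaves X @ leaves Y)"
    using generated_merge[OF typed_is_path[OF t(1)] typed_is_path[OF t(2), folded t(3)]] t(3) by metis
  have "generated v (cmp (ten p q) r)"
    using p q r t by (intro gen_cmp gen_ten) simp_all
  then show ?case using p q r by (intro exI[of _ "cmp (ten p q) r"]) simp
qed

lemma generated_comb_forest:
  "\<forall>X\<in>set Xs. typed C X \<Longrightarrow> \<exists>ps. (\<forall>p\<in>set ps. generated v p) \<and> srcs ps = Xs \<and>
     trgs ps = map (\<lambda>X. comb (left_end X) (leaves X)) Xs"
proof (induction Xs)
  case (Cons X Xs)
  then obtain ps where ps: "\<forall>p\<in>set ps. generated v p" "srcs ps = Xs" "trgs ps = map (\<lambda>X. comb (left_end X) (leaves X)) Xs"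
    by auto
  obtain p where "generated v p" "src p = X" "trg p = comb (left_end X) (leaves X)"
    using generated_comb[of X v] Cons.prems by auto
  then show ?case using ps by (intro exI[of _ "p # ps"]) simp
qed simp

end

section \<open>Termination and confluence\<close>

context free_bicat
begin

text \<open>Any representative may be chosen because terms for the same 2-cell have the same
  forest.\<close>

definition cell_weight :: "'a bicat_term set \<Rightarrow> nat" where
  "cell_weight X = forest_weight (term_forest (SOME t. t \<in> X))"

lemma cell_weight: "W t \<Longrightarrow> bdim t = 2 \<Longrightarrow> cell_weight (cl t) = forest_weight (term_forest t)"
proof -
  assume t: "W t" "bdim t = 2"
  have "(SOME u. u \<in> cl t) \<in> cl t" by (rule someI[of _ t]) (rule self_class[OF t(1)])
  then have "same_cell t (SOME u. u \<in> cl t)" using same_cell by (simp add: cell_class_def)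
  then show ?thesis using t by (simp add: cell_weight_def same_cell_def)
qed

end

theorem BiCat_terminating: "three_terminating (BiCat C)"
proof -
  interpret free_bicat C 3 3 by unfold_locales simp_all
  have F: "free_ncat 3 (BiCat C) = K" by (simp add: free_ncat_def)
  \<comment> \<open>Gives antisymmetry as well as well-foundedness.\<close>
  have decr: "u = v \<or> cell_weight v < cell_weight u" if uv: "(u, v) \<in> rewrites3 (BiCat C)" for u v
  proof -
    obtain A where A: "A \<in> cells K 3" "csrc K A = u" "ctgt K A = v" using uv by (auto simp: rewrites3_def F)
    obtain t where t: "A = cl t" "W t" "bdim t = 3" using cellE[OF A(1)] by auto
    obtain ps where ps: "\<forall>q\<in>set ps. generated False q" "srcs ps = term_forest (bsrc t)" "trgs ps = term_forest (btgt t)"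
      using cl_forest3[OF t(2,3)] by auto
    note b = boundary3[OF t(2,3)]
    have d: "tdim (BiCat C) t = Suc 2" using t(3) by simp
    have u: "u = cl (bsrc t)" "v = cl (btgt t)" using A t class_boundary[OF t(2) d] by simp_all
    show ?thesis
      using forest_weight[OF ps(1)] ps(2,3) b A t u cell_weight[OF b(1)] cell_weight[OF b(2)]
      by (auto simp: good2_def)
  qed
  have "refl_on (cells K 2) (rewrites3 (BiCat C))"
  proof (rule refl_onI)
    fix u assume u: "u \<in> cells K 2"
    then have "hom3 (csrc K (csrc K u)) (ctgt K (csrc K u)) (csrc K u) (ctgt K u) u u (cid K u)"
      by (intro hom3_id hom2I)
    then show "(u, u) \<in> rewrites3 (BiCat C)" using u by (auto simp: rewrites3_def F hom3_def)
  qed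
  moreover have "trans (rewrites3 (BiCat C))"
  proof (rule transI)
    fix u v w assume "(u, v) \<in> rewrites3 (BiCat C)" "(v, w) \<in> rewrites3 (BiCat C)"
    then obtain A B where A: "A \<in> cells K 3" "csrc K A = u" "ctgt K A = v" "u \<in> cells K 2" "w \<in> cells K 2"
      and B: "B \<in> cells K 3" "csrc K B = v" "ctgt K B = w"
      by (auto simp: rewrites3_def F)
    have "composable K 3 2 A B" using A B by (simp add: composable_def at_unfold)
    from ccomp_cell[OF this] csrc_ccomp[OF this] ctgt_ccomp[OF this]
    show "(u, w) \<in> rewrites3 (BiCat C)" using A B by (auto simp: rewrites3_def F)
  qed
  moreover have "antisym (rewrites3 (BiCat C))"
  proof (rule antisymI)
    fix u v assume uv: "(u, v) \<in> rewrites3 (BiCat C)" "(v, u) \<in> rewrites3 (BiCat C)"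
    show "u = v" using decr[OF uv(1)] decr[OF uv(2)] by (elim disjE) simp_all
  qed
  moreover have "rewrites3 (BiCat C) \<subseteq> cells K 2 \<times> cells K 2"
    by (auto simp: rewrites3_def F)
  moreover have "wf ((rewrites3 (BiCat C))\<inverse> - Id)"
  proof (rule wf_subset[OF wf_measure[of cell_weight]], rule subsetI)
    fix x assume "x \<in> (rewrites3 (BiCat C))\<inverse> - Id"
    then obtain u v where "x = (v, u)" "(u, v) \<in> rewrites3 (BiCat C)" "u \<noteq> v" by blast
    then show "x \<in> measure cell_weight" using decr[of u v] by simp
  qed
  ultimately show ?thesis
    by (simp add: three_terminating_def partial_order_on_def preorder_on_def F)
qed

theorem BiCat_confluent: "three_confluent (BiCat C)"
proof -
  interpret free_bicat C 3 3 by unfold_locales simp_all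
  have F: "free_ncat 3 (BiCat C) = K" by (simp add: free_ncat_def)
  \<comment> \<open>The common target consists of the combs of the source trees. It depends on the
    source alone, so that completing every 3-cell to this target already gives confluence, without
    an analysis of critical branchings.\<close>
  let ?N = "\<lambda>t. forest (term_start (bsrc t)) (map (\<lambda>X. comb (left_end X) (leaves X)) (term_forest (bsrc t)))"
  have complete: "\<exists>A'\<in>cells K 3. composable K 3 2 (cl t) A' \<and> ctgt K (ccomp K 2 (cl t) A') = ?N t"
    if t: "W t" "bdim t = 3" for t
  proof -
    obtain ps where ps: "\<forall>q\<in>set ps. generated False q" "srcs ps = term_forest (bsrc t)" "trgs ps = term_forest (btgt t)"
      using cl_forest3[OF t] by auto
    note b = boundary3[OF t]
    obtain qs where qs: "\<forall>q\<in>set qs. generated False q" "srcs qs = term_forest (btgt t)"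
      "trgs qs = map (\<lambda>X. comb (left_end X) (leaves X)) (term_forest (btgt t))"
      using generated_comb_forest[of "term_forest (btgt t)" False] b(4) by (auto simp: good2_def is_forest_def)
    have a: "\<forall>q\<in>set ps. arrow q" "\<forall>q\<in>set qs. arrow q" using ps(1) qs(1) generated_arrow by blast+
    \<comment> \<open>Arrows preserve left ends and leaves, so source and target trees have the same
      combs.\<close>
    have "map (\<lambda>X. comb (left_end X) (leaves X)) (trgs ps) = map (\<lambda>X. comb (left_end X) (leaves X)) (srcs ps)"
      using a(1) by (simp add: arrowD(4,6))
    then have N: "forest (term_start (bsrc t)) (trgs qs) = ?N t" using ps qs by simp
    have f: "is_forest C (term_start (bsrc t)) (srcs qs) (term_end (bsrc t))"
      using b(4-6) qs(2) by (simp add: good2_def)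
    let ?A' = "forest3 (term_start (bsrc t)) qs"
    note h = forest3_hom[OF a(2) f]
    have A: "cl t \<in> cells K 3" using t class_cell_iff by simp
    have c: "composable K 3 2 (cl t) ?A'"
      using h A b(8) qs(2) by (simp add: composable_def at_unfold hom3_def)
    have "?A' \<in> cells K 3" using h by (simp add: hom3_def)
    moreover have "ctgt K (ccomp K 2 (cl t) ?A') = ?N t"
      using ctgt_ccomp[OF c] hom3D(4)[OF h] N by simp
    ultimately show ?thesis using c by blast
  qed
  show ?thesis
    unfolding three_confluent_def Let_def F
  proof (intro ballI impI)
    fix A B assume A: "A \<in> cells K 3" and B: "B \<in> cells K 3" and e: "csrc K A = csrc K B"
    obtain t where t: "A = cl t" "W t" "bdim t = 3" using cellE[OF A] by auto
    obtain u where u: "B = cl u" "W u" "bdim u = 3" using cellE[OF B] by auto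
    have d: "tdim (BiCat C) t = Suc 2" "tdim (BiCat C) u = Suc 2" using t u by simp_all
    have "cl (bsrc t) = cl (bsrc u)"
      using e t u class_boundary[OF t(2) d(1)] class_boundary[OF u(2) d(2)] by simp
    then have "same_cell (bsrc t) (bsrc u)"
      using same_cell cell_class_eq_iff boundary3(1)[OF t(2,3)] by blast
    then have "?N t = ?N u" using boundary3(3)[OF t(2,3)] by (simp add: same_cell_def good2_def)
    then show "\<exists>A'\<in>cells K 3. \<exists>B'\<in>cells K 3. composable K 3 2 A A' \<and> composable K 3 2 B B' \<and>
        ctgt K (ccomp K 2 A A') = ctgt K (ccomp K 2 B B')"
      unfolding t(1) u(1) using complete[OF t(2,3)] complete[OF u(2,3)] by fastforce
  qed
qed

section \<open>Connection by 4-cells as a congruence on 3-cells\<close>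

context free_bicat
begin

definition homotopic :: "'a bicat_term set \<Rightarrow> 'a bicat_term set \<Rightarrow> bool" where
  "homotopic A B \<longleftrightarrow> (\<exists>h\<in>cells K 4. csrc K h = A \<and> ctgt K h = B)"

text \<open>The connecting 4-cells are composed along the same dimension. It lies below three, so
  the iterated boundaries of a 4-cell are those of either of its 3-dimensional boundaries, and
  composability is inherited.\<close>

lemma homotopic_comp:
  assumes "homotopic A A'" "homotopic B B'" "composable K 3 i A B"
  shows "homotopic (ccomp K i A B) (ccomp K i A' B')"
proof -
  obtain h k where h: "h \<in> cells K 4" "csrc K h = A" "ctgt K h = A'" and k: "k \<in> cells K 4" "csrc K k = B" "ctgt K k = B'"
    using assms(1,2) by (auto simp: homotopic_def)
  have i: "i < 3" using assms(3) by (simp add: composable_def)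
  have p: "parallel K 3 A A'" using globular[of h 3] h by simp
  have s: "Suc (Suc (Suc (Suc 0))) - i = Suc (3 - i)" "3 - i = Suc (2 - i)" using i by auto
  have "ctgt_at K 4 i h = ctgt_at K 3 i A'" "csrc_at K 4 i k = csrc_at K 3 i B"
    using h k s(1) by (simp_all add: ctgt_at_def csrc_at_def eval_nat_numeral funpow_swap1)
  moreover have "ctgt_at K 3 i A' = ctgt_at K 3 i A"
    unfolding ctgt_at_def s(2) using p by (simp add: parallel_def funpow_swap1)
  ultimately have c: "composable K 4 i h k"
    using assms(3) h k by (simp add: composable_def)
  show ?thesis
    unfolding homotopic_def using ccomp_cell[OF c] csrc_ccomp[OF c] ctgt_ccomp[OF c] i h k
    by (intro bexI[of _ "ccomp K i h k"]) auto
qed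

lemma homotopic_gen:
  assumes "4 \<le> n" "set_bicat_gen g \<subseteq> C" "bicat_dim g = 4"
  shows "homotopic (denote (bicat_src g)) (denote (bicat_tgt g))"
proof -
  have d: "bicat_dim g = Suc 3" "bicat_dim g \<le> n" using assms by simp_all
  have "cl (Gen g) \<in> cells K 4" using gen_cell(1)[OF assms(2) d(2,1)] by simp
  then show ?thesis
    unfolding homotopic_def using gen_cell(2,3)[OF assms(2) d(2,1)] by blast
qed

text \<open>The boundary of \<open>G_pi\<close> is spelled out as a composite in \<open>K\<close> in
  order to match the hypothesis of \<open>coherent_cells\<close> literally.\<close>

lemma homotopic_pentagon:
  assumes "4 \<le> n" "a \<in> C" "b \<in> C" "c \<in> C" "d \<in> C" "e \<in> C"
  shows "homotopic
    (ccomp K 2 (ccomp K 2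
      (ccomp K (Suc 0) (ccomp K 0 (cl (t_alpha a b c d)) (cid K (cid K (cl (t_e d e))))) (cid K (cl (t_m a d e))))
      (ccomp K (Suc 0) (cid K (ccomp K 0 (ccomp K 0 (cid K (cl (t_e a b))) (cl (t_m b c d))) (cid K (cl (t_e d e)))))
        (cl (t_alpha a b d e))))
      (ccomp K (Suc 0) (ccomp K 0 (cid K (cid K (cl (t_e a b)))) (cl (t_alpha b c d e))) (cid K (cl (t_m a b e)))))
    (ccomp K 2
      (ccomp K (Suc 0) (cid K (ccomp K 0 (ccomp K 0 (cl (t_m a b c)) (cid K (cl (t_e c d)))) (cid K (cl (t_e d e)))))
        (cl (t_alpha a c d e)))
      (ccomp K (Suc 0) (cid K (ccomp K 0 (cid K (ccomp K 0 (cl (t_e a b)) (cl (t_e b c)))) (cl (t_m c d e))))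
        (cl (t_alpha a b c e))))"
  using homotopic_gen[of "G_pi a b c d e"] assms by (simp add: bicat_unfold)

lemma homotopic_triangle:
  assumes "4 \<le> n" "a \<in> C" "b \<in> C" "c \<in> C"
  shows "homotopic
    (ccomp K 2
      (ccomp K (Suc 0) (cid K (ccomp K 0 (ccomp K 0 (cid K (cl (t_e a b))) (cl (t_i b))) (cid K (cl (t_e b c)))))
        (cl (t_alpha a b b c)))
      (ccomp K (Suc 0) (ccomp K 0 (cid K (cid K (cl (t_e a b)))) (cl (t_lambda b c))) (cid K (cl (t_m a b c)))))
    (ccomp K (Suc 0) (ccomp K 0 (cl (t_rho a b)) (cid K (cid K (cl (t_e b c))))) (cid K (cl (t_m a b c))))"
  using homotopic_gen[of "G_kappa a b c"] assms by (simp add: bicat_unfold)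

end

theorem BiCat_coherent: "three_coherent (free_npcat 4 2 (BiCat C))"
proof -
  interpret free_bicat C 4 2 by unfold_locales simp_all
  interpret np: strict_npcategory 4 2 K by (rule free_strict_npcategory)
  interpret coherent_cells 4 K C "\<lambda>a. cl (t_obj a)" "\<lambda>a b. cl (t_e a b)" "\<lambda>a b c. cl (t_m a b c)" "\<lambda>a. cl (t_i a)"
    "\<lambda>a b c d. cl (t_alpha a b c d)" "\<lambda>a b. cl (t_lambda a b)" "\<lambda>a b. cl (t_rho a b)" homotopic
  proof
    show "homotopic A A" if "A \<in> cells K 3" for A
      unfolding homotopic_def using that cid_cell[of A 3] csrc_cid[of A 3] ctgt_cid[of A 3]
      by (intro bexI[of _ "cid K A"]) simp_all
    \<comment> \<open>For \<open>p = 2\<close> the 4-cells are invertible along 3-cells, and the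
      inverse connects the two in the other direction.\<close>
    show "homotopic B A" if AB: "homotopic A B" for A B
    proof -
      obtain h where h: "h \<in> cells K (Suc 3)" "csrc K h = A" "ctgt K h = B" using AB by (auto simp: homotopic_def)
      obtain k where "composable K (Suc 3) 3 h k" "composable K (Suc 3) 3 k h"
        using np.invertible[OF _ h(1)] by (auto simp: invertible_cell_def)
      then show ?thesis
        using h unfolding homotopic_def by (intro bexI[of _ k]) (simp_all add: composable_def csrc_at_def ctgt_at_def)
    qed
    show "homotopic A D" if AB: "homotopic A B" and BD: "homotopic B D" for A B D
    proof -
      obtain h k where h: "h \<in> cells K 4" "csrc K h = A" "ctgt K h = B" and k: "k \<in> cells K 4" "csrc K k = B" "ctgt K k = D"
        using AB BD by (auto simp: homotopic_def)
      have c: "composable K 4 3 h k" using h k by (simp add: composable_def csrc_at_def ctgt_at_def)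
      show ?thesis
        unfolding homotopic_def using ccomp_cell[OF c] csrc_ccomp[OF c] ctgt_ccomp[OF c] h k
        by (intro bexI[of _ "ccomp K 3 h k"]) simp_all
    qed
    show "parallel K 3 A B" if "homotopic A B" for A B
      using that globular[of _ 3] by (auto simp: homotopic_def)
    show "homotopic (ccomp K i A B) (ccomp K i A' B')" if "homotopic A A'" "homotopic B B'" "composable K 3 i A B" for A A' B B' i
      using that by (rule homotopic_comp)
    show "invertible_cell K 2 A" if "A \<in> cells K 3" for A
      using np.invertible[of 2 A] that by simp
  qed (rule homotopic_pentagon homotopic_triangle; simp)+
  show ?thesis
    unfolding three_coherent_def
  proof (intro allI impI)
    fix f g assume p: "parallel K 3 f g"
    then have fg: "f \<in> cells K 3" "g \<in> cells K 3" by (simp_all add: parallel_def)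
    obtain t where t: "f = cl t" "W t" "bdim t = 3" using cellE[OF fg(1)] by auto
    obtain u where u: "g = cl u" "W u" "bdim u = 3" using cellE[OF fg(2)] by auto
    obtain ps where ps: "\<forall>q\<in>set ps. generated True q" "srcs ps = term_forest (bsrc t)" "trgs ps = term_forest (btgt t)"
      "cl t = forest3 (term_start (bsrc t)) ps"
      using cl_forest3[OF t(2,3)] by auto
    obtain qs where qs: "\<forall>q\<in>set qs. generated True q" "srcs qs = term_forest (bsrc u)" "trgs qs = term_forest (btgt u)"
      "cl u = forest3 (term_start (bsrc u)) qs"
      using cl_forest3[OF u(2,3)] by auto
    have d: "tdim (BiCat C) t = Suc 2" "tdim (BiCat C) u = Suc 2" using t u by simp_all
    have "cl (bsrc t) = cl (bsrc u)" "cl (btgt t) = cl (btgt u)"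
      using p t u class_boundary[OF t(2) d(1)] class_boundary[OF u(2) d(2)] by (simp_all add: parallel_def)
    \<comment> \<open>Equal boundary classes have equal forests, so the two lists of arrows have the
      same source trees and the same target trees.\<close>
    then have s: "same_cell (bsrc t) (bsrc u)" "same_cell (btgt t) (btgt u)"
      using same_cell cell_class_eq_iff boundary3(1,2)[OF t(2,3)] by blast+
    have "homotopic (forest3 (term_start (bsrc t)) ps) (forest3 (term_start (bsrc t)) qs)"
      using s ps qs boundary3(3,4)[OF t(2,3)]
      by (intro forest3_eqv[where b = "term_end (bsrc t)"]) (simp_all add: same_cell_def good2_def)
    then show "\<exists>h\<in>cells K 4. csrc K h = f \<and> ctgt K h = g"
      using s ps(4) qs(4) t(1) u(1) boundary3(3)[OF t(2,3)]
      by (simp add: homotopic_def same_cell_def good2_def)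
  qed
qed

theorem theorem3p1p6:
  fixes C :: "'a set"
  shows "three_convergent (BiCat C) \<and> three_coherent (free_npcat 4 2 (BiCat C))"
  using BiCat_terminating BiCat_confluent BiCat_coherent by (auto simp: three_convergent_def)

end
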